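(* Let $k$ be an infinite field, let $\mathfrak{F}\colon\mathbb{P}^n_k\dashrightarrow\mathbb{P}^n_k$ be a Cremona map, $\mathfrak{F}=(f_0:\cdots:f_n)$ with $f_0,\ldots,f_n\in R=k[x_0,\ldots,x_n]$ forms of the same degree with $\gcd(f_0,\ldots,f_n)=1$, and let $I=(f_0,\ldots,f_n)\subset R$ be its base ideal. Assume that $\operatorname{depth}(R/I)>0$. Let the inverse map be represented by forms $g_0,\ldots,g_n\in S=k[y_0,\ldots,y_n]$ of the same degree $d'$ with $\gcd(g_0,\ldots,g_n)=1$, so that $d'$ is the degree of the inverse map, and let $D\in R$ be the source inversion factor of $\mathfrak{F}$ relative to $(g_0,\ldots,g_n)$. Suppose that: (i) for every $\ell\ge 1$ the $R$-module $I^{(\ell)}/I^{\ell}$ is either zero or $(x_0,\ldots,x_n)$-primary; (ii) the Rees algebra $\mathcal{R}(I)=R[It]$ satisfies Serre's property $(S_2)$. Then: (a) The symbolic Rees algebra of $I$ is $\mathcal{R}^{(I)}=R[It,Dt^{d'}]$ (as subalgebras of $R[t]$). (b) If $\mathcal{I}\subset k[\mathbf{x},\mathbf{y}]=k[x_0,\ldots,x_n,y_0,\ldots,y_n]$ denotes the presentation ideal of $R[It]$ (the kernel of the $R$-algebra map $R[\mathbf y]\to R[It]$, $y_i\mapsto f_it$), then the presentation ideal of $\mathcal{R}^{(I)}$ on $k[\mathbf{x},\mathbf{y},z]$ (the kernel of the $R$-algebra map with $y_i\mapsto f_it$, $z\mapsto Dt^{d'}$) is $$\left(\mathcal{I},\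 \{x_iz-g_i(\mathbf{y}) : 0\le i\le n\}\right).$$
   Context: A Cremona map of $\mathbb{P}^n$ is a birational map $\mathbb{P}^n\dashrightarrow\mathbb{P}^n$; it is given by $n+1$ forms of the same degree without nontrivial common factor (this common degree is the degree of the map), and the ideal they generate is its base ideal. Source inversion factor: if forms $g_0,\ldots,g_n\in k[y_0,\ldots,y_n]$ represent the inverse map of $\mathfrak{F}=(f_0:\cdots:f_n)$, then there is a uniquely determined form $D\in R$ with $g_i(f_0,\ldots,f_n)=x_iD$ for all $i=0,\ldots,n$; $D$ is called the source inversion factor of $\mathfrak{F}$ relative to the representative $(g_0,\ldots,g_n)$. Symbolic powers: for an ideal $I\subset R$ and $\ell\ge1$, $I^{(\ell)}:=\iota^{-1}(W^{-1}I^{\ell})$, where $W\subset R$ is the complement of the union of all associated primes of $R/I$ (not only the minimal ones) and $\iota\colon R\to W^{-1}R$ is the canonical homomorphism. The symbolic Rees algebra is $\mathcal{R}^{(I)}=\bigoplus_{\ell\ge0}I^{(\ell)}t^{\ell}\subset R[t]$, with $I^{(0)}=R$. The Rees algebra is $\mathcal{R}(I)=R[It]\subset R[t]$. A nonzero finitely generated module is $\mathfrak{p}$-primary if $\mathfrak{p}$ is its only associated prime. *)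

theory Defs
  imports
    "HOL-Library.Poly_Mapping"
    "HOL-Library.Extended_Nat"
    "HOL-Computational_Algebra.Polynomial"
    "HOL-Algebra.Algebraic_Closure_Type"
    "HOL-Algebra.Generated_Rings"
    "HOL-Algebra.Ideal_Product"
    "HOL-Algebra.Module"
begin

definition self_module :: "'a ring \<Rightarrow> ('a, 'a) module" where
  "self_module A =
     \<lparr>carrier = carrier A, monoid.mult = monoid.mult A, one = one A, zero = zero A, add = add A,
      module.smult = monoid.mult A\<rparr>"

text \<open>The quotient of a module by a submodule, with cosets as elements. A module record also carries
  the fields \<open>mult\<close> and \<open>one\<close>, which play no role for modules.\<close>

definition quot_module :: "('a, 'm) module \<Rightarrow> 'm set \<Rightarrow> ('a, 'm set) module" where
  "quot_module M N =
     \<lparr>carrier = a_rcosets\<^bsub>M\<^esub> N, monoid.mult = undefined, one = undefined, zero = N, add = set_add M,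
      module.smult = (\<lambda>a B. \<Union>x\<in>B. N +>\<^bsub>M\<^esub> (a \<odot>\<^bsub>M\<^esub> x))\<rparr>"

definition gen_submodule :: "'a ring \<Rightarrow> ('a, 'm) module \<Rightarrow> 'm set \<Rightarrow> 'm set" where
  "gen_submodule A M E = \<Inter>{N. submodule N A M \<and> E \<subseteq> N}"

definition ideal_smult :: "'a ring \<Rightarrow> 'a set \<Rightarrow> ('a, 'm) module \<Rightarrow> 'm set" where
  "ideal_smult A J M = gen_submodule A M {a \<odot>\<^bsub>M\<^esub> x | a x. a \<in> J \<and> x \<in> carrier M}"

definition fin_gen_module :: "'a ring \<Rightarrow> ('a, 'm) module \<Rightarrow> bool" where
  "fin_gen_module A M \<longleftrightarrow> (\<exists>E. finite E \<and> E \<subseteq> carrier M \<and> gen_submodule A M E = carrier M)"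

definition assoc_primes :: "'a ring \<Rightarrow> ('a, 'm) module \<Rightarrow> 'a set set" where
  "assoc_primes A M =
     {P. primeideal P A \<and> (\<exists>x\<in>carrier M. P = {a \<in> carrier A. a \<odot>\<^bsub>M\<^esub> x = \<zero>\<^bsub>M\<^esub>})}"

definition zero_module :: "('a, 'm) module \<Rightarrow> bool" where
  "zero_module M \<longleftrightarrow> carrier M = {\<zero>\<^bsub>M\<^esub>}"

definition primary_module :: "'a ring \<Rightarrow> 'a set \<Rightarrow> ('a, 'm) module \<Rightarrow> bool" where
  "primary_module A P M \<longleftrightarrow> \<not> zero_module M \<and> fin_gen_module A M \<and> assoc_primes A M = {P}"

definition regular_seq :: "'a ring \<Rightarrow> ('a, 'm) module \<Rightarrow> 'a list \<Rightarrow> bool" where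
  "regular_seq A M as \<longleftrightarrow>
     set as \<subseteq> carrier A \<and>
     (\<forall>i<length as. \<forall>B \<in> carrier (quot_module M (ideal_smult A (set (take i as)) M)).
        (as ! i) \<odot>\<^bsub>quot_module M (ideal_smult A (set (take i as)) M)\<^esub> B
          = \<zero>\<^bsub>quot_module M (ideal_smult A (set (take i as)) M)\<^esub>
        \<longrightarrow> B = \<zero>\<^bsub>quot_module M (ideal_smult A (set (take i as)) M)\<^esub>) \<and>
     ideal_smult A (set as) M \<noteq> carrier M"

text \<open>Depth of \<open>M\<close> in the ideal \<open>J\<close>, with the usual convention that it is infinite if \<open>JM = M\<close>.\<close>

definition depth :: "'a ring \<Rightarrow> 'a set \<Rightarrow> ('a, 'm) module \<Rightarrow> enat" where
  "depth A J M =
     (if ideal_smult A J M = carrier M then \<infinity>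
      else Sup {enat (length as) | as. set as \<subseteq> J \<and> regular_seq A M as})"

definition krull_dim :: "'a ring \<Rightarrow> enat" where
  "krull_dim A =
     Sup {enat (length Ps - 1) | Ps. Ps \<noteq> [] \<and> (\<forall>P\<in>set Ps. primeideal P A) \<and> sorted_wrt (\<subset>) Ps}"

definition loc_rel :: "'a ring \<Rightarrow> 'a set \<Rightarrow> (('a \<times> 'a) \<times> ('a \<times> 'a)) set" where
  "loc_rel A W =
     {((a, s), (b, t)) | a s b t. a \<in> carrier A \<and> s \<in> W \<and> b \<in> carrier A \<and> t \<in> W \<and>
        (\<exists>u\<in>W. u \<otimes>\<^bsub>A\<^esub> (a \<otimes>\<^bsub>A\<^esub> t \<ominus>\<^bsub>A\<^esub> b \<otimes>\<^bsub>A\<^esub> s) = \<zero>\<^bsub>A\<^esub>)}"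

definition loc_frac :: "'a ring \<Rightarrow> 'a set \<Rightarrow> 'a \<Rightarrow> 'a \<Rightarrow> ('a \<times> 'a) set" where
  "loc_frac A W a s = loc_rel A W `` {(a, s)}"

text \<open>The ring \<open>W\<^sup>-\<^sup>1A\<close>. The unions defining the operations range over representatives of the two
  classes; each is a union of equal sets.\<close>

definition localization :: "'a ring \<Rightarrow> 'a set \<Rightarrow> ('a \<times> 'a) set ring" where
  "localization A W =
     \<lparr>carrier = (carrier A \<times> W) // loc_rel A W,
      monoid.mult = (\<lambda>B C. \<Union>(a, s)\<in>B. \<Union>(b, t)\<in>C. loc_frac A W (a \<otimes>\<^bsub>A\<^esub> b) (s \<otimes>\<^bsub>A\<^esub> t)),
      one = loc_frac A W \<one>\<^bsub>A\<^esub> \<one>\<^bsub>A\<^esub>,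
      zero = loc_frac A W \<zero>\<^bsub>A\<^esub> \<one>\<^bsub>A\<^esub>,
      add = (\<lambda>B C. \<Union>(a, s)\<in>B. \<Union>(b, t)\<in>C.
               loc_frac A W (a \<otimes>\<^bsub>A\<^esub> t \<oplus>\<^bsub>A\<^esub> b \<otimes>\<^bsub>A\<^esub> s) (s \<otimes>\<^bsub>A\<^esub> t))\<rparr>"

definition loc_ideal :: "'a ring \<Rightarrow> 'a set \<Rightarrow> 'a set \<Rightarrow> ('a \<times> 'a) set set" where
  "loc_ideal A W J = {loc_frac A W a s | a s. a \<in> J \<and> s \<in> W}"

definition serre_S :: "nat \<Rightarrow> 'a ring \<Rightarrow> bool" where
  "serre_S r A \<longleftrightarrow>
     (\<forall>P. primeideal P A \<longrightarrow>
        (let AP = localization A (carrier A - P)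
         in depth AP (loc_ideal A (carrier A - P) P) (self_module AP) \<ge> min (enat r) (krull_dim AP)))"

definition ideal_power :: "'a ring \<Rightarrow> 'a set \<Rightarrow> nat \<Rightarrow> 'a set" where
  "ideal_power A I l = I [^]\<^bsub>ideals_set A\<^esub> l"

text \<open>For \<open>l = 0\<close> this is the whole ring, as \<open>I\<^sup>0\<close> is.\<close>

definition symbolic_power :: "'a ring \<Rightarrow> 'a set \<Rightarrow> nat \<Rightarrow> 'a set" where
  "symbolic_power A I l =
     (let W = carrier A - \<Union>(assoc_primes A (quot_module (self_module A) I))
      in {a \<in> carrier A. loc_frac A W a \<one>\<^bsub>A\<^esub> \<in> loc_ideal A W (ideal_power A I l)})"

text \<open>The type \<open>'a\<close>, and then \<open>'a poly\<close>, is turned into a ring record by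
  \<^const>\<open>ring_of_type_algebra\<close>. For a ring \<open>R\<close> given by the type \<open>'a\<close>, the set \<open>subalgebra_t E\<close>
  is the subalgebra \<open>R[E]\<close> of \<open>R[t]\<close>.\<close>

definition subalgebra_t :: "'a::comm_ring_1 poly set \<Rightarrow> 'a poly set" where
  "subalgebra_t E = generate_ring ring_of_type_algebra (range (\<lambda>a. [:a:]) \<union> E)"

definition rees_algebra :: "'a::comm_ring_1 set \<Rightarrow> 'a poly set" where
  "rees_algebra I = subalgebra_t ((\<lambda>a. Polynomial.monom a 1) ` I)"

definition symbolic_rees_algebra :: "'a::comm_ring_1 set \<Rightarrow> 'a poly set" where
  "symbolic_rees_algebra I = {p. \<forall>l. Polynomial.coeff p l \<in> symbolic_power ring_of_type_algebra I l}"

type_synonym ('v, 'a) mpoly = "('v \<Rightarrow>\<^sub>0 nat) \<Rightarrow>\<^sub>0 'a"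

definition mconst :: "'a::zero \<Rightarrow> ('v, 'a) mpoly" where
  "mconst c = Poly_Mapping.single 0 c"

definition mvar :: "'v \<Rightarrow> ('v, 'a::zero_neq_one) mpoly" where
  "mvar v = Poly_Mapping.single (Poly_Mapping.single v 1) 1"

text \<open>Substitution of \<open>b v\<close> for the variable \<open>v\<close>, with \<open>c\<close> applied to the coefficients: for a ring
  homomorphism \<open>c\<close> the homomorphism of algebras determined by \<open>b\<close>.\<close>

definition msubst :: "('a \<Rightarrow> 'b) \<Rightarrow> ('v \<Rightarrow> 'b) \<Rightarrow> ('v, 'a::zero) mpoly \<Rightarrow> 'b::comm_semiring_1" where
  "msubst c b p =
     (\<Sum>m\<in>Poly_Mapping.keys p.
        c (Poly_Mapping.lookup p m) *
        (\<Prod>v\<in>Poly_Mapping.keys m. b v ^ Poly_Mapping.lookup m v))"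

definition form :: "nat \<Rightarrow> ('v, 'a::zero) mpoly \<Rightarrow> bool" where
  "form d p \<longleftrightarrow>
     (\<forall>m\<in>Poly_Mapping.keys p. (\<Sum>v\<in>Poly_Mapping.keys m. Poly_Mapping.lookup m v) = d)"

definition no_common_factor :: "('i \<Rightarrow> 'a::comm_semiring_1) \<Rightarrow> bool" where
  "no_common_factor f \<longleftrightarrow> (\<forall>p. (\<forall>i. p dvd f i) \<longrightarrow> p dvd 1)"

text \<open>Projective \<open>n\<close>-space has its coordinates indexed by a finite type of \<open>n + 1\<close> elements. A rational
  self-map is represented by a tuple of forms of the same degree, not all zero; two tuples represent the
  same map if they are proportional. The tuple of variables represents the identity. Where the index type
  is required to be linearly ordered, this reflects the numbering of the variables and makes the
  polynomial ring an instance of \<^class>\<open>idom\<close>.\<close>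

definition rational_map_rep :: "('n \<Rightarrow> ('n, 'k::field) mpoly) \<Rightarrow> bool" where
  "rational_map_rep f \<longleftrightarrow> (\<exists>d. \<forall>i. form d (f i)) \<and> (\<exists>i. f i \<noteq> 0)"

definition same_rational_map ::
  "('n \<Rightarrow> ('n, 'k::field) mpoly) \<Rightarrow> ('n \<Rightarrow> ('n, 'k) mpoly) \<Rightarrow> bool" where
  "same_rational_map f h \<longleftrightarrow> (\<forall>i j. f i * h j = f j * h i)"

definition comp_rep ::
  "('n \<Rightarrow> ('n, 'k::field) mpoly) \<Rightarrow> ('n \<Rightarrow> ('n, 'k) mpoly) \<Rightarrow> 'n \<Rightarrow> ('n, 'k) mpoly" where
  "comp_rep g f = (\<lambda>i. msubst mconst f (g i))"

definition represents_inverse ::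
  "('n \<Rightarrow> ('n, 'k::field) mpoly) \<Rightarrow> ('n \<Rightarrow> ('n, 'k) mpoly) \<Rightarrow> bool" where
  "represents_inverse g f \<longleftrightarrow>
     rational_map_rep g \<and> rational_map_rep f \<and>
     rational_map_rep (comp_rep g f) \<and> same_rational_map (comp_rep g f) mvar \<and>
     rational_map_rep (comp_rep f g) \<and> same_rational_map (comp_rep f g) mvar"

definition cremona_map :: "('n \<Rightarrow> ('n, 'k::field) mpoly) \<Rightarrow> bool" where
  "cremona_map f \<longleftrightarrow>
     (\<exists>d. \<forall>i. form d (f i)) \<and> no_common_factor f \<and> (\<exists>h. represents_inverse h f)"

definition base_ideal :: "('n \<Rightarrow> ('n, 'k::field) mpoly) \<Rightarrow> ('n, 'k) mpoly set" where
  "base_ideal f = Idl\<^bsub>ring_of_type_algebra\<^esub> (range f)"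

definition irrelevant_ideal :: "('n, 'k::field) mpoly set" where
  "irrelevant_ideal = Idl\<^bsub>ring_of_type_algebra\<^esub> (range mvar)"

definition source_inversion_factor ::
  "('n \<Rightarrow> ('n, 'k::field) mpoly) \<Rightarrow> ('n \<Rightarrow> ('n, 'k) mpoly) \<Rightarrow> ('n, 'k) mpoly \<Rightarrow> bool" where
  "source_inversion_factor f g D \<longleftrightarrow>
     (\<exists>e. form e D) \<and> (\<forall>i. msubst mconst f (g i) = mvar i * D)"

text \<open>\<open>k[x,y]\<close> is taken as \<open>R[y]\<close> and \<open>k[x,y,z]\<close> as \<open>R[y,z]\<close>, where \<open>R = k[x]\<close>. In the latter the
  variable \<open>y i\<close> has index \<open>Some i\<close> and \<open>z\<close> has index \<open>None\<close>.\<close>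

definition rees_presentation_ideal ::
  "('n \<Rightarrow> ('n, 'k::field) mpoly) \<Rightarrow> ('n, ('n, 'k) mpoly) mpoly set" where
  "rees_presentation_ideal f =
     a_kernel ring_of_type_algebra ring_of_type_algebra
       (msubst (\<lambda>a. [:a:]) (\<lambda>i. Polynomial.monom (f i) 1))"

definition symbolic_presentation_ideal ::
  "('n \<Rightarrow> ('n, 'k::field) mpoly) \<Rightarrow> ('n, 'k) mpoly \<Rightarrow> nat \<Rightarrow> ('n option, ('n, 'k) mpoly) mpoly set" where
  "symbolic_presentation_ideal f D d =
     a_kernel ring_of_type_algebra ring_of_type_algebra
       (msubst (\<lambda>a. [:a:])
         (case_option (Polynomial.monom D d) (\<lambda>i. Polynomial.monom (f i) 1)))"

definition incl_xyz :: "('n, ('n, 'k::field) mpoly) mpoly \<Rightarrow> ('n option, ('n, 'k) mpoly) mpoly" where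
  "incl_xyz = msubst mconst (\<lambda>i. mvar (Some i))"

definition form_in_y :: "('n, 'k::field) mpoly \<Rightarrow> ('n option, ('n, 'k) mpoly) mpoly" where
  "form_in_y = msubst (\<lambda>c. mconst (mconst c)) (\<lambda>i. mvar (Some i))"

end

theory Submission
  imports Defs
begin

text \<open>
  Write \<open>R = k[x]\<close>, \<open>S = k[y]\<close> and \<open>A = R[It]\<close>. Birationality identifies \<open>A\<close> with the Rees algebra
  over \<open>S\<close> of the ideal \<open>(g)\<close>, where \<open>y\<^sub>i\<close> corresponds to \<open>f\<^sub>i t\<close> and \<open>x\<^sub>i\<close> to \<open>g\<^sub>i u\<close>. As
  \<open>g\<^sub>i(f t) = x\<^sub>i D t\<^sup>d\<^sup>'\<close>, the element \<open>D t\<^sup>d\<^sup>'\<close> is \<open>u\<^sup>-\<^sup>1\<close>, and \<open>A[D t\<^sup>d\<^sup>']\<close> is the extended Rees algebra of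
  \<open>(g)\<close>. The grading by powers of \<open>u\<close> is the one in which \<open>H t\<^sup>l\<close>, for a form \<open>H\<close> of degree \<open>e\<close>, has weight
  \<open>e - d l\<close>, where \<open>d\<close> is the degree of the \<open>f\<^sub>i\<close>.

  The hypotheses on depth and on \<open>I\<^sup>(\<^sup>l\<^sup>)/I\<^sup>l\<close> say that \<open>I\<^sup>(\<^sup>l\<^sup>)\<close> consists of the \<open>H\<close> which all \<open>x\<^sub>i\<close>
  multiply into \<open>I\<^sup>l\<close> after raising to a power (\<open>symbolic_power_saturation\<close>, from the existence of
  associated primes). So let \<open>x\<^sub>i\<^sup>s H \<in> I\<^sup>l\<close> for all \<open>i\<close>, with \<open>H\<close> a form. Let \<open>E\<close> be the inversion factor
  on the other side, \<open>f\<^sub>i(g) = y\<^sub>i E\<close>. Substituting \<open>g\<close> shows that \<open>E\<^sup>l\<close> divides every \<open>g\<^sub>i\<^sup>s H(g)\<close>. Because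
  \<open>S\<close> is factorial and the \<open>g\<^sub>i\<close> have no common factor, \<open>E\<^sup>l\<close> divides \<open>H(g)\<close>. The quotient is a form \<open>p\<close> with
  \<open>H t\<^sup>l = p(f t) u\<^sup>a\<close>, where \<open>a\<close> is the weight of \<open>H t\<^sup>l\<close> (\<open>saturated_form\<close>). If \<open>a < 0\<close>, then this is
  visibly in \<open>A[D t\<^sup>d\<^sup>']\<close>. If \<open>a \<ge> 0\<close>, then \<open>g\<^sub>i(f t)\<^sup>a\<close> multiplies it into \<open>A\<close>, and so do powers of all the
  \<open>x\<^sub>i\<close>. The elements of positive weight form a nonzero prime ideal of \<open>A\<close>, generated by the \<open>x\<^sub>i\<close>,
  to which \<open>g\<^sub>i(f t)\<close> does not belong if \<open>g\<^sub>i \<noteq> 0\<close>. The multipliers of \<open>H t\<^sup>l\<close> into \<open>A\<close> therefore lie in no prime of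
  height at most one, and condition \<open>(S\<^sub>2)\<close> gives \<open>H t\<^sup>l \<in> A\<close> (\<open>serre_S2_extension\<close>, \<open>rees_S2\<close>).

  For the presentation, the relations \<open>x\<^sub>i z = g\<^sub>i(y)\<close> bring every polynomial to the form
  \<open>p(x, y) + \<Sum> z\<^sup>m q\<^sub>m(y)\<close> with \<open>m \<ge> 1\<close>. Its image has the part \<open>p(x, f t)\<close> of nonnegative weights and the
  parts \<open>D\<^sup>m t\<^sup>d\<^sup>'\<^sup>m q\<^sub>m(f t)\<close> of weights \<open>-m\<close>. If it vanishes, then all these parts do, and \<open>q\<^sub>m = 0\<close> as
  the \<open>f\<^sub>i\<close> are algebraically independent (\<open>normal_form_kernel\<close>).
\<close>

section \<open>Subrings of a commutative ring, and the Hilbert basis theorem\<close>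

text \<open>Rings are subsets of a type throughout. Adjoining one variable or one element after the other then
  stays within a type, and inductions on the number of generators are possible.\<close>

definition is_subring :: "'a::comm_ring_1 set \<Rightarrow> bool" where
  "is_subring B \<longleftrightarrow> 1 \<in> B \<and> (\<forall>a\<in>B. \<forall>b\<in>B. a - b \<in> B \<and> a * b \<in> B)"

definition is_ideal :: "'a::comm_ring_1 set \<Rightarrow> 'a set \<Rightarrow> bool" where
  "is_ideal B J \<longleftrightarrow> J \<subseteq> B \<and> 0 \<in> J \<and> (\<forall>a\<in>J. \<forall>b\<in>J. a + b \<in> J) \<and> (\<forall>r\<in>B. \<forall>a\<in>J. r * a \<in> J)"

definition is_prime_ideal :: "'a::comm_ring_1 set \<Rightarrow> 'a set \<Rightarrow> bool" where
  "is_prime_ideal B P \<longleftrightarrow>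
     is_ideal B P \<and> 1 \<notin> P \<and> (\<forall>a\<in>B. \<forall>b\<in>B. a * b \<in> P \<longrightarrow> a \<in> P \<or> b \<in> P)"

definition noetherian :: "'a::comm_ring_1 set \<Rightarrow> bool" where
  "noetherian B \<longleftrightarrow>
     (\<forall>J::nat \<Rightarrow> 'a set. (\<forall>i. is_ideal B (J i)) \<and> (\<forall>i. J i \<subseteq> J (Suc i)) \<longrightarrow> (\<exists>N. \<forall>i\<ge>N. J i = J N))"

definition poly_over :: "'a::comm_ring_1 set \<Rightarrow> 'a poly set" where
  "poly_over B = {p. \<forall>i. coeff p i \<in> B}"

definition adjoin :: "'a::comm_ring_1 set \<Rightarrow> 'a \<Rightarrow> 'a set" where
  "adjoin B x = (\<lambda>p. poly p x) ` poly_over B"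

lemma is_subringD:
  assumes "is_subring B"
  shows "1 \<in> B" "0 \<in> B" "a \<in> B \<Longrightarrow> b \<in> B \<Longrightarrow> a - b \<in> B" "a \<in> B \<Longrightarrow> b \<in> B \<Longrightarrow> a + b \<in> B"
    "a \<in> B \<Longrightarrow> b \<in> B \<Longrightarrow> a * b \<in> B" "a \<in> B \<Longrightarrow> - a \<in> B" "a \<in> B \<Longrightarrow> a ^ n \<in> B"
    "(\<And>i. i \<in> Y \<Longrightarrow> h i \<in> B) \<Longrightarrow> sum h Y \<in> B"
proof -
  show one: "1 \<in> B" and diff: "a \<in> B \<Longrightarrow> b \<in> B \<Longrightarrow> a - b \<in> B"
    and mult: "\<And>a b. a \<in> B \<Longrightarrow> b \<in> B \<Longrightarrow> a * b \<in> B" for a b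
    using assms by (auto simp: is_subring_def)
  show zero: "0 \<in> B" using diff[OF one one] by simp
  show neg: "- a \<in> B" if "a \<in> B" for a using diff[OF zero that] by simp
  show add: "a + b \<in> B" if "a \<in> B" "b \<in> B" for a b
    using diff[OF that(1) neg[OF that(2)]] by simp
  show "a ^ n \<in> B" if "a \<in> B" for a using that one mult by (induction n) auto
  show "sum h Y \<in> B" if "\<And>i. i \<in> Y \<Longrightarrow> h i \<in> B"
    using that zero add by (induction Y rule: infinite_finite_induct) auto
qed

lemma is_subring_UNIV: "is_subring UNIV"
  by (simp add: is_subring_def)

lemma is_idealD:
  assumes "is_ideal B J"
  shows "J \<subseteq> B" "0 \<in> J" "a \<in> J \<Longrightarrow> b \<in> J \<Longrightarrow> a + b \<in> J" "r \<in> B \<Longrightarrow> a \<in> J \<Longrightarrow> r * a \<in> J"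
  using assms by (auto simp: is_ideal_def)

lemma is_ideal_diff:
  assumes "is_subring B" "is_ideal B J" "a \<in> J" "b \<in> J"
  shows "a - b \<in> J"
proof -
  have "(- 1) * b \<in> J"
    using assms is_subringD(1,6)[OF assms(1)] is_idealD(4)[OF assms(2)] by blast
  then show ?thesis using is_idealD(3)[OF assms(2) assms(3)] by fastforce
qed

lemma is_subring_poly_over:
  assumes "is_subring B"
  shows "is_subring (poly_over B)"
  unfolding is_subring_def poly_over_def mem_Collect_eq
proof (intro conjI ballI allI)
  show "coeff 1 i \<in> B" for i
    using is_subringD(1,2)[OF assms] by (cases i) auto
  show "coeff (a - b) i \<in> B" if "a \<in> {p. \<forall>i. coeff p i \<in> B}" "b \<in> {p. \<forall>i. coeff p i \<in> B}" for a b i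
    using that is_subringD(3)[OF assms] by simp
  show "coeff (a * b) i \<in> B" if "a \<in> {p. \<forall>i. coeff p i \<in> B}" "b \<in> {p. \<forall>i. coeff p i \<in> B}" for a b i
    unfolding coeff_mult using that
    by (intro is_subringD(8)[OF assms] is_subringD(5)[OF assms]) auto
qed

lemma poly_over_pCons:
  assumes "is_subring B" "a \<in> B" "p \<in> poly_over B"
  shows "pCons a p \<in> poly_over B"
  using assms unfolding poly_over_def by (auto simp: coeff_pCons split: nat.splits)

lemma poly_over_const: "is_subring B \<Longrightarrow> a \<in> B \<Longrightarrow> [:a:] \<in> poly_over B"
  by (rule poly_over_pCons) (auto simp: poly_over_def is_subringD(2))

lemma poly_over_X: "is_subring B \<Longrightarrow> [:0, 1:] \<in> poly_over B"
  by (intro poly_over_pCons poly_over_const is_subringD(1,2))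

lemma adjoin:
  assumes B: "is_subring B"
  shows is_subring_adjoin: "is_subring (adjoin B x)"
    and subset_adjoin: "B \<subseteq> adjoin B x" and mem_adjoin: "x \<in> adjoin B x"
    and adjoin_least: "is_subring C \<Longrightarrow> B \<subseteq> C \<Longrightarrow> x \<in> C \<Longrightarrow> adjoin B x \<subseteq> C"
proof -
  note PB = is_subring_poly_over[OF B]
  show "is_subring (adjoin B x)"
    unfolding is_subring_def
  proof (intro conjI ballI)
    show "1 \<in> adjoin B x"
      unfolding adjoin_def by (rule image_eqI[OF _ is_subringD(1)[OF PB]]) simp
    fix a b assume "a \<in> adjoin B x" "b \<in> adjoin B x"
    then obtain p q where p: "p \<in> poly_over B" "a = poly p x" and q: "q \<in> poly_over B" "b = poly q x"
      by (auto simp: adjoin_def)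
    show "a - b \<in> adjoin B x"
      unfolding adjoin_def by (rule image_eqI[OF _ is_subringD(3)[OF PB p(1) q(1)]]) (simp add: p q)
    show "a * b \<in> adjoin B x"
      unfolding adjoin_def by (rule image_eqI[OF _ is_subringD(5)[OF PB p(1) q(1)]]) (simp add: p q)
  qed
  show "B \<subseteq> adjoin B x"
  proof
    fix b assume "b \<in> B"
    show "b \<in> adjoin B x"
      unfolding adjoin_def by (rule image_eqI[OF _ poly_over_const[OF B \<open>b \<in> B\<close>]]) simp
  qed
  show "x \<in> adjoin B x"
    unfolding adjoin_def by (rule image_eqI[OF _ poly_over_X[OF B]]) simp
  show "adjoin B x \<subseteq> C" if C: "is_subring C" "B \<subseteq> C" "x \<in> C"
  proof
    fix a assume "a \<in> adjoin B x"
    then obtain p where p: "\<And>i. coeff p i \<in> B" "a = poly p x" by (auto simp: adjoin_def poly_over_def)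
    have "coeff p i * x ^ i \<in> C" for i
      using p(1) C by (intro is_subringD(5)[OF C(1)] is_subringD(7)[OF C(1)]) auto
    then show "a \<in> C" unfolding p(2) poly_altdef by (intro is_subringD(8)[OF C(1)])
  qed
qed

text \<open>The coefficients in degree \<open>k\<close> of the polynomials of degree at most \<open>k\<close> in an ideal form an
  ideal of the coefficient ring, and nested ideals with the same coefficient ideals are equal, by
  induction on the degree. For an ascending chain of ideals \<open>J i\<close> the coefficient ideals
  \<open>L k (J i)\<close> ascend in both indices. The diagonal chain stabilises, at \<open>K\<close> say, which settles all
  \<open>k \<ge> K\<close> at once; finitely many chains remain, one for each \<open>k < K\<close>.\<close>

theorem noetherian_adjoin:
  assumes B: "is_subring B" and noeth: "noetherian B"
  shows "noetherian (adjoin B x)"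
  unfolding noetherian_def
proof (intro allI impI, elim conjE)
  fix J :: "nat \<Rightarrow> 'a set"
  assume J: "\<forall>i. is_ideal (adjoin B x) (J i)" and inc: "\<forall>i. J i \<subseteq> J (Suc i)"
  define Q where "Q i = {p \<in> poly_over B. poly p x \<in> J i}" for i
  define L where "L k i = {coeff p k | p. p \<in> Q i \<and> degree p \<le> k}" for k i
  note PB = is_subring_poly_over[OF B]
  have Jmono: "J i \<subseteq> J j" if "i \<le> j" for i j
    using lift_Suc_mono_le[of J, OF _ that] inc by blast
  have Qmono: "Q i \<subseteq> Q j" if "i \<le> j" for i j
    using Jmono[OF that] by (auto simp: Q_def)
  have Qideal: "is_ideal (poly_over B) (Q i)" for i
    unfolding is_ideal_def Q_def
    using is_idealD(2-4)[OF J[rule_format, of i]] is_subringD(2,4,5)[OF PB]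
    by (auto simp: adjoin_def)
  have Lideal: "is_ideal B (L k i)" for k i
    unfolding is_ideal_def
  proof (intro conjI ballI)
    show "L k i \<subseteq> B" by (auto simp: L_def Q_def poly_over_def)
    show "0 \<in> L k i" using is_idealD(2)[OF Qideal] by (force simp: L_def)
    show "a + b \<in> L k i" if ab: "a \<in> L k i" "b \<in> L k i" for a b
    proof -
      obtain p q where "p \<in> Q i" "q \<in> Q i" "degree p \<le> k" "degree q \<le> k"
        "a = coeff p k" "b = coeff q k" using ab unfolding L_def by blast
      then show ?thesis unfolding L_def
        by (auto intro!: exI[of _ "p + q"] is_idealD(3)[OF Qideal] degree_add_le)
    qed
    show "r * a \<in> L k i" if ra: "r \<in> B" "a \<in> L k i" for r a
    proof -
      obtain p where p: "p \<in> Q i" "degree p \<le> k" "a = coeff p k" using ra by (auto simp: L_def)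
      have "smult r p \<in> Q i" using is_idealD(4)[OF Qideal poly_over_const[OF B ra(1)] p(1)] by simp
      moreover have "degree (smult r p) \<le> k" using p(2) degree_smult_le le_trans by blast
      ultimately show ?thesis unfolding L_def using p(3) by (auto intro!: exI[of _ "smult r p"])
    qed
  qed
  have Lmono1: "L k i \<subseteq> L k j" if "i \<le> j" for k i j
    using Qmono[OF that] by (auto simp: L_def)
  have LSuc: "L k i \<subseteq> L (Suc k) i" for k i
  proof
    fix a assume "a \<in> L k i"
    then obtain p where p: "p \<in> Q i" "degree p \<le> k" "a = coeff p k" by (auto simp: L_def)
    have "pCons 0 p \<in> Q i" using is_idealD(4)[OF Qideal poly_over_X[OF B] p(1)] by simp
    moreover have "degree (pCons 0 p) \<le> Suc k" using p(2) by (simp add: degree_pCons_eq_if)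
    ultimately show "a \<in> L (Suc k) i" unfolding L_def using p(3)
      by (auto intro!: exI[of _ "pCons 0 p"])
  qed
  have Lmono2: "L k i \<subseteq> L m i" if "k \<le> m" for k m i
    using lift_Suc_mono_le[of "\<lambda>k. L k i", OF _ that] LSuc by blast
  have Lmono: "L k i \<subseteq> L m j" if "k \<le> m" "i \<le> j" for k m i j
    using Lmono1[OF that(2)] Lmono2[OF that(1)] by blast
  \<comment> \<open>\<open>K\<close> and \<open>n\<close> are the stages at which the diagonal chain and the chain for \<open>k\<close> become stationary.\<close>
  obtain K where K: "\<And>i. i \<ge> K \<Longrightarrow> L i i = L K K"
    using noeth[unfolded noetherian_def, rule_format, of "\<lambda>i. L i i"] Lideal Lmono by auto
  have "\<exists>n. \<forall>i\<ge>n. L k i = L k n" for k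
    using noeth[unfolded noetherian_def, rule_format, of "\<lambda>i. L k i"] Lideal Lmono by auto
  then obtain n where n: "\<And>k i. i \<ge> n k \<Longrightarrow> L k i = L k (n k)" by metis
  define N where "N = Max (insert K (n ` {..<K}))"
  have NK: "N \<ge> K" and Nn: "\<And>k. k < K \<Longrightarrow> N \<ge> n k" by (auto simp: N_def)
  have stable: "L k i = L k N" if "i \<ge> N" for k i
  proof (cases "k < K")
    case True
    then show ?thesis using n[of k i] n[of k N] Nn[of k] that by simp
  next
    case False
    have "L k i \<subseteq> L (max k i) (max k i)" by (rule Lmono) auto
    also have "\<dots> = L K K" using NK that False by (intro K) auto
    also have "\<dots> \<subseteq> L k N" using False NK by (intro Lmono) auto
    finally show ?thesis using Lmono[of k k N i] that by auto
  qed
  have Qstable: "p \<in> Q N" if "p \<in> Q i" "i \<ge> N" for p i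
    using that
  proof (induction "degree p" arbitrary: p rule: less_induct)
    case less
    have "lead_coeff p \<in> L (degree p) i"
      using less(2) unfolding L_def by blast
    then have "lead_coeff p \<in> L (degree p) N"
      using stable[OF less(3)] by blast
    then obtain q where q: "q \<in> Q N" "degree q \<le> degree p" "coeff q (degree p) = lead_coeff p"
      by (auto simp: L_def)
    have qi: "q \<in> Q i" using q(1) Qmono less(3) by blast
    have diff: "p - q \<in> Q i" by (rule is_ideal_diff[OF PB Qideal less(2) qi])
    have "p - q \<in> Q N"
    proof (cases "degree p = 0")
      case True
      then have "p = [:coeff p 0:]" "q = [:coeff q 0:]" using q(2) by (auto dest: degree_0_id)
      then have "p - q = 0" using True q(3) by (metis right_minus_eq)
      then show ?thesis using is_idealD(2)[OF Qideal] by simp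
    next
      case False
      have "degree (p - q) \<le> degree p" using q(2) by (simp add: degree_diff_le)
      moreover have "degree (p - q) \<noteq> degree p"
      proof
        assume eq: "degree (p - q) = degree p"
        have "coeff (p - q) (degree p) = 0" using q(3) by simp
        then have "p - q = 0" using eq by (metis leading_coeff_0_iff)
        then show False using False eq by simp
      qed
      ultimately show ?thesis using less(1)[OF _ diff less(3)] by simp
    qed
    then show ?case using is_idealD(3)[OF Qideal q(1), of "p - q"] by simp
  qed
  have "J i = J N" if "i \<ge> N" for i
  proof
    show "J N \<subseteq> J i" by (rule Jmono[OF that])
    show "J i \<subseteq> J N"
    proof
      fix a assume a: "a \<in> J i"
      then have "a \<in> adjoin B x" using is_idealD(1)[OF J[rule_format]] by blast
      then obtain p where "p \<in> poly_over B" "a = poly p x" by (auto simp: adjoin_def)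
      then show "a \<in> J N" using Qstable[of p i] a that by (simp add: Q_def)
    qed
  qed
  then show "\<exists>N. \<forall>i\<ge>N. J i = J N" by blast
qed

text \<open>Minimality stands in for the subring generated by \<open>B\<close> and \<open>F\<close>. The polynomial ring and the Rees
  algebra are both of this form.\<close>

lemma noetherian_finitely_generated:
  assumes "is_subring B" "noetherian B" "finite F"
  shows "\<exists>C. is_subring C \<and> noetherian C \<and> B \<union> F \<subseteq> C \<and>
           (\<forall>C'. is_subring C' \<longrightarrow> B \<union> F \<subseteq> C' \<longrightarrow> C \<subseteq> C')"
  using assms(3)
proof induction
  case empty
  then show ?case using assms by (intro exI[of _ B]) auto
next
  case (insert x F)
  then obtain C where C: "is_subring C" "noetherian C" "B \<union> F \<subseteq> C"
    "\<And>C'. is_subring C' \<Longrightarrow> B \<union> F \<subseteq> C' \<Longrightarrow> C \<subseteq> C'" by blast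
  show ?case
  proof (intro exI[of _ "adjoin C x"] conjI allI impI)
    show "B \<union> insert x F \<subseteq> adjoin C x"
      using C(3) subset_adjoin[OF C(1), of x] mem_adjoin[OF C(1), of x] by blast
    show "adjoin C x \<subseteq> C'" if "is_subring C'" "B \<union> insert x F \<subseteq> C'" for C'
      using that C(4)[of C'] by (intro adjoin_least[OF C(1)]) auto
  qed (rule is_subring_adjoin[OF C(1)] noetherian_adjoin[OF C(1,2)])+
qed

lemma noetherian_maximal:
  assumes noeth: "noetherian B" and J0: "J0 \<in> F" and F: "\<And>J. J \<in> F \<Longrightarrow> is_ideal B J"
  obtains J where "J \<in> F" "\<And>K. K \<in> F \<Longrightarrow> J \<subseteq> K \<Longrightarrow> K = J"
proof -
  have wf: "wf {(K, J). K \<in> F \<and> J \<in> F \<and> J \<subset> K}"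
    unfolding wf_iff_no_infinite_down_chain
  proof (intro notI, elim exE)
    fix c assume c: "\<forall>i. (c (Suc i), c i) \<in> {(K, J). K \<in> F \<and> J \<in> F \<and> J \<subset> K}"
    have ideal: "is_ideal B (c i)" for i using c[rule_format, of i] by (intro F) simp
    have sub: "c i \<subset> c (Suc i)" for i using c[rule_format, of i] by simp
    have "\<exists>N. \<forall>i\<ge>N. c i = c N"
      using ideal sub by (intro noeth[unfolded noetherian_def, rule_format] conjI allI psubset_imp_subset)
    then obtain N where "\<forall>i\<ge>N. c i = c N" ..
    from this[rule_format, OF le_SucI[OF order_refl]] have "c (Suc N) = c N" .
    then show False using sub[of N] by blast
  qed
  show thesis
  proof (rule wfE_min[OF wf J0])
    fix J assume J: "J \<in> F"
      and min: "\<And>K. (K, J) \<in> {(K, J). K \<in> F \<and> J \<in> F \<and> J \<subset> K} \<Longrightarrow> K \<notin> F"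
    show thesis
    proof (rule that[OF J])
      fix K assume "K \<in> F" "J \<subseteq> K"
      then show "K = J" using min[of K] J by blast
    qed
  qed
qed

text \<open>Divide the ambient ring by \<open>N\<close> and then by all elements killed by powers of \<open>x\<close>. Among the
  annihilators there of nonzero multiples of \<open>h\<close>, a maximal one is prime and does not contain \<open>x\<close>. As
  \<open>B\<close> is Noetherian, one power of \<open>x\<close> suffices for all of its elements, so that it is the annihilator of
  a multiple of \<open>h\<close> modulo \<open>N\<close> itself. For \<open>x = 1\<close> this is the existence of associated primes.\<close>

theorem associated_prime_avoiding:
  fixes h :: "'a::comm_ring_1"
  assumes B: "is_subring B" and noeth: "noetherian B"
    and N: "0 \<in> N" "\<And>u v. u \<in> N \<Longrightarrow> v \<in> N \<Longrightarrow> u + v \<in> N" "\<And>r u. r \<in> B \<Longrightarrow> u \<in> N \<Longrightarrow> r * u \<in> N"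
    and x: "x \<in> B" and h: "\<And>k. x ^ k * h \<notin> N"
  obtains b where "b \<in> B" "is_prime_ideal B {r \<in> B. r * (b * h) \<in> N}" "x \<notin> {r \<in> B. r * (b * h) \<in> N}"
proof -
  define K where "K a = {r \<in> B. \<exists>k. x ^ k * (r * (a * h)) \<in> N}" for a
  have xk: "x ^ k \<in> B" for k using is_subringD(7)[OF B x] .
  have up: "x ^ (k + m) * u \<in> N" if "x ^ k * u \<in> N" for k m u
    using N(3)[OF xk[of m] that] by (simp add: power_add mult_ac)
  have Kideal: "is_ideal B (K a)" for a
    unfolding is_ideal_def
  proof (intro conjI ballI)
    show "K a \<subseteq> B" by (auto simp: K_def)
    show "0 \<in> K a" using N(1) is_subringD(2,4,5)[OF B] by (auto simp: K_def)
    show "r + s \<in> K a" if rs: "r \<in> K a" "s \<in> K a" for r s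
    proof -
      obtain k m where k: "x ^ k * (r * (a * h)) \<in> N" and m: "x ^ m * (s * (a * h)) \<in> N"
        and "r \<in> B" "s \<in> B" using rs by (auto simp: K_def)
      have "x ^ (k + m) * ((r + s) * (a * h)) \<in> N"
        using N(2)[OF up[OF k, of m] up[OF m, of k]] by (simp add: algebra_simps)
      then show ?thesis using \<open>r \<in> B\<close> \<open>s \<in> B\<close> is_subringD(2,4,5)[OF B] by (auto simp: K_def)
    qed
    show "s * r \<in> K a" if rs: "s \<in> B" "r \<in> K a" for r s
    proof -
      obtain k where k: "x ^ k * (r * (a * h)) \<in> N" and "r \<in> B" using rs by (auto simp: K_def)
      have "x ^ k * (s * r * (a * h)) \<in> N" using N(3)[OF rs(1) k] by (simp add: mult_ac)
      then show ?thesis using \<open>r \<in> B\<close> rs(1) is_subringD(2,4,5)[OF B] by (auto simp: K_def)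
    qed
  qed
  have one: "1 \<in> B" by (rule is_subringD(1)[OF B])
  define F where "F = {K a | a. a \<in> B \<and> 1 \<notin> K a}"
  have "1 \<notin> K 1" using h by (auto simp: K_def)
  then have "K 1 \<in> F" using one unfolding F_def by blast
  moreover have "is_ideal B J" if "J \<in> F" for J using that Kideal by (auto simp: F_def)
  ultimately obtain J where J: "J \<in> F" and Jmax: "\<And>L. L \<in> F \<Longrightarrow> J \<subseteq> L \<Longrightarrow> L = J"
    using noetherian_maximal[OF noeth] by metis
  from J obtain a where a: "a \<in> B" "1 \<notin> K a" and Ja: "J = K a" unfolding F_def by blast
  have max: "K c = K a" if "c \<in> B" "1 \<notin> K c" "K a \<subseteq> K c" for c
    using Jmax[of "K c"] that unfolding F_def Ja by blast
  have prime: "is_prime_ideal B (K a)"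
    unfolding is_prime_ideal_def
  proof (intro conjI ballI impI Kideal a(2))
    fix r s assume rs: "r \<in> B" "s \<in> B" "r * s \<in> K a"
    show "r \<in> K a \<or> s \<in> K a"
    proof (rule disjCI)
      assume s: "s \<notin> K a"
      have sa: "s * a \<in> B" using is_subringD(5)[OF B] rs a by blast
      have "1 \<notin> K (s * a)" using s rs(2) one by (auto simp: K_def mult_ac)
      moreover have "K a \<subseteq> K (s * a)"
      proof
        fix t assume t: "t \<in> K a"
        then have "s * t \<in> K a" using is_idealD(4)[OF Kideal rs(2)] by blast
        with t show "t \<in> K (s * a)" by (auto simp: K_def mult_ac)
      qed
      ultimately have "K (s * a) = K a" using max[OF sa] by blast
      moreover have "r \<in> K (s * a)" using rs by (auto simp: K_def mult_ac)
      ultimately show "r \<in> K a" by simp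
    qed
  qed
  \<comment> \<open>\<open>K a\<close> is the union of the ascending ideals \<open>T k\<close>.\<close>
  define T where "T k = {r \<in> B. r * (x ^ k * a * h) \<in> N}" for k
  have Tideal: "is_ideal B (T k)" for k
    unfolding is_ideal_def T_def using N is_subringD(2,4,5)[OF B]
    by (auto simp: distrib_right mult.assoc)
  have Tinc: "T k \<subseteq> T (Suc k)" for k
  proof
    fix r assume "r \<in> T k"
    then show "r \<in> T (Suc k)"
      using N(3)[OF x, of "r * (x ^ k * a * h)"] by (auto simp: T_def mult_ac)
  qed
  obtain M where M: "\<And>i. i \<ge> M \<Longrightarrow> T i = T M"
    using noeth[unfolded noetherian_def, rule_format, of T] Tideal Tinc by auto
  have "K a = T M"
  proof
    show "T M \<subseteq> K a" by (auto simp: T_def K_def mult_ac)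
    show "K a \<subseteq> T M"
    proof
      fix r assume "r \<in> K a"
      then obtain k where r: "r \<in> B" and "x ^ k * (r * (a * h)) \<in> N" by (auto simp: K_def)
      then have "x ^ (k + M) * (r * (a * h)) \<in> N" by (intro up)
      then have "r \<in> T (k + M)" using r by (auto simp: T_def mult_ac)
      then show "r \<in> T M" using M[of "k + M"] by simp
    qed
  qed
  moreover have "x \<notin> K a"
  proof
    assume "x \<in> K a"
    then obtain k where "x ^ k * (x * (a * h)) \<in> N" by (auto simp: K_def)
    then have "x ^ Suc k * (1 * (a * h)) \<in> N" by (simp add: mult_ac)
    then show False using a(2) one unfolding K_def by blast
  qed
  ultimately show thesis
    using that[of "x ^ M * a"] prime is_subringD(5)[OF B xk a(1)] by (simp add: T_def)
qed

section \<open>Unique factorisation in polynomial rings\<close>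

text \<open>Divisibility depends on the ring, so that the notions of divisor and prime element carry the
  subring as a parameter. This makes an induction on the number of variables possible inside the one
  type of polynomials in all variables.\<close>

definition dvd_in :: "'a::idom set \<Rightarrow> 'a \<Rightarrow> 'a \<Rightarrow> bool" where
  "dvd_in B a b \<longleftrightarrow> (\<exists>c\<in>B. b = a * c)"

definition prime_in :: "'a::idom set \<Rightarrow> 'a \<Rightarrow> bool" where
  "prime_in B p \<longleftrightarrow> p \<in> B \<and> p \<noteq> 0 \<and> \<not> dvd_in B p 1 \<and>
     (\<forall>a\<in>B. \<forall>b\<in>B. dvd_in B p (a * b) \<longrightarrow> dvd_in B p a \<or> dvd_in B p b)"

inductive prime_product :: "'a::idom set \<Rightarrow> nat \<Rightarrow> 'a \<Rightarrow> bool" for B where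
  unit: "u \<in> B \<Longrightarrow> dvd_in B u 1 \<Longrightarrow> prime_product B 0 u"
| prime: "prime_in B p \<Longrightarrow> prime_product B n a \<Longrightarrow> prime_product B (Suc n) (p * a)"

definition factorial_in :: "'a::idom set \<Rightarrow> bool" where
  "factorial_in B \<longleftrightarrow> (\<forall>a\<in>B. a \<noteq> 0 \<longrightarrow> (\<exists>n. prime_product B n a))"

lemma prime_inD:
  assumes "prime_in B p"
  shows "p \<in> B" "p \<noteq> 0" "\<not> dvd_in B p 1"
    "a \<in> B \<Longrightarrow> b \<in> B \<Longrightarrow> dvd_in B p (a * b) \<Longrightarrow> dvd_in B p a \<or> dvd_in B p b"
  using assms by (auto simp: prime_in_def)

context
  fixes B :: "'a::idom set"
  assumes B: "is_subring B"
begin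

lemma prime_product_mem: "prime_product B n a \<Longrightarrow> a \<in> B"
  by (induction rule: prime_product.induct) (auto intro: is_subringD(5)[OF B] prime_inD(1))

lemma prime_product_nonzero: "prime_product B n a \<Longrightarrow> a \<noteq> 0"
  by (induction rule: prime_product.induct) (auto simp: dvd_in_def prime_inD(2))

lemma prime_product_unit_mult:
  assumes "u \<in> B" "dvd_in B u 1" "prime_product B n a"
  shows "prime_product B n (u * a)"
  using assms(3)
proof induction
  case (unit v)
  from assms(2) unit(2) obtain u' v' where "u' \<in> B" "v' \<in> B" "1 = u * u'" "1 = v * v'"
    by (auto simp: dvd_in_def)
  moreover from this have "1 = u * v * (u' * v')" by (metis mult.assoc mult.left_commute mult_1_right)
  moreover have "u' * v' \<in> B" using calculation by (intro is_subringD(5)[OF B])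
  ultimately show ?case
    using is_subringD(5)[OF B assms(1) unit(1)] by (intro prime_product.unit) (auto simp: dvd_in_def)
next
  case (prime p n a)
  then show ?case
    using prime_product.prime[OF prime(1) prime(3)] by (simp add: mult.left_commute)
qed

lemma prime_product_mult:
  assumes "prime_product B n a" "prime_product B m b"
  shows "prime_product B (n + m) (a * b)"
  using assms(1)
proof induction
  case (unit u)
  then show ?case using prime_product_unit_mult[OF unit assms(2)] by simp
next
  case (prime p n a)
  then show ?case using prime_product.prime[OF prime(1) prime(3)] by (simp add: mult.assoc)
qed

end

context
  fixes B :: "'a::idom set"
  assumes B: "is_subring B"
begin

text \<open>A prime element that divides a product of primes is one of them up to a unit. The number of prime
  factors therefore drops when a prime element is divided out, and can serve as an induction measure.\<close>

lemma prime_product_divide: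
  assumes "prime_product B n a" "prime_in B q" "b \<in> B" "a = q * b"
  shows "\<exists>m. n = Suc m \<and> prime_product B m b"
  using assms(1,3,4)
proof (induction arbitrary: b)
  case (unit u)
  then obtain c where "c \<in> B" "1 = u * c" by (auto simp: dvd_in_def)
  then have "1 = q * (b * c)" "b * c \<in> B"
    using unit by (simp_all add: mult.assoc is_subringD(5)[OF B])
  then show ?case using prime_inD(3)[OF assms(2)] unfolding dvd_in_def by blast
next
  case (prime p n a)
  note q = prime_inD[OF assms(2)] and p = prime_inD[OF prime(1)]
  have aB: "a \<in> B" by (rule prime_product_mem[OF B prime(2)])
  have "dvd_in B q (p * a)" using prime(4,5) by (auto simp: dvd_in_def)
  then consider "dvd_in B q p" | "dvd_in B q a" using q(4)[OF p(1) aB] by blast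
  then show ?case
  proof cases
    case 1
    then obtain v where v: "v \<in> B" "p = q * v" by (auto simp: dvd_in_def)
    have "dvd_in B p (q * v)" using v is_subringD(1)[OF B] by (auto simp: dvd_in_def)
    moreover have "\<not> dvd_in B p v"
    proof
      assume "dvd_in B p v"
      then obtain w where w: "w \<in> B" "v = p * w" by (auto simp: dvd_in_def)
      then have "p * 1 = p * (q * w)" using v(2) by (simp add: mult.left_commute)
      then have "1 = q * w" using p(2) by (metis mult_left_cancel)
      then show False using q(3) w(1) unfolding dvd_in_def by blast
    qed
    ultimately obtain w where w: "w \<in> B" "q = p * w"
      using p(4)[OF q(1) v(1)] by (auto simp: dvd_in_def)
    have "q * 1 = q * (v * w)" using v(2) w(2) by (metis mult.assoc mult_1_right)
    then have vw: "1 = v * w" using q(2) mult_left_cancel by blast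
    have "q * b = q * (v * a)" using prime(5) v(2) by (metis mult.assoc)
    then have "b = v * a" using q(2) mult_left_cancel by blast
    then show ?thesis
      using prime_product_unit_mult[OF B v(1) _ prime(2)] w(1) vw by (auto simp: dvd_in_def)
  next
    case 2
    then obtain c where c: "c \<in> B" "a = q * c" by (auto simp: dvd_in_def)
    then obtain m where m: "n = Suc m" "prime_product B m c" using prime.IH by blast
    have "q * b = q * (p * c)" using prime(5) c(2) by (metis mult.left_commute)
    then have "b = p * c" using q(2) mult_left_cancel by blast
    then show ?thesis using prime_product.prime[OF prime(1) m(2)] m(1) by auto
  qed
qed

lemma dvd_in_const_iff:
  assumes "c \<noteq> 0" "p \<in> poly_over B"
  shows "dvd_in (poly_over B) [:c:] p \<longleftrightarrow> (\<forall>i. dvd_in B c (coeff p i))"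
proof
  assume "dvd_in (poly_over B) [:c:] p"
  then show "\<forall>i. dvd_in B c (coeff p i)" by (auto simp: dvd_in_def poly_over_def)
next
  assume dvd: "\<forall>i. dvd_in B c (coeff p i)"
  define h where "h a = (SOME b. a = c * b)" for a
  have h: "h (c * b) = b" for b
    unfolding h_def using assms(1) by (intro some_equality) auto
  have h0: "h 0 = 0" using h[of 0] by simp
  have coeff: "coeff p i = c * h (coeff p i) \<and> h (coeff p i) \<in> B" for i
    using dvd[rule_format, of i] h by (auto simp: dvd_in_def)
  have "p = [:c:] * map_poly h p"
    using coeff by (auto intro!: poly_eqI simp: coeff_map_poly[of h, OF h0])
  moreover have "map_poly h p \<in> poly_over B"
    using coeff by (auto simp: poly_over_def coeff_map_poly[of h, OF h0])
  ultimately show "dvd_in (poly_over B) [:c:] p" by (auto simp: dvd_in_def)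
qed

text \<open>If \<open>c\<close> divides neither factor, then it does not divide the coefficient of the product at which
  the first coefficients not divisible by \<open>c\<close> meet.\<close>

lemma prime_in_const:
  assumes c: "prime_in B c"
  shows "prime_in (poly_over B) [:c:]"
  unfolding prime_in_def
proof (intro conjI ballI impI)
  note cD = prime_inD[OF c]
  show "[:c:] \<in> poly_over B" by (rule poly_over_const[OF B cD(1)])
  show "[:c:] \<noteq> 0" using cD(2) by simp
  have one: "1 \<in> poly_over B" by (rule is_subringD(1)[OF is_subring_poly_over[OF B]])
  show "\<not> dvd_in (poly_over B) [:c:] 1"
  proof
    assume "dvd_in (poly_over B) [:c:] 1"
    then have "dvd_in B c (coeff 1 0)" unfolding dvd_in_const_iff[OF cD(2) one] by blast
    then show False using cD(3) by simp
  qed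
  fix p q assume p: "p \<in> poly_over B" and q: "q \<in> poly_over B"
    and dvd: "dvd_in (poly_over B) [:c:] (p * q)"
  have pq: "p * q \<in> poly_over B" by (rule is_subringD(5)[OF is_subring_poly_over[OF B] p q])
  have pB: "coeff p i \<in> B" and qB: "coeff q i \<in> B" for i using p q by (auto simp: poly_over_def)
  show "dvd_in (poly_over B) [:c:] p \<or> dvd_in (poly_over B) [:c:] q"
  proof (rule ccontr)
    assume "\<not> ?thesis"
    then obtain i0 j0 where "\<not> dvd_in B c (coeff p i0)" "\<not> dvd_in B c (coeff q j0)"
      unfolding dvd_in_const_iff[OF cD(2) p] dvd_in_const_iff[OF cD(2) q] by blast
    then obtain i j where i: "\<not> dvd_in B c (coeff p i)" "\<And>k. k < i \<Longrightarrow> dvd_in B c (coeff p k)"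
      and j: "\<not> dvd_in B c (coeff q j)" "\<And>k. k < j \<Longrightarrow> dvd_in B c (coeff q k)"
      using exists_least_iff[of "\<lambda>i. \<not> dvd_in B c (coeff p i)"]
        exists_least_iff[of "\<lambda>i. \<not> dvd_in B c (coeff q i)"] by metis
    define rest where "rest = (\<Sum>k\<in>{..i + j} - {i}. coeff p k * coeff q (i + j - k))"
    have "dvd_in B c (coeff p k * coeff q (i + j - k))" if "k \<in> {..i + j} - {i}" for k
    proof (cases "k < i")
      case True
      from i(2)[OF this] obtain a where "a \<in> B" "coeff p k = c * a" by (auto simp: dvd_in_def)
      then show ?thesis
        unfolding dvd_in_def
        by (intro bexI[of _ "a * coeff q (i + j - k)"] is_subringD(5)[OF B] qB) (auto simp: mult.assoc)
    next
      case False
      then have "i + j - k < j" using that by auto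
      from j(2)[OF this] obtain a where "a \<in> B" "coeff q (i + j - k) = c * a" by (auto simp: dvd_in_def)
      then show ?thesis
        unfolding dvd_in_def
        by (intro bexI[of _ "coeff p k * a"] is_subringD(5)[OF B] pB) (auto simp: mult.left_commute)
    qed
    then obtain a where a: "\<And>k. k \<in> {..i + j} - {i} \<Longrightarrow> a k \<in> B \<and> coeff p k * coeff q (i + j - k) = c * a k"
      unfolding dvd_in_def by metis
    have rest: "rest = c * (\<Sum>k\<in>{..i + j} - {i}. a k)"
      unfolding rest_def sum_distrib_left using a by (intro sum.cong) auto
    have "coeff (p * q) (i + j) = coeff p i * coeff q j + rest"
      unfolding coeff_mult rest_def by (subst sum.remove[of _ i]) auto
    moreover obtain b where b: "b \<in> B" "coeff (p * q) (i + j) = c * b"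
      using dvd[unfolded dvd_in_const_iff[OF cD(2) pq], rule_format, of "i + j"]
      unfolding dvd_in_def by blast
    ultimately have "coeff p i * coeff q j = c * (b - (\<Sum>k\<in>{..i + j} - {i}. a k))"
      using rest by (simp add: algebra_simps)
    moreover have "b - (\<Sum>k\<in>{..i + j} - {i}. a k) \<in> B"
      using a b by (intro is_subringD(3)[OF B] is_subringD(8)[OF B]) auto
    ultimately have "dvd_in B c (coeff p i * coeff q j)" unfolding dvd_in_def by blast
    then show False using cD(4)[OF pB qB] i(1) j(1) by blast
  qed
qed

lemma prime_product_const:
  "prime_product B n c \<Longrightarrow> prime_product (poly_over B) n [:c:]"
proof (induction rule: prime_product.induct)
  case (unit u)
  then obtain v where "v \<in> B" "1 = u * v" by (auto simp: dvd_in_def)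
  then have "dvd_in (poly_over B) [:u:] 1"
    unfolding dvd_in_def by (intro bexI[of _ "[:v:]"] poly_over_const[OF B]) (auto simp: one_pCons mult.commute)
  then show ?case using poly_over_const[OF B unit(1)] by (rule prime_product.unit[rotated])
next
  case (prime p n a)
  then show ?case
    using prime_product.prime[OF prime_in_const[OF prime(1)] prime(3)] by (simp add: mult.commute)
qed

definition primitive :: "'a poly \<Rightarrow> bool" where
  "primitive p \<longleftrightarrow> (\<forall>c. prime_in B c \<longrightarrow> \<not> dvd_in (poly_over B) [:c:] p)"

text \<open>A constant prime divisor of \<open>p\<close> divides the leading coefficient, which has only finitely many prime
  factors to lose.\<close>

lemma primitive_part:
  assumes fact: "factorial_in B" and p: "p \<in> poly_over B" "p \<noteq> 0"
  shows "\<exists>m c q. prime_product B m c \<and> q \<in> poly_over B \<and> primitive q \<and> p = [:c:] * q"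
proof -
  from p have "lead_coeff p \<in> B" "lead_coeff p \<noteq> 0" by (auto simp: poly_over_def)
  then obtain n where "prime_product B n (lead_coeff p)" using fact by (auto simp: factorial_in_def)
  then show ?thesis using p
  proof (induction n arbitrary: p rule: less_induct)
    case (less n)
    show ?case
    proof (cases "primitive p")
      case True
      have "prime_product B 0 1"
        using is_subringD(1)[OF B] by (intro prime_product.unit) (auto simp: dvd_in_def)
      then show ?thesis
        using True less(3) by (intro exI[of _ "0::nat"] exI[of _ 1] exI[of _ p]) simp
    next
      case False
      then obtain c q where c: "prime_in B c" and q: "q \<in> poly_over B" "p = [:c:] * q"
        by (auto simp: primitive_def dvd_in_def)
      have "q \<noteq> 0" using less(4) q(2) by auto
      have "lead_coeff q \<in> B" using q(1) by (auto simp: poly_over_def)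
      moreover have "lead_coeff p = c * lead_coeff q" using q(2) by (simp add: lead_coeff_smult)
      ultimately obtain m where "n = Suc m" "prime_product B m (lead_coeff q)"
        using prime_product_divide[OF less(2) c] by blast
      then obtain k d r where "prime_product B k d" "r \<in> poly_over B" "primitive r" "q = [:d:] * r"
        using less(1)[of m q] q(1) \<open>q \<noteq> 0\<close> by auto
      then show ?thesis
        using prime_product.prime[OF c, of k d] q(2)
        by (intro exI[of _ "Suc k"] exI[of _ "c * d"] exI[of _ r]) (simp add: mult.commute)
    qed
  qed
qed

text \<open>Gauss's lemma in the form used here: if \<open>c q = p s\<close>, then the prime factors of \<open>c\<close> do not divide
  \<open>p\<close>, so they divide \<open>s\<close> and cancel.\<close>

lemma primitive_dvd_cancel:
  assumes "prime_product B n c" "p \<in> poly_over B" "primitive p" "q \<in> poly_over B"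
    "dvd_in (poly_over B) p ([:c:] * q)"
  shows "dvd_in (poly_over B) p q"
  using assms(1,4,5)
proof (induction arbitrary: q)
  note PB = is_subring_poly_over[OF B]
  case (unit u)
  then obtain v s where v: "v \<in> B" "1 = u * v" and s: "s \<in> poly_over B" "[:u:] * q = p * s"
    by (auto simp: dvd_in_def)
  have "[:v:] * ([:u:] * q) = q" using v(2) by (simp add: mult.commute)
  then have "q = p * ([:v:] * s)" unfolding s(2) by (metis mult.left_commute)
  then show ?case
    using is_subringD(5)[OF PB poly_over_const[OF B v(1)] s(1)] unfolding dvd_in_def by blast
next
  note PB = is_subring_poly_over[OF B]
  case (prime c n a)
  note C = prime_in_const[OF prime(1)]
  obtain s where s: "s \<in> poly_over B" "[:c * a:] * q = p * s" using prime(5) by (auto simp: dvd_in_def)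
  have eq: "[:c:] * ([:a:] * q) = p * s" using s(2) by (simp add: mult.commute)
  have aq: "[:a:] * q \<in> poly_over B"
    by (intro is_subringD(5)[OF PB] poly_over_const[OF B] prime_product_mem[OF B prime(2)] prime(4))
  have "dvd_in (poly_over B) [:c:] (p * s)" unfolding dvd_in_def using eq aq by metis
  then have "dvd_in (poly_over B) [:c:] s"
    using prime_inD(4)[OF C assms(2) s(1)] assms(3) prime(1) by (auto simp: primitive_def)
  then obtain s' where s': "s' \<in> poly_over B" "s = [:c:] * s'" by (auto simp: dvd_in_def)
  have "[:c:] * ([:a:] * q) = [:c:] * (p * s')" using eq s'(2) by (metis mult.left_commute)
  then have "[:a:] * q = p * s'" using prime_inD(2)[OF C] by (metis mult_left_cancel)
  then show ?case using prime.IH[OF prime(4)] s'(1) unfolding dvd_in_def by blast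
qed

text \<open>Every prime factor of \<open>c\<close> divides one of the two factors, and is cancelled there without a change of
  the degrees.\<close>

lemma split_constant_multiple:
  assumes p: "p \<in> poly_over B"
    and "prime_product B n c" "w \<in> poly_over B" "s \<in> poly_over B" "[:c:] * p = w * s"
  shows "\<exists>w'\<in>poly_over B. \<exists>s'\<in>poly_over B. degree w' = degree w \<and> degree s' = degree s \<and> p = w' * s'"
  using assms(2-)
proof (induction arbitrary: w s)
  note PB = is_subring_poly_over[OF B]
  case (unit u)
  then obtain v where v: "v \<in> B" "1 = u * v" by (auto simp: dvd_in_def)
  have "[:v:] * ([:u:] * p) = p" using v(2) by (simp add: mult.commute)
  then have "p = ([:v:] * w) * s" unfolding unit(5) by (metis mult.assoc)
  moreover have "v \<noteq> 0" using v(2) by auto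
  moreover have "[:v:] * w \<in> poly_over B"
    by (intro is_subringD(5)[OF PB] poly_over_const[OF B v(1)] unit(3))
  ultimately show ?case using unit(4) by (intro bexI[of _ "[:v:] * w"] bexI[of _ s]) auto
next
  note PB = is_subring_poly_over[OF B]
  case (prime c n a)
  note C = prime_in_const[OF prime(1)] and c0 = prime_inD(2)[OF prime(1)]
  have eq: "[:c:] * ([:a:] * p) = w * s" using prime(6) by (simp add: mult.commute)
  have deg: "degree ([:c:] * q) = degree q" for q using c0 by simp
  have cancel: "x = y" if "[:c:] * x = [:c:] * y" for x y
    using that prime_inD(2)[OF C] mult_left_cancel by blast
  have "[:a:] * p \<in> poly_over B"
    by (intro is_subringD(5)[OF PB] poly_over_const[OF B] prime_product_mem[OF B prime(2)] p)
  then have "dvd_in (poly_over B) [:c:] (w * s)" unfolding dvd_in_def using eq by metis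
  then consider "dvd_in (poly_over B) [:c:] w" | "dvd_in (poly_over B) [:c:] s"
    using prime_inD(4)[OF C prime(4,5)] by blast
  then show ?case
  proof cases
    case 1
    then obtain w1 where w1: "w1 \<in> poly_over B" "w = [:c:] * w1" by (auto simp: dvd_in_def)
    have "[:c:] * ([:a:] * p) = [:c:] * (w1 * s)" using eq w1(2) by (metis mult.assoc)
    then have "[:a:] * p = w1 * s" by (rule cancel)
    from prime.IH[OF w1(1) prime(5) this] show ?thesis using w1(2) deg by metis
  next
    case 2
    then obtain s1 where s1: "s1 \<in> poly_over B" "s = [:c:] * s1" by (auto simp: dvd_in_def)
    have "[:c:] * ([:a:] * p) = [:c:] * (w * s1)" using eq s1(2) by (metis mult.left_commute)
    then have "[:a:] * p = w * s1" by (rule cancel)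
    from prime.IH[OF prime(4) s1(1) this] show ?thesis using s1(2) deg by metis
  qed
qed

lemma pseudo_division:
  assumes w: "w \<in> poly_over B" "w \<noteq> 0" and p: "p \<in> poly_over B"
  shows "\<exists>c\<in>B. \<exists>s\<in>poly_over B. c \<noteq> 0 \<and>
           ([:c:] * p - w * s = 0 \<or> degree ([:c:] * p - w * s) < degree w)"
  using p
proof (induction "degree p" arbitrary: p rule: less_induct)
  case less
  note PB = is_subring_poly_over[OF B]
  have lc: "lead_coeff w \<in> B" "lead_coeff w \<noteq> 0" using w by (auto simp: poly_over_def)
  have lcp: "lead_coeff p \<in> B" using less(2) by (auto simp: poly_over_def)
  show ?case
  proof (cases "p = 0 \<or> degree p < degree w")
    case True
    then show ?thesis
      using is_subringD(1)[OF B] is_subringD(2)[OF PB] by (intro bexI[of _ 1] bexI[of _ 0]) auto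
  next
    case False
    define t where "t = Polynomial.monom (lead_coeff p) (degree p - degree w)"
    have t: "t \<in> poly_over B"
      unfolding t_def poly_over_def using lcp is_subringD(2)[OF B] by simp
    define p1 where "p1 = [:lead_coeff w:] * p - w * t"
    have p1: "p1 \<in> poly_over B"
      unfolding p1_def by (intro is_subringD(3,5)[OF PB] poly_over_const[OF B lc(1)] less(2) w(1) t)
    have "degree (w * t) = degree p"
      using False w(2) by (simp add: t_def degree_mult_eq degree_monom_eq)
    then have le: "degree p1 \<le> degree p" unfolding p1_def by (intro degree_diff_le) auto
    have "coeff (w * t) (degree p) = lead_coeff w * lead_coeff p"
      using \<open>degree (w * t) = degree p\<close> lead_coeff_mult[of w t] lead_coeff_monom
      unfolding t_def by metis
    then have c0: "coeff p1 (degree p) = 0" unfolding p1_def by simp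
    show ?thesis
    proof (cases "p1 = 0")
      case True
      then show ?thesis using lc t unfolding p1_def by blast
    next
      case False
      have "degree p1 < degree p"
        using le c0 False by (metis leading_coeff_0_iff le_neq_implies_less)
      from less(1)[OF this p1] obtain c s where c: "c \<in> B" "c \<noteq> 0" and s: "s \<in> poly_over B"
        and rem: "[:c:] * p1 - w * s = 0 \<or> degree ([:c:] * p1 - w * s) < degree w" by blast
      have "[:c:] * p1 - w * s = [:c * lead_coeff w:] * p - w * ([:c:] * t + s)"
        unfolding p1_def by (simp add: algebra_simps smult_diff_right)
      moreover have "[:c:] * t + s \<in> poly_over B"
        by (intro is_subringD(4,5)[OF PB] poly_over_const[OF B c(1)] t s)
      moreover have "c * lead_coeff w \<in> B" by (rule is_subringD(5)[OF B c(1) lc(1)])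
      moreover have "c * lead_coeff w \<noteq> 0" using c(2) lc(2) by simp
      ultimately show ?thesis using rem by metis
    qed
  qed
qed

text \<open>Let \<open>w \<noteq> 0\<close> be of least degree in the ideal of \<open>p\<close> and \<open>q\<close>. Pseudo-division shows that \<open>w\<close>
  divides multiples of \<open>p\<close> and of \<open>q\<close> by constants. The first of these multiples gives a
  factorisation of \<open>p\<close> itself, in which one factor must be constant. If the cofactor is, then \<open>p\<close>
  divides a constant multiple of \<open>q\<close>, hence \<open>q\<close>. If \<open>w\<close> is a constant, then \<open>p\<close> divides
  \<open>w r = (u p + v q) r\<close> as soon as it divides \<open>q r\<close>, hence \<open>r\<close>. No fraction field is involved.\<close>

lemma prime_in_poly_over:
  assumes fact: "factorial_in B" and p: "p \<in> poly_over B" "primitive p" "degree p > 0"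
    and irred: "\<And>u v. u \<in> poly_over B \<Longrightarrow> v \<in> poly_over B \<Longrightarrow> p = u * v \<Longrightarrow>
      degree u = 0 \<or> degree v = 0"
  shows "prime_in (poly_over B) p"
  unfolding prime_in_def
proof (intro conjI ballI impI p(1))
  note PB = is_subring_poly_over[OF B]
  have p0: "p \<noteq> 0" using p(3) by auto
  then show "p \<noteq> 0" .
  show "\<not> dvd_in (poly_over B) p 1"
  proof
    assume "dvd_in (poly_over B) p 1"
    then obtain c where "1 = p * c" by (auto simp: dvd_in_def)
    then have "degree p + degree c = 0" using p0 degree_mult_eq[of p c] by fastforce
    then show False using p(3) by simp
  qed
  have cancel: "dvd_in (poly_over B) p a" if "c \<in> B" "c \<noteq> 0" "a \<in> poly_over B" "dvd_in (poly_over B) p ([:c:] * a)"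
    for c a using fact that primitive_dvd_cancel[OF _ p(1,2)] by (auto simp: factorial_in_def)
  fix q r assume q: "q \<in> poly_over B" and r: "r \<in> poly_over B" and dvd: "dvd_in (poly_over B) p (q * r)"
  define A where "A = {u * p + v * q | u v. u \<in> poly_over B \<and> v \<in> poly_over B}"
  have A: "A \<subseteq> poly_over B" unfolding A_def using p(1) q is_subringD(4,5)[OF PB] by blast
  have pA: "p \<in> A" and qA: "q \<in> A"
    unfolding A_def using is_subringD(1,2)[OF PB]
    by (force intro: exI[of _ 1] exI[of _ 0])+
  have comb: "[:c:] * a - b * s \<in> A" if ab: "a \<in> A" "b \<in> A" and c: "c \<in> B" and s: "s \<in> poly_over B" for a b c s
  proof -
    obtain u v u' v' where uv: "u \<in> poly_over B" "v \<in> poly_over B" "u' \<in> poly_over B" "v' \<in> poly_over B"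
      "a = u * p + v * q" "b = u' * p + v' * q" using ab unfolding A_def by blast
    have "[:c:] * a - b * s = ([:c:] * u - u' * s) * p + ([:c:] * v - v' * s) * q"
      unfolding uv by (simp add: algebra_simps smult_add_right)
    moreover have "[:c:] * u - u' * s \<in> poly_over B" "[:c:] * v - v' * s \<in> poly_over B"
      by (intro is_subringD(3,5)[OF PB] poly_over_const[OF B c] uv s)+
    ultimately show ?thesis unfolding A_def by blast
  qed
  obtain w where w: "w \<in> A" "w \<noteq> 0" and min: "\<And>a. a \<in> A \<Longrightarrow> a \<noteq> 0 \<Longrightarrow> degree w \<le> degree a"
    using ex_has_least_nat[of "\<lambda>a. a \<in> A \<and> a \<noteq> 0" p degree] pA p0 by blast
  have wP: "w \<in> poly_over B" using A w(1) by blast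
  have mult: "\<exists>c\<in>B. \<exists>s\<in>poly_over B. c \<noteq> 0 \<and> [:c:] * a = w * s" if a: "a \<in> A" for a
  proof -
    obtain c s where c: "c \<in> B" "c \<noteq> 0" and s: "s \<in> poly_over B"
      and rem: "[:c:] * a - w * s = 0 \<or> degree ([:c:] * a - w * s) < degree w"
      using pseudo_division[OF wP w(2), of a] a A by blast
    have "[:c:] * a - w * s = 0"
      using rem min[OF comb[OF a w(1) c(1) s]] by linarith
    then show ?thesis using c s by auto
  qed
  obtain c s where c: "c \<in> B" "c \<noteq> 0" and s: "s \<in> poly_over B" and cp: "[:c:] * p = w * s"
    using mult[OF pA] by blast
  obtain n where "prime_product B n c" using fact c by (auto simp: factorial_in_def)
  from split_constant_multiple[OF p(1) this wP s cp]
  have "degree w = 0 \<or> degree s = 0" using irred by metis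
  then show "dvd_in (poly_over B) p q \<or> dvd_in (poly_over B) p r"
  proof
    assume "degree s = 0"
    then obtain \<sigma> where \<sigma>: "s = [:\<sigma>:]" by (metis degree_0_id)
    have "\<sigma> \<in> B" using s unfolding \<sigma> poly_over_def by (auto dest: spec[of _ 0])
    have "s \<noteq> 0" using cp c(2) p0 by auto
    then have "\<sigma> \<noteq> 0" using \<sigma> by simp
    obtain d t where d: "d \<in> B" "d \<noteq> 0" and t: "t \<in> poly_over B" and dq: "[:d:] * q = w * t"
      using mult[OF qA] by blast
    have "[:\<sigma> * d:] * q = s * ([:d:] * q)" using \<sigma> by (simp add: mult.commute)
    also have "\<dots> = (w * s) * t" unfolding dq by (simp add: mult_ac)
    also have "\<dots> = p * ([:c:] * t)" unfolding cp[symmetric] by (simp add: mult_ac)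
    finally have "[:\<sigma> * d:] * q = p * ([:c:] * t)" .
    moreover have "[:c:] * t \<in> poly_over B" by (intro is_subringD(5)[OF PB] poly_over_const[OF B] c t)
    ultimately have "dvd_in (poly_over B) p ([:\<sigma> * d:] * q)" unfolding dvd_in_def by blast
    moreover have "\<sigma> * d \<in> B" by (rule is_subringD(5)[OF B \<open>\<sigma> \<in> B\<close> d(1)])
    ultimately show ?thesis using cancel[of "\<sigma> * d" q] q d(2) \<open>\<sigma> \<noteq> 0\<close> by simp
  next
    assume "degree w = 0"
    then obtain \<gamma> where \<gamma>: "w = [:\<gamma>:]" by (metis degree_0_id)
    have "\<gamma> \<in> B" using wP unfolding \<gamma> poly_over_def by (auto dest: spec[of _ 0])
    have "\<gamma> \<noteq> 0" using w(2) \<gamma> by simp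
    obtain u v where uv: "u \<in> poly_over B" "v \<in> poly_over B" "w = u * p + v * q"
      using w(1) unfolding A_def by blast
    obtain e where e: "e \<in> poly_over B" "q * r = p * e" using dvd by (auto simp: dvd_in_def)
    have "[:\<gamma>:] * r = u * p * r + v * (q * r)"
      unfolding \<gamma>[symmetric] uv(3) by (simp add: algebra_simps)
    also have "\<dots> = p * (u * r + v * e)" unfolding e(2) by (simp add: algebra_simps)
    finally have "[:\<gamma>:] * r = p * (u * r + v * e)" .
    moreover have "u * r + v * e \<in> poly_over B" by (intro is_subringD(4,5)[OF PB] uv r e)
    ultimately have "dvd_in (poly_over B) p ([:\<gamma>:] * r)" unfolding dvd_in_def by blast
    then show ?thesis using cancel[OF \<open>\<gamma> \<in> B\<close> \<open>\<gamma> \<noteq> 0\<close> r] by blast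
  qed
qed

text \<open>By induction on the degree. The content is a product of constant primes, and a primitive polynomial
  splits into factors of lower degree or is prime.\<close>

theorem factorial_in_poly_over:
  assumes fact: "factorial_in B"
  shows "factorial_in (poly_over B)"
proof -
  note PB = is_subring_poly_over[OF B]
  have "\<exists>n. prime_product (poly_over B) n p" if "p \<in> poly_over B" "p \<noteq> 0" for p
    using that
  proof (induction "degree p" arbitrary: p rule: less_induct)
    case less
    obtain m c q where c: "prime_product B m c" and q: "q \<in> poly_over B" "primitive q"
      and pq: "p = [:c:] * q" using primitive_part[OF fact less(2,3)] by blast
    have q0: "q \<noteq> 0" using less(3) pq by auto
    have deg: "degree p = degree q" using pq prime_product_nonzero[OF B c] by simp
    have "\<exists>n. prime_product (poly_over B) n q"
    proof (cases "degree q = 0")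
      case True
      then obtain b where b: "q = [:b:]" by (metis degree_0_id)
      have "b \<in> B" using q(1) unfolding b poly_over_def by (auto dest: spec[of _ 0])
      moreover have "b \<noteq> 0" using q0 b by simp
      ultimately show ?thesis using fact prime_product_const b unfolding factorial_in_def by blast
    next
      case False
      show ?thesis
      proof (cases "\<exists>u\<in>poly_over B. \<exists>v\<in>poly_over B. q = u * v \<and> degree u \<noteq> 0 \<and> degree v \<noteq> 0")
        case True
        then obtain u v where uv: "u \<in> poly_over B" "v \<in> poly_over B" "q = u * v"
          "degree u \<noteq> 0" "degree v \<noteq> 0" by blast
        have nz: "u \<noteq> 0" "v \<noteq> 0" using q0 uv(3) by auto
        then have "degree q = degree u + degree v" using uv(3) degree_mult_eq by blast
        then obtain k l where "prime_product (poly_over B) k u" "prime_product (poly_over B) l v"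
          using less(1)[of u] less(1)[of v] uv nz deg by auto
        then show ?thesis using prime_product_mult[OF PB] uv(3) by blast
      next
        case no_split: False
        have "prime_in (poly_over B) q"
          using False no_split by (intro prime_in_poly_over[OF fact q]) auto
        moreover have "prime_product (poly_over B) 0 1"
          using is_subringD(1)[OF PB] by (intro prime_product.unit) (auto simp: dvd_in_def)
        ultimately show ?thesis using prime_product.prime by fastforce
      qed
    qed
    then show ?case
      using prime_product_const[OF c] prime_product_mult[OF PB] pq by blast
  qed
  then show ?thesis by (auto simp: factorial_in_def)
qed

text \<open>Evaluation at a transcendental element is an isomorphism from the polynomial ring.\<close>

lemma factorial_in_adjoin:
  assumes fact: "factorial_in B" and trans: "\<And>p. p \<in> poly_over B \<Longrightarrow> poly p x = 0 \<Longrightarrow> p = 0"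
  shows "factorial_in (adjoin B x)"
proof -
  note PB = is_subring_poly_over[OF B]
  have inj: "p = q" if "p \<in> poly_over B" "q \<in> poly_over B" "poly p x = poly q x" for p q
  proof -
    have "p - q = 0" using that by (intro trans is_subringD(3)[OF PB]) simp_all
    then show ?thesis by simp
  qed
  have dvd: "dvd_in (adjoin B x) (poly p x) (poly q x) \<longleftrightarrow> dvd_in (poly_over B) p q"
    if p: "p \<in> poly_over B" and q: "q \<in> poly_over B" for p q
  proof
    assume "dvd_in (poly_over B) p q"
    then show "dvd_in (adjoin B x) (poly p x) (poly q x)" by (auto simp: dvd_in_def adjoin_def)
  next
    assume "dvd_in (adjoin B x) (poly p x) (poly q x)"
    then obtain c where c: "c \<in> poly_over B" "poly q x = poly (p * c) x"
      by (auto simp: dvd_in_def adjoin_def)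
    then have "q = p * c" using p q by (intro inj is_subringD(5)[OF PB])
    then show "dvd_in (poly_over B) p q" using c(1) by (auto simp: dvd_in_def)
  qed
  have one: "1 \<in> poly_over B" by (rule is_subringD(1)[OF PB])
  have prime_image: "prime_in (adjoin B x) (poly p x)" if p: "prime_in (poly_over B) p" for p
    unfolding prime_in_def
  proof (intro conjI ballI impI)
    note pD = prime_inD[OF p]
    show "poly p x \<in> adjoin B x" using pD(1) by (auto simp: adjoin_def)
    show "poly p x \<noteq> 0" using trans pD(1,2) by blast
    show "\<not> dvd_in (adjoin B x) (poly p x) 1" using dvd[OF pD(1) one] pD(3) by simp
    fix a b assume "a \<in> adjoin B x" "b \<in> adjoin B x" and ab: "dvd_in (adjoin B x) (poly p x) (a * b)"
    then obtain q r where q: "q \<in> poly_over B" "a = poly q x" and r: "r \<in> poly_over B" "b = poly r x"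
      by (auto simp: adjoin_def)
    have "dvd_in (poly_over B) p (q * r)"
      using ab dvd[OF pD(1) is_subringD(5)[OF PB q(1) r(1)]] q(2) r(2) by simp
    then show "dvd_in (adjoin B x) (poly p x) a \<or> dvd_in (adjoin B x) (poly p x) b"
      using pD(4)[OF q(1) r(1)] dvd[OF pD(1)] q r by blast
  qed
  have product: "prime_product (adjoin B x) n (poly p x)" if "prime_product (poly_over B) n p" for n p
    using that
  proof induction
    case (unit u)
    then show ?case using dvd[OF unit(1) one] by (intro prime_product.unit) (auto simp: adjoin_def)
  next
    case (prime q n a)
    then show ?case using prime_product.prime[OF prime_image[OF prime(1)] prime(3)] by simp
  qed
  show ?thesis
    unfolding factorial_in_def
  proof (intro ballI impI)
    fix a assume "a \<in> adjoin B x" "a \<noteq> 0"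
    then obtain p where p: "p \<in> poly_over B" "a = poly p x" by (auto simp: adjoin_def)
    with \<open>a \<noteq> 0\<close> have "p \<noteq> 0" by auto
    then obtain n where "prime_product (poly_over B) n p"
      using factorial_in_poly_over[OF fact] p(1) unfolding factorial_in_def by blast
    then show "\<exists>n. prime_product (adjoin B x) n a" using product p(2) by blast
  qed
qed

end

text \<open>A prime factor of \<open>E\<close> fails to divide some \<open>h i\<close>. So it divides \<open>G\<close>, and can be cancelled
  from \<open>E\<close> and \<open>G\<close>.\<close>

lemma factorial_dvd_cancel_coprime:
  fixes E G :: "'a::idom"
  assumes fact: "factorial_in (UNIV :: 'a set)" and E: "E \<noteq> 0"
    and h: "no_common_factor h" and dvd: "\<And>i. E dvd h i ^ s * G"
  shows "E dvd G"
proof -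
  have dvd_iff: "dvd_in UNIV a b \<longleftrightarrow> a dvd b" for a b :: 'a by (auto simp: dvd_in_def dvd_def)
  obtain n where "prime_product UNIV n E" using fact E by (auto simp: factorial_in_def)
  then show ?thesis using dvd
  proof (induction arbitrary: G)
    case (unit u)
    then have "u dvd 1" by (simp add: dvd_iff)
    then show ?case by (rule dvd_trans) simp
  next
    case (prime p n a)
    have p: "p \<noteq> 0" "\<not> p dvd 1" "\<And>a b. p dvd a * b \<Longrightarrow> p dvd a \<or> p dvd b"
      using prime(1) by (auto simp: prime_in_def dvd_iff)
    have pow: "p dvd b" if "p dvd b ^ s" for b
      using that
    proof (induction s)
      case 0
      then show ?case using p(2) by simp
    next
      case (Suc s)
      then show ?case using p(3)[of b "b ^ s"] by auto
    qed
    obtain i where "\<not> p dvd h i" using h p(2) unfolding no_common_factor_def by blast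
    moreover have "p dvd h i ^ s * G" using dvd_mult_left[OF prime(4)[of i]] .
    ultimately have "p dvd G" using p(3) pow by blast
    then obtain G' where G': "G = p * G'" by (elim dvdE)
    have "a dvd h i ^ s * G'" for i
    proof -
      have "p * a dvd p * (h i ^ s * G')" using prime(4)[of i] unfolding G' by (simp add: mult_ac)
      then show ?thesis using p(1) by simp
    qed
    then have "a dvd G'" by (rule prime.IH)
    then show ?case unfolding G' by simp
  qed
qed

section \<open>Substitution and homogeneous components\<close>

definition is_hom :: "('a::comm_ring_1 \<Rightarrow> 'b::comm_ring_1) \<Rightarrow> bool" where
  "is_hom h \<longleftrightarrow> h 1 = 1 \<and> (\<forall>a b. h (a + b) = h a + h b) \<and> (\<forall>a b. h (a * b) = h a * h b)"

lemma is_homD: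
  assumes "is_hom h"
  shows "h 1 = 1" "h (a + b) = h a + h b" "h (a * b) = h a * h b" "h 0 = 0" "h (- a) = - h a"
    "h (a - b) = h a - h b" "h (a ^ n) = h a ^ n" "h (sum u Y) = (\<Sum>y\<in>Y. h (u y))"
    "h (prod u Y) = (\<Prod>y\<in>Y. h (u y))"
proof -
  show one: "h 1 = 1" and add: "h (a + b) = h a + h b" and mult: "h (a * b) = h a * h b" for a b
    using assms by (auto simp: is_hom_def)
  show zero: "h 0 = 0" using add[of 0 0] by simp
  show neg: "h (- a) = - h a" for a using add[of a "- a"] zero by (simp add: eq_neg_iff_add_eq_0 add.commute)
  show "h (a - b) = h a - h b" using add[of a "- b"] neg[of b] by simp
  show "h (a ^ n) = h a ^ n" by (induction n) (simp_all add: one mult)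
  show "h (sum u Y) = (\<Sum>y\<in>Y. h (u y))"
    by (induction Y rule: infinite_finite_induct) (simp_all add: zero add)
  show "h (prod u Y) = (\<Prod>y\<in>Y. h (u y))"
    by (induction Y rule: infinite_finite_induct) (simp_all add: one mult)
qed

lemma is_hom_mconst: "is_hom (mconst :: 'a::comm_ring_1 \<Rightarrow> ('v, 'a) mpoly)"
  by (auto simp: is_hom_def mconst_def single_add mult_single)

lemma is_hom_pconst: "is_hom (\<lambda>a :: 'a::comm_ring_1. [:a:])"
  by (auto simp: is_hom_def one_pCons)

lemma is_hom_comp: "is_hom h \<Longrightarrow> is_hom k \<Longrightarrow> is_hom (\<lambda>a. h (k a))"
  by (auto simp: is_hom_def)

definition monom_eval :: "('v \<Rightarrow> 'b::comm_semiring_1) \<Rightarrow> ('v \<Rightarrow>\<^sub>0 nat) \<Rightarrow> 'b" where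
  "monom_eval b m = (\<Prod>v\<in>Poly_Mapping.keys m. b v ^ Poly_Mapping.lookup m v)"

definition monom_deg :: "('v \<Rightarrow>\<^sub>0 nat) \<Rightarrow> nat" where
  "monom_deg m = (\<Sum>v\<in>Poly_Mapping.keys m. Poly_Mapping.lookup m v)"

lemma monom_eval_UNIV:
  fixes b :: "'v::finite \<Rightarrow> 'b::comm_semiring_1"
  shows "monom_eval b m = (\<Prod>v\<in>UNIV. b v ^ Poly_Mapping.lookup m v)"
  unfolding monom_eval_def by (rule prod.mono_neutral_left) (auto simp: in_keys_iff)

lemma monom_deg_UNIV: "monom_deg (m :: 'v::finite \<Rightarrow>\<^sub>0 nat) = (\<Sum>v\<in>UNIV. Poly_Mapping.lookup m v)"
  unfolding monom_deg_def by (rule sum.mono_neutral_left) (auto simp: in_keys_iff)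

lemma monom_eval_add:
  "monom_eval (b :: 'v::finite \<Rightarrow> 'b::comm_semiring_1) (m + n) = monom_eval b m * monom_eval b n"
  by (simp add: monom_eval_UNIV lookup_add power_add prod.distrib)

lemma monom_deg_single [simp]: "monom_deg (Poly_Mapping.single v k) = k"
  by (simp add: monom_deg_def)

lemma sum_single_lookup: "(\<Sum>m\<in>Poly_Mapping.keys p. Poly_Mapping.single m (Poly_Mapping.lookup p m)) = p"
proof (rule poly_mapping_eqI)
  fix k
  have "Poly_Mapping.lookup (\<Sum>m\<in>Poly_Mapping.keys p. Poly_Mapping.single m (Poly_Mapping.lookup p m)) k
      = (\<Sum>m\<in>Poly_Mapping.keys p. if m = k then Poly_Mapping.lookup p m else 0)"
    by (simp add: lookup_sum lookup_single when_def)
  also have "\<dots> = Poly_Mapping.lookup p k" by (simp add: in_keys_iff)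
  finally show "Poly_Mapping.lookup (\<Sum>m\<in>Poly_Mapping.keys p. Poly_Mapping.single m (Poly_Mapping.lookup p m)) k = Poly_Mapping.lookup p k" .
qed

lemma msubst_superset:
  assumes "c 0 = 0" "finite S" "Poly_Mapping.keys p \<subseteq> S"
  shows "msubst c b p = (\<Sum>m\<in>S. c (Poly_Mapping.lookup p m) * monom_eval b m)"
  unfolding msubst_def monom_eval_def[symmetric]
  using assms by (intro sum.mono_neutral_left) (auto simp: in_keys_iff)

lemma msubst_single:
  assumes "c 0 = 0"
  shows "msubst c b (Poly_Mapping.single m a) = c a * monom_eval b m"
  by (subst msubst_superset[of c "{m}", OF assms]) (auto simp: lookup_single)

lemma msubst_add:
  assumes c: "is_hom c"
  shows "msubst c b (p + q) = msubst c b p + msubst c b q"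
proof -
  let ?S = "Poly_Mapping.keys p \<union> Poly_Mapping.keys q"
  have *: "msubst c b r = (\<Sum>m\<in>?S. c (Poly_Mapping.lookup r m) * monom_eval b m)"
    if "Poly_Mapping.keys r \<subseteq> ?S" for r
    using that by (intro msubst_superset is_homD(4)[OF c]) auto
  show ?thesis
    using keys_add[of p q]
    by (simp add: * lookup_add is_homD(2)[OF c] distrib_right sum.distrib)
qed

lemma msubst_sum:
  assumes c: "is_hom c"
  shows "msubst c b (sum u Y) = (\<Sum>y\<in>Y. msubst c b (u y))"
proof (induction Y rule: infinite_finite_induct)
  case (insert x F)
  then show ?case by (simp add: msubst_add[OF c])
qed (simp_all add: msubst_def)

lemma is_hom_msubst:
  fixes b :: "'v::finite \<Rightarrow> 'b::comm_ring_1"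
  assumes c: "is_hom c"
  shows "is_hom (msubst c b)"
  unfolding is_hom_def
proof (intro conjI allI)
  note c0 = is_homD(4)[OF c]
  show "msubst c b 1 = 1"
    using msubst_single[of c b 0 1, OF c0] by (simp add: is_homD(1)[OF c] monom_eval_def)
  show "msubst c b (p + q) = msubst c b p + msubst c b q" for p q by (rule msubst_add[OF c])
  show "msubst c b (p * q) = msubst c b p * msubst c b q" for p q
  proof -
    have "p * q = (\<Sum>m\<in>Poly_Mapping.keys p. \<Sum>n\<in>Poly_Mapping.keys q. Poly_Mapping.single (m + n) (Poly_Mapping.lookup p m * Poly_Mapping.lookup q n))"
      by (subst (1 2) sum_single_lookup[symmetric]) (simp add: sum_product mult_single)
    then have "msubst c b (p * q) = (\<Sum>m\<in>Poly_Mapping.keys p. \<Sum>n\<in>Poly_Mapping.keys q.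
        (c (Poly_Mapping.lookup p m) * monom_eval b m) * (c (Poly_Mapping.lookup q n) * monom_eval b n))"
      by (simp add: msubst_sum[OF c] msubst_single c0 monom_eval_add is_homD(3)[OF c] mult_ac)
    also have "\<dots> = msubst c b p * msubst c b q"
      by (simp add: msubst_def monom_eval_def sum_product)
    finally show ?thesis .
  qed
qed

lemma msubst_mconst: "is_hom c \<Longrightarrow> msubst c b (mconst a) = c a"
  by (simp add: mconst_def msubst_single is_homD(4) monom_eval_def)

lemma msubst_mvar: "is_hom c \<Longrightarrow> msubst c b (mvar v) = b v"
  by (simp add: mvar_def msubst_single is_homD(1,4) monom_eval_def)

lemma hom_msubst:
  assumes h: "is_hom h"
  shows "h (msubst c b p) = msubst (\<lambda>a. h (c a)) (\<lambda>v. h (b v)) p"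
  unfolding msubst_def by (simp add: is_homD[OF h])

lemma mvar_power:
  "mvar v ^ k = (Poly_Mapping.single (Poly_Mapping.single v k) 1 :: ('v, 'a::comm_ring_1) mpoly)"
  by (induction k) (simp_all add: mvar_def mult_single flip: single_add)

lemma monom_eval_mvar:
  "monom_eval mvar m = (Poly_Mapping.single m 1 :: ('v::finite, 'a::comm_ring_1) mpoly)"
proof -
  have "(\<Prod>v\<in>A. Poly_Mapping.single (u v) 1) = (Poly_Mapping.single (sum u A) 1 :: ('v, 'a) mpoly)"
    if "finite A" for A and u :: "'v \<Rightarrow> 'v \<Rightarrow>\<^sub>0 nat"
    using that by induction (simp_all add: mult_single)
  then show ?thesis unfolding monom_eval_def mvar_power by (simp add: sum_single_lookup)
qed

lemma msubst_mvar_id: "msubst mconst mvar p = (p :: ('v::finite, 'a::comm_ring_1) mpoly)"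
proof -
  have "msubst mconst mvar p = (\<Sum>m\<in>Poly_Mapping.keys p. Poly_Mapping.single m (Poly_Mapping.lookup p m))"
    unfolding msubst_def monom_eval_def[symmetric] monom_eval_mvar by (simp add: mconst_def mult_single)
  then show ?thesis by (simp add: sum_single_lookup)
qed

text \<open>Induction over polynomials takes this form below: what holds on a subring need only be checked for
  constants and variables.\<close>

lemma mpoly_generated:
  fixes C :: "('v::finite, 'a::comm_ring_1) mpoly set"
  assumes C: "is_subring C" and "\<And>a. mconst a \<in> C" "\<And>v. mvar v \<in> C"
  shows "C = UNIV"
proof -
  have prod: "prod u Y \<in> C" if "\<And>y. y \<in> Y \<Longrightarrow> u y \<in> C" for u and Y :: "'v set"
    using that by (induction Y rule: infinite_finite_induct) (auto intro: is_subringD(1,5)[OF C])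
  have "p \<in> C" for p
    by (subst msubst_mvar_id[symmetric], unfold msubst_def)
      (intro is_subringD(5,7,8)[OF C] assms prod)
  then show ?thesis by blast
qed

lemma hom_eqI:
  fixes h k :: "('v::finite, 'a::comm_ring_1) mpoly \<Rightarrow> 'b::comm_ring_1"
  assumes h: "is_hom h" and k: "is_hom k"
    and "\<And>a. h (mconst a) = k (mconst a)" "\<And>v. h (mvar v) = k (mvar v)"
  shows "h p = k p"
proof -
  have "is_subring {p. h p = k p}"
    by (auto simp: is_subring_def is_homD[OF h] is_homD[OF k])
  from mpoly_generated[OF this] assms(3,4) show ?thesis by blast
qed

text \<open>Homogeneous components are the coefficients of the image under the homomorphism that multiplies
  every variable by one new variable, so that the laws of a grading are the laws for coefficients.\<close>

definition homog :: "('v, 'a::comm_ring_1) mpoly \<Rightarrow> ('v, 'a) mpoly poly" where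
  "homog = msubst (\<lambda>a. [:mconst a:]) (\<lambda>v. Polynomial.monom (mvar v) 1)"

definition hcomp :: "nat \<Rightarrow> ('v, 'a::comm_ring_1) mpoly \<Rightarrow> ('v, 'a) mpoly" where
  "hcomp e p = coeff (homog p) e"

lemma is_hom_const_poly: "is_hom (\<lambda>a :: 'a::comm_ring_1. [:mconst a :: ('v, 'a) mpoly:])"
  by (intro is_hom_comp[OF is_hom_pconst is_hom_mconst])

lemma is_hom_homog: "is_hom (homog :: ('v::finite, 'a::comm_ring_1) mpoly \<Rightarrow> _)"
  unfolding homog_def by (rule is_hom_msubst[OF is_hom_const_poly])

lemma homog_mconst: "homog (mconst a) = [:mconst a:]"
  unfolding homog_def by (rule msubst_mconst[OF is_hom_const_poly])

text \<open>With a new variable for \<open>s\<close> this yields that substitution preserves homogeneity. The composition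
  formulas for a Cremona map and its inverse are the case of an inversion factor \<open>s\<close>.\<close>

lemma msubst_form_scale:
  fixes b :: "'v::finite \<Rightarrow> 'b::comm_ring_1"
  assumes "form l p"
  shows "msubst c (\<lambda>v. b v * s) p = msubst c b p * s ^ l"
proof -
  have "monom_eval (\<lambda>v. b v * s) m = monom_eval b m * s ^ l" if "m \<in> Poly_Mapping.keys p" for m
    using that assms
    by (simp add: form_def monom_eval_def power_mult_distrib prod.distrib flip: power_sum)
  then show ?thesis
    unfolding msubst_def monom_eval_def[symmetric] sum_distrib_right
    by (intro sum.cong) (simp_all add: mult.assoc)
qed

lemma form_single: "form e (Poly_Mapping.single m a) \<longleftrightarrow> a = 0 \<or> monom_deg m = e"
  by (auto simp: form_def monom_deg_def)

lemma homog_form: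
  assumes "form e (p :: ('v::finite, 'a::comm_ring_1) mpoly)"
  shows "homog p = Polynomial.monom p e"
proof -
  have "homog p = msubst (\<lambda>a. [:mconst a:]) (\<lambda>v. [:mvar v:] * Polynomial.monom 1 1) p"
    unfolding homog_def by (simp add: smult_monom)
  also have "\<dots> = msubst (\<lambda>a. [:mconst a:]) (\<lambda>v. [:mvar v:]) p * Polynomial.monom 1 1 ^ e"
    by (rule msubst_form_scale[OF assms])
  also have "msubst (\<lambda>a. [:mconst a:]) (\<lambda>v. [:mvar v:]) p = [:msubst mconst mvar p:]"
    by (rule hom_msubst[OF is_hom_pconst, symmetric])
  finally show ?thesis by (simp add: msubst_mvar_id monom_power smult_monom)
qed

lemma lookup_hcomp:
  "Poly_Mapping.lookup (hcomp e p) m = (if monom_deg m = e then Poly_Mapping.lookup (p :: ('v::finite, 'a::comm_ring_1) mpoly) m else 0)"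
proof -
  have "homog p = (\<Sum>m\<in>Poly_Mapping.keys p. Polynomial.monom (Poly_Mapping.single m (Poly_Mapping.lookup p m)) (monom_deg m))"
    by (subst sum_single_lookup[symmetric], subst is_homD(8)[OF is_hom_homog])
      (intro sum.cong refl homog_form, simp add: form_single)
  then have "Poly_Mapping.lookup (hcomp e p) m = (\<Sum>m'\<in>Poly_Mapping.keys p. Poly_Mapping.lookup
      (if monom_deg m' = e then Poly_Mapping.single m' (Poly_Mapping.lookup p m') else 0) m)"
    by (simp add: hcomp_def coeff_sum lookup_sum)
  also have "\<dots> = (\<Sum>m'\<in>Poly_Mapping.keys p.
      if m' = m then (if monom_deg m = e then Poly_Mapping.lookup p m else 0) else 0)"
    by (intro sum.cong refl) (auto simp: lookup_single when_def)
  also have "\<dots> = (if monom_deg m = e then Poly_Mapping.lookup p m else 0)" by (auto simp: in_keys_iff)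
  finally show ?thesis .
qed

lemma form_iff_lookup: "form e p \<longleftrightarrow> (\<forall>m. Poly_Mapping.lookup p m \<noteq> 0 \<longrightarrow> monom_deg m = e)"
  by (auto simp: form_def monom_deg_def in_keys_iff)

context
  fixes p q :: "('v::finite, 'a::comm_ring_1) mpoly"
begin

lemma form_hcomp: "form e (hcomp e p)"
  by (auto simp: form_iff_lookup lookup_hcomp)

lemma hcomp_form: "form d p \<Longrightarrow> hcomp e p = (if e = d then p else 0)"
  by (auto simp: form_iff_lookup lookup_hcomp intro!: poly_mapping_eqI)

lemma hcomp_add: "hcomp e (p + q) = hcomp e p + hcomp e q"
  by (simp add: hcomp_def is_homD[OF is_hom_homog])

lemma hcomp_diff: "hcomp e (p - q) = hcomp e p - hcomp e q"
  by (simp add: hcomp_def is_homD[OF is_hom_homog])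

lemma hcomp_mult: "hcomp e (p * q) = (\<Sum>i\<le>e. hcomp i p * hcomp (e - i) q)"
  by (simp add: hcomp_def is_homD[OF is_hom_homog] coeff_mult)

lemma hcomp_zero: "hcomp e (0 :: ('v, 'a) mpoly) = 0"
  by (simp add: hcomp_def is_homD(4)[OF is_hom_homog])

lemma hcomp_sum: "hcomp e (sum h Y) = (\<Sum>y\<in>Y. hcomp e (h y :: ('v, 'a) mpoly))"
  by (simp add: hcomp_def is_homD(8)[OF is_hom_homog] coeff_sum)

lemma sum_hcomp: "(\<Sum>e\<le>degree (homog p). hcomp e p) = p"
proof -
  have "is_hom (\<lambda>p :: ('v, 'a) mpoly. poly (homog p) 1)"
    using is_hom_homog[where 'v = 'v and 'a = 'a] by (simp add: is_hom_def)
  then have "poly (homog p) 1 = p"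
    using hom_eqI[of "\<lambda>p. poly (homog p) 1" "\<lambda>p. p" p]
    by (simp add: homog_def msubst_mconst[OF is_hom_const_poly] msubst_mvar[OF is_hom_const_poly]
        poly_monom is_hom_def)
  then show ?thesis by (simp add: poly_altdef hcomp_def)
qed

end

lemma form_iff_homog:
  "form e p \<longleftrightarrow> homog p = Polynomial.monom (p :: ('v::finite, 'a::comm_ring_1) mpoly) e"
proof
  assume "homog p = Polynomial.monom p e"
  then have "hcomp e p = p" by (simp add: hcomp_def)
  then show "form e p" using form_hcomp[of e p] by simp
qed (rule homog_form)

lemma form_mult:
  fixes p q :: "('v::finite, 'a::comm_ring_1) mpoly"
  shows "form d p \<Longrightarrow> form e q \<Longrightarrow> form (d + e) (p * q)"
  by (simp add: form_iff_homog is_homD(3)[OF is_hom_homog] mult_monom)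

lemma form_power:
  fixes p :: "('v::finite, 'a::comm_ring_1) mpoly"
  shows "form d p \<Longrightarrow> form (d * n) (p ^ n)"
  by (simp add: form_iff_homog is_homD(7)[OF is_hom_homog] monom_power)

lemma form_mvar: "form 1 (mvar v :: ('v::finite, 'a::comm_ring_1) mpoly)"
  by (simp add: mvar_def form_single)

lemma form_unique:
  assumes "form d p" "form e p" "p \<noteq> (0 :: ('v::finite, 'a::comm_ring_1) mpoly)"
  shows "d = e"
  using hcomp_form[OF assms(1), of d] hcomp_form[OF assms(2), of d] assms(3) by (auto split: if_splits)

text \<open>In \<open>homog p * homog q\<close> the first factor is a monomial, so that each homogeneous component of \<open>q\<close>
  contributes to its own degree of the product. Only one of them can be nonzero.\<close>

lemma form_quotient:
  fixes p q :: "('v::{finite, linorder}, 'a::idom) mpoly"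
  assumes p: "form a p" "p \<noteq> 0" and pq: "form b (p * q)" and q: "q \<noteq> 0"
  shows "a \<le> b \<and> form (b - a) q"
proof -
  have "Polynomial.monom p a * homog q = Polynomial.monom (p * q) b"
    using pq p(1) by (simp add: form_iff_homog is_homD(3)[OF is_hom_homog])
  then have "coeff (Polynomial.monom p a * homog q) (a + e) = (if a + e = b then p * q else 0)" for e
    by simp
  then have *: "p * hcomp e q = (if a + e = b then p * q else 0)" for e
    by (simp add: hcomp_def coeff_monom_mult)
  have "\<exists>e. hcomp e q \<noteq> 0" using sum_hcomp[of q] q by (metis sum.neutral)
  then obtain e where "hcomp e q \<noteq> 0" ..
  then have e: "a + e = b" using *[of e] p(2) by (metis no_zero_divisors)
  then have "hcomp e q = q" using *[of e] p(2) by simp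
  then show ?thesis using form_hcomp[of e q] e by auto
qed

lemma form_msubst:
  fixes q :: "('v::finite, 'a::comm_ring_1) mpoly" and f :: "'v \<Rightarrow> ('w::finite, 'a) mpoly"
  assumes q: "form l q" and f: "\<And>v. form d (f v)"
  shows "form (d * l) (msubst mconst f q)"
proof -
  have "homog (msubst mconst f q) = msubst (\<lambda>a. [:mconst a:]) (\<lambda>v. [:f v:] * Polynomial.monom 1 d) q"
    using f by (simp add: hom_msubst[OF is_hom_homog] form_iff_homog homog_mconst smult_monom)
  also have "\<dots> = msubst (\<lambda>a. [:mconst a:]) (\<lambda>v. [:f v:]) q * Polynomial.monom 1 d ^ l"
    by (rule msubst_form_scale[OF q])
  also have "msubst (\<lambda>a. [:mconst a:]) (\<lambda>v. [:f v:]) q = [:msubst mconst f q:]"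
    by (rule hom_msubst[OF is_hom_pconst, symmetric])
  finally show ?thesis by (simp add: form_iff_homog monom_power smult_monom)
qed

lemma msubst_msubst:
  fixes f :: "'v \<Rightarrow> ('w::finite, 'a::comm_ring_1) mpoly" and h :: "'w \<Rightarrow> 'b::comm_ring_1"
  assumes c: "is_hom c"
  shows "msubst c h (msubst mconst f p) = msubst c (\<lambda>v. msubst c h (f v)) p"
  by (simp add: hom_msubst[OF is_hom_msubst[OF c]] msubst_mconst[OF c])

section \<open>Polynomial rings over a field are Noetherian and factorial\<close>

lemma is_subring_range_mconst: "is_subring (range (mconst :: 'a::comm_ring_1 \<Rightarrow> ('v, 'a) mpoly))"
  unfolding is_subring_def
  using is_homD(1,3,6)[OF is_hom_mconst[where 'v = 'v and 'a = 'a]]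
  by (auto simp: image_iff) metis+

lemma mconst_inverse: "(a :: 'k::field) \<noteq> 0 \<Longrightarrow> mconst (inverse a) * mconst a = 1"
  by (simp add: mconst_def mult_single)

text \<open>A field has only two ideals, and the variables are adjoined to the constants.\<close>

lemma noetherian_mpoly: "noetherian (UNIV :: ('v::finite, 'k::field) mpoly set)"
proof -
  let ?K = "range (mconst :: 'k \<Rightarrow> ('v, 'k) mpoly)"
  have ideal: "J = {0} \<or> J = ?K" if J: "is_ideal ?K J" for J
  proof (rule disjCI)
    assume "J \<noteq> ?K"
    have "a = 0" if a: "a \<in> J" for a
    proof (rule ccontr)
      assume "a \<noteq> 0"
      obtain c where c: "a = mconst c" using is_idealD(1)[OF J] a by blast
      with \<open>a \<noteq> 0\<close> have "c \<noteq> 0" by (auto simp: mconst_def)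
      then have "mconst (b * inverse c) * a = mconst b" for b
        unfolding c by (simp add: mconst_def mult_single field_simps)
      then have "?K \<subseteq> J" using is_idealD(4)[OF J _ a] by (metis image_subsetI rangeI)
      then show False using is_idealD(1)[OF J] \<open>J \<noteq> ?K\<close> by blast
    qed
    then show "J = {0}" using is_idealD(2)[OF J] by blast
  qed
  have "noetherian ?K"
    unfolding noetherian_def
  proof (intro allI impI, elim conjE)
    fix J assume J: "\<forall>i. is_ideal ?K (J i)" and inc: "\<forall>i. J i \<subseteq> J (Suc i)"
    have mono: "J i \<subseteq> J j" if "i \<le> j" for i j
      using lift_Suc_mono_le[of J, OF _ that] inc by blast
    show "\<exists>N. \<forall>i\<ge>N. J i = J N"
    proof (cases "\<exists>N. J N = ?K")
      case True
      then obtain N where N: "J N = ?K" ..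
      have "J i = J N" if "i \<ge> N" for i
        using mono[OF that] is_idealD(1)[OF J[rule_format, of i]] N by simp
      then show ?thesis by blast
    next
      case False
      then have "J i = {0}" for i using ideal[OF J[rule_format]] by blast
      then show ?thesis by simp
    qed
  qed
  from noetherian_finitely_generated[OF is_subring_range_mconst this finite_imageI[OF finite_UNIV]]
  obtain C where C: "is_subring C" "noetherian C" "?K \<union> range mvar \<subseteq> C" by blast
  then have "C = UNIV" by (intro mpoly_generated) auto
  with C(2) show ?thesis by simp
qed

lemma mult_mvar_power:
  fixes c :: "('v, 'a::comm_ring_1) mpoly"
  shows "c * mvar v ^ j = (\<Sum>n\<in>Poly_Mapping.keys c.
    Poly_Mapping.single (n + Poly_Mapping.single v j) (Poly_Mapping.lookup c n))"
  by (subst sum_single_lookup[symmetric]) (simp add: mvar_power sum_distrib_right mult_single)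

lemma lookup_mult_mvar_power:
  fixes c :: "('v, 'a::comm_ring_1) mpoly"
  shows "Poly_Mapping.lookup (c * mvar v ^ j) (m + Poly_Mapping.single v j) = Poly_Mapping.lookup c m"
proof -
  have "Poly_Mapping.lookup (c * mvar v ^ j) (m + Poly_Mapping.single v j)
      = (\<Sum>n\<in>Poly_Mapping.keys c. if n = m then Poly_Mapping.lookup c n else 0)"
    by (simp add: mult_mvar_power lookup_sum lookup_single when_def)
  then show ?thesis by (simp add: in_keys_iff)
qed

lemma lookup_mult_mvar_power_less:
  fixes c :: "('v, 'a::comm_ring_1) mpoly"
  assumes "Poly_Mapping.lookup m v < j"
  shows "Poly_Mapping.lookup (c * mvar v ^ j) m = 0"
proof -
  have "n + Poly_Mapping.single v j \<noteq> m" for n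
    using assms by (auto simp: lookup_add)
  then show ?thesis by (simp add: mult_mvar_power lookup_sum lookup_single)
qed

definition mpoly_in :: "'v set \<Rightarrow> ('v, 'a::comm_ring_1) mpoly set" where
  "mpoly_in V = {p. \<forall>m\<in>Poly_Mapping.keys p. Poly_Mapping.keys m \<subseteq> V}"

lemma is_subring_mpoly_in: "is_subring (mpoly_in V :: ('v, 'a::comm_ring_1) mpoly set)"
  unfolding is_subring_def
proof (intro conjI ballI)
  show "1 \<in> (mpoly_in V :: ('v, 'a) mpoly set)" by (simp add: mpoly_in_def)
  fix p q :: "('v, 'a) mpoly" assume pq: "p \<in> mpoly_in V" "q \<in> mpoly_in V"
  have "Poly_Mapping.keys (p - q) \<subseteq> Poly_Mapping.keys p \<union> Poly_Mapping.keys q"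
    by (auto simp: in_keys_iff lookup_minus)
  then show "p - q \<in> mpoly_in V" using pq by (force simp: mpoly_in_def)
  show "p * q \<in> mpoly_in V"
    unfolding mpoly_in_def mem_Collect_eq
  proof
    fix m assume "m \<in> Poly_Mapping.keys (p * q)"
    then obtain a b where ab: "m = a + b" "a \<in> Poly_Mapping.keys p" "b \<in> Poly_Mapping.keys q"
      using keys_mult[of p q] by blast
    then have "Poly_Mapping.keys a \<subseteq> V" "Poly_Mapping.keys b \<subseteq> V" using pq by (auto simp: mpoly_in_def)
    then show "Poly_Mapping.keys m \<subseteq> V" using keys_add[of a b] unfolding ab(1) by blast
  qed
qed

text \<open>A relation \<open>\<Sum> c\<^sub>i v\<^sup>i = 0\<close> is read off at the monomials \<open>m v\<^sup>i\<close>, where \<open>m\<close> is free of \<open>v\<close>.\<close>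

lemma mvar_transcendental:
  fixes p :: "('v, 'a::comm_ring_1) mpoly poly"
  assumes v: "v \<notin> V" and p: "p \<in> poly_over (mpoly_in V)" and zero: "poly p (mvar v) = 0"
  shows "p = 0"
proof (rule poly_eqI)
  fix i
  have off: "Poly_Mapping.lookup (coeff p j) n = 0" if n: "v \<in> Poly_Mapping.keys n" for j n
  proof (rule ccontr)
    assume "Poly_Mapping.lookup (coeff p j) n \<noteq> 0"
    then have "n \<in> Poly_Mapping.keys (coeff p j)" by (simp add: in_keys_iff)
    then have "Poly_Mapping.keys n \<subseteq> V" using p unfolding poly_over_def mpoly_in_def by blast
    then show False using n v by blast
  qed
  have "Poly_Mapping.lookup (coeff p i) m = 0" for m
  proof (cases "Poly_Mapping.lookup m v = 0")
    case False
    then show ?thesis by (intro off) (simp add: in_keys_iff)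
  next
    case True
    let ?m = "m + Poly_Mapping.single v i"
    have other: "Poly_Mapping.lookup (coeff p j * mvar v ^ j) ?m = 0" if "j \<noteq> i" for j
    proof (cases "j < i")
      case False
      then show ?thesis using that True
        by (intro lookup_mult_mvar_power_less) (simp add: lookup_add)
    next
      case j: True
      have "?m = (m + Poly_Mapping.single v (i - j)) + Poly_Mapping.single v j"
        using j by (simp add: add.assoc flip: single_add)
      then have "Poly_Mapping.lookup (coeff p j * mvar v ^ j) ?m
          = Poly_Mapping.lookup (coeff p j) (m + Poly_Mapping.single v (i - j))"
        by (simp only: lookup_mult_mvar_power)
      moreover have "v \<in> Poly_Mapping.keys (m + Poly_Mapping.single v (i - j))"
        using j by (simp add: in_keys_iff lookup_add)
      ultimately show ?thesis using off by simp
    qed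
    have "poly p (mvar v) = (\<Sum>j\<le>max i (degree p). coeff p j * mvar v ^ j)"
      unfolding poly_altdef by (rule sum.mono_neutral_left) (auto simp: coeff_eq_0)
    then have "0 = Poly_Mapping.lookup (\<Sum>j\<le>max i (degree p). coeff p j * mvar v ^ j) ?m"
      using zero by simp
    also have "\<dots> = (\<Sum>j\<le>max i (degree p). if j = i then Poly_Mapping.lookup (coeff p i) m else 0)"
      unfolding lookup_sum using other by (intro sum.cong) (auto simp: lookup_mult_mvar_power)
    finally show ?thesis by simp
  qed
  then show "coeff p i = coeff 0 i" by (simp add: poly_mapping_eqI)
qed

text \<open>The bound \<open>mpoly_in V\<close> is carried through the induction because it makes the next variable
  transcendental.\<close>

theorem factorial_mpoly:
  "factorial_in (UNIV :: ('v::{finite, linorder}, 'k::field) mpoly set)"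
proof -
  let ?K = "range (mconst :: 'k \<Rightarrow> ('v, 'k) mpoly)"
  have "\<exists>C. is_subring C \<and> factorial_in C \<and> ?K \<union> mvar ` V \<subseteq> C \<and> C \<subseteq> mpoly_in V"
    if "finite V" for V :: "'v set"
    using that
  proof induction
    case empty
    have "factorial_in ?K"
      unfolding factorial_in_def
    proof (intro ballI impI)
      fix a assume a: "a \<in> ?K" "a \<noteq> 0"
      then obtain c where c: "a = mconst c" "c \<noteq> 0" by (metis imageE mconst_def single_zero)
      have "1 = a * mconst (inverse c)" using mconst_inverse[OF c(2)] unfolding c(1) by (metis mult.commute)
      then have "dvd_in ?K a 1" unfolding dvd_in_def by blast
      then show "\<exists>n. prime_product ?K n a" using prime_product.unit[OF a(1)] by blast
    qed
    moreover have "?K \<subseteq> mpoly_in {}" by (auto simp: mpoly_in_def mconst_def split: if_splits)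
    ultimately show ?case using is_subring_range_mconst by (intro exI[of _ ?K]) auto
  next
    case (insert v V)
    then obtain C where C: "is_subring C" "factorial_in C" "?K \<union> mvar ` V \<subseteq> C" "C \<subseteq> mpoly_in V"
      by blast
    have "p = 0" if "p \<in> poly_over C" "poly p (mvar v) = 0" for p
      using that C(4) mvar_transcendental[OF insert(2), of p] by (auto simp: poly_over_def)
    then have "factorial_in (adjoin C (mvar v))" by (rule factorial_in_adjoin[OF C(1,2)])
    moreover have "mpoly_in V \<subseteq> (mpoly_in (insert v V) :: ('v, 'k) mpoly set)"
      by (auto simp: mpoly_in_def)
    then have "adjoin C (mvar v) \<subseteq> mpoly_in (insert v V)"
      using C(4) by (intro adjoin_least[OF C(1) is_subring_mpoly_in])
        (auto simp: mpoly_in_def mvar_def)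
    moreover have "?K \<union> mvar ` insert v V \<subseteq> adjoin C (mvar v)"
      using C(3) subset_adjoin[OF C(1), of "mvar v"] mem_adjoin[OF C(1), of "mvar v"] by blast
    ultimately show ?case using is_subring_adjoin[OF C(1)] by blast
  qed
  from this[of UNIV] obtain C where C: "is_subring C" "factorial_in C" "?K \<union> range mvar \<subseteq> C" by auto
  then have "C = UNIV" by (intro mpoly_generated) auto
  with C(2) show ?thesis by simp
qed

section \<open>Ring records, quotient modules and depth\<close>

text \<open>The bridge from subsets of a type to ring records.\<close>

definition ring_on :: "'a::comm_ring_1 set \<Rightarrow> 'a ring" where
  "ring_on B = ring_of_type_algebra\<lparr>carrier := B\<rparr>"

lemma ring_on_simps [simp]:
  "carrier (ring_on B) = B" "monoid.mult (ring_on B) = (*)" "add (ring_on B) = (+)"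
  "one (ring_on B) = 1" "zero (ring_on B) = 0"
  by (simp_all add: ring_on_def ring_of_type_algebra_def)

lemma ring_on_UNIV: "ring_on UNIV = ring_of_type_algebra"
  by (simp add: ring_on_def ring_of_type_algebra_def)

lemma cring_ring_on:
  assumes B: "is_subring B"
  shows "cring (ring_on B)"
proof (intro cringI abelian_groupI comm_monoidI)
  fix x assume "x \<in> carrier (ring_on B)"
  then show "\<exists>y\<in>carrier (ring_on B). y \<oplus>\<^bsub>ring_on B\<^esub> x = \<zero>\<^bsub>ring_on B\<^esub>"
    using is_subringD(6)[OF B] by (intro bexI[of _ "- x"]) auto
qed (auto simp: algebra_simps is_subringD[OF B])

lemma a_minus_ring_on:
  assumes B: "is_subring B" and "a \<in> B" "b \<in> B"
  shows "a \<ominus>\<^bsub>ring_on B\<^esub> b = a - b"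
proof -
  interpret cring "ring_on B" by (rule cring_ring_on[OF B])
  have "\<ominus>\<^bsub>ring_on B\<^esub> b = - b"
    using assms is_subringD(6)[OF B] by (intro minus_equality) auto
  then show ?thesis by (simp add: a_minus_def)
qed

lemma ideal_ring_on_iff:
  assumes B: "is_subring B"
  shows "ideal J (ring_on B) \<longleftrightarrow> is_ideal B J"
proof
  assume "ideal J (ring_on B)"
  then interpret ideal J "ring_on B" .
  show "is_ideal B J"
    unfolding is_ideal_def
    using a_subset additive_subgroup.zero_closed[OF is_additive_subgroup]
      additive_subgroup.a_closed[OF is_additive_subgroup] I_l_closed by auto
next
  assume J: "is_ideal B J"
  interpret cring "ring_on B" by (rule cring_ring_on[OF B])
  show "ideal J (ring_on B)"
  proof (rule idealI)
    show "ring (ring_on B)" by (rule cring.axioms(1)[OF cring_ring_on[OF B]])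
    show "subgroup J (add_monoid (ring_on B))"
    proof (rule add.subgroupI)
      show "J \<subseteq> carrier (ring_on B)" "J \<noteq> {}" using is_idealD[OF J] by auto
      show "\<ominus>\<^bsub>ring_on B\<^esub> a \<in> J" if "a \<in> J" for a
      proof -
        have "a \<in> B" using is_idealD(1)[OF J] that by blast
        then have "\<ominus>\<^bsub>ring_on B\<^esub> a = 0 - a"
          using is_subringD(6)[OF B] by (intro minus_equality) auto
        then show ?thesis using is_ideal_diff[OF B J is_idealD(2)[OF J] that] by simp
      qed
      show "a \<oplus>\<^bsub>ring_on B\<^esub> b \<in> J" if "a \<in> J" "b \<in> J" for a b
        using is_idealD(3)[OF J that] by simp
    qed
    show "x \<otimes>\<^bsub>ring_on B\<^esub> a \<in> J" "a \<otimes>\<^bsub>ring_on B\<^esub> x \<in> J"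
      if "a \<in> J" "x \<in> carrier (ring_on B)" for a x
      using is_idealD(4)[OF J, of x a] that by (simp_all add: mult.commute)
  qed
qed

lemma primeideal_ring_on_iff:
  assumes B: "is_subring B"
  shows "primeideal P (ring_on B) \<longleftrightarrow> is_prime_ideal B P"
proof
  assume "primeideal P (ring_on B)"
  then interpret primeideal P "ring_on B" .
  show "is_prime_ideal B P"
    unfolding is_prime_ideal_def
    using is_ideal ideal_ring_on_iff[OF B] I_prime I_notcarr one_imp_carrier by auto
next
  assume P: "is_prime_ideal B P"
  then have ideal: "ideal P (ring_on B)" using ideal_ring_on_iff[OF B] by (simp add: is_prime_ideal_def)
  show "primeideal P (ring_on B)"
    using P is_subringD(1)[OF B] unfolding is_prime_ideal_def
    by (intro primeidealI[OF ideal cring_ring_on[OF B]]) auto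
qed

text \<open>The record fields of the modules that occur all come from the type, but their carriers may be
  smaller: the quotient of a symbolic power by a power is formed in the carrier of the former.\<close>

definition coset :: "'a::comm_ring_1 set \<Rightarrow> 'a \<Rightarrow> 'a set" where
  "coset N x = (\<lambda>y. y + x) ` N"

lemma coset_eq_iff:
  assumes N: "is_ideal UNIV N"
  shows "coset N x = coset N y \<longleftrightarrow> x - y \<in> N"
proof
  assume "coset N x = coset N y"
  moreover have "x \<in> coset N x" using is_idealD(2)[OF N] by (force simp: coset_def)
  ultimately show "x - y \<in> N" by (auto simp: coset_def)
next
  have sub: "coset N x \<subseteq> coset N y" if "x - y \<in> N" for x y
  proof
    fix z assume "z \<in> coset N x"
    then obtain u where u: "u \<in> N" "z = u + x" by (auto simp: coset_def)
    have "z = (u + (x - y)) + y" using u(2) by simp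
    then show "z \<in> coset N y" unfolding coset_def using is_idealD(3)[OF N u(1) that] by blast
  qed
  assume xy: "x - y \<in> N"
  then have "y - x \<in> N" using is_ideal_diff[OF is_subring_UNIV N is_idealD(2)[OF N], of "x - y"] by simp
  with xy show "coset N x = coset N y" using sub by blast
qed

lemma coset_self: "is_ideal UNIV N \<Longrightarrow> x \<in> coset N x"
  using is_idealD(2) by (force simp: coset_def)

lemma coset_zero: "coset N 0 = N"
  by (simp add: coset_def)

lemma coset_eq_ideal_iff: "is_ideal UNIV N \<Longrightarrow> coset N x = N \<longleftrightarrow> x \<in> N"
  using coset_eq_iff[of N x 0] by (simp add: coset_zero)

lemma quot_module_simps:
  fixes N C :: "'a::comm_ring_1 set"
  defines "M \<equiv> quot_module ((self_module (ring_on UNIV))\<lparr>carrier := C\<rparr>) N"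
  assumes N: "is_ideal UNIV N"
  shows "carrier M = coset N ` C" "\<zero>\<^bsub>M\<^esub> = N" "\<zero>\<^bsub>M\<^esub> = coset N 0"
    "a \<odot>\<^bsub>M\<^esub> coset N x = coset N (a * x)" "coset N x \<oplus>\<^bsub>M\<^esub> coset N y = coset N (x + y)"
proof -
  have r_coset: "N +>\<^bsub>(self_module (ring_on UNIV))\<lparr>carrier := C\<rparr>\<^esub> x = coset N x" for x
    by (auto simp: a_r_coset_def r_coset_def self_module_def coset_def)
  show "carrier M = coset N ` C"
    by (auto simp: M_def quot_module_def A_RCOSETS_def RCOSETS_def r_coset_def coset_def
        self_module_def)
  show "\<zero>\<^bsub>M\<^esub> = N" by (simp add: M_def quot_module_def)
  then show "\<zero>\<^bsub>M\<^esub> = coset N 0" by (simp add: coset_zero)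
  have "coset N (a * y) = coset N (a * x)" if y: "y \<in> coset N x" for y
  proof -
    have "y - x \<in> N" using y by (auto simp: coset_def)
    then have "a * (y - x) \<in> N" using is_idealD(4)[OF N] by blast
    then show ?thesis using coset_eq_iff[OF N] by (simp add: right_diff_distrib)
  qed
  then have "(\<Union>y\<in>coset N x. coset N (a * y)) = coset N (a * x)" using coset_self[OF N, of x] by blast
  then show "a \<odot>\<^bsub>M\<^esub> coset N x = coset N (a * x)"
    by (simp add: M_def quot_module_def r_coset) (simp add: self_module_def)
  have "coset N x \<oplus>\<^bsub>M\<^esub> coset N y = (\<Union>u\<in>coset N x. \<Union>v\<in>coset N y. {u + v})"
    by (simp add: M_def quot_module_def set_add_def set_mult_def self_module_def)
  also have "\<dots> = coset N (x + y)"
  proof (intro equalityI subsetI)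
    fix z assume "z \<in> (\<Union>u\<in>coset N x. \<Union>v\<in>coset N y. {u + v})"
    then obtain u v where uv: "u \<in> N" "v \<in> N" "z = (u + x) + (v + y)" by (auto simp: coset_def)
    then have "z = (u + v) + (x + y)" by simp
    then show "z \<in> coset N (x + y)" unfolding coset_def using is_idealD(3)[OF N uv(1,2)] by blast
  next
    fix z assume "z \<in> coset N (x + y)"
    then obtain u where "u \<in> N" "z = (u + x) + (0 + y)" by (auto simp: coset_def add.assoc)
    then show "z \<in> (\<Union>u\<in>coset N x. \<Union>v\<in>coset N y. {u + v})"
      unfolding coset_def using is_idealD(2)[OF N] by blast
  qed
  finally show "coset N x \<oplus>\<^bsub>M\<^esub> coset N y = coset N (x + y)" .
qed

lemma self_module_UNIV: "(self_module (ring_on UNIV))\<lparr>carrier := UNIV\<rparr> = self_module (ring_on UNIV)"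
  by (simp add: self_module_def)

lemmas quot_UNIV_simps = quot_module_simps[where C = UNIV, unfolded self_module_UNIV]

lemma group_quot_module:
  fixes N :: "'a::comm_ring_1 set"
  assumes N: "is_ideal UNIV N"
  shows "group (add_monoid (quot_module (self_module (ring_on UNIV)) N))"
    (is "group (add_monoid ?M)")
proof (rule groupI)
  note s = quot_UNIV_simps[OF N]
  show "\<one>\<^bsub>add_monoid ?M\<^esub> \<in> carrier (add_monoid ?M)" using s(1,3) by simp
  fix U assume "U \<in> carrier (add_monoid ?M)"
  then obtain x where x: "U = coset N x" using s(1) by auto
  show "\<one>\<^bsub>add_monoid ?M\<^esub> \<otimes>\<^bsub>add_monoid ?M\<^esub> U = U" by (simp add: x s(3,5))
  show "\<exists>Y\<in>carrier (add_monoid ?M). Y \<otimes>\<^bsub>add_monoid ?M\<^esub> U = \<one>\<^bsub>add_monoid ?M\<^esub>"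
    using s(1) by (intro bexI[of _ "coset N (- x)"]) (auto simp: x s(3,5))
  fix Y assume "Y \<in> carrier (add_monoid ?M)"
  then obtain y where y: "Y = coset N y" using s(1) by auto
  show "U \<otimes>\<^bsub>add_monoid ?M\<^esub> Y \<in> carrier (add_monoid ?M)" using s(1) by (simp add: x y s(5))
  fix Z assume "Z \<in> carrier (add_monoid ?M)"
  then obtain z where z: "Z = coset N z" using s(1) by auto
  show "U \<otimes>\<^bsub>add_monoid ?M\<^esub> Y \<otimes>\<^bsub>add_monoid ?M\<^esub> Z = U \<otimes>\<^bsub>add_monoid ?M\<^esub> (Y \<otimes>\<^bsub>add_monoid ?M\<^esub> Z)"
    by (simp add: x y z s(5) add.assoc)
qed

lemma submodule_quot_module:
  fixes N :: "'a::comm_ring_1 set"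
  assumes N: "is_ideal UNIV N" and T: "is_ideal UNIV T"
  shows "submodule (coset N ` T) (ring_on UNIV) (quot_module (self_module (ring_on UNIV)) N)"
    (is "submodule _ _ ?M")
proof (intro submodule.intro submodule_axioms.intro)
  note s = quot_UNIV_simps[OF N]
  interpret M: group "add_monoid ?M" by (rule group_quot_module[OF N])
  show "subgroup (coset N ` T) (add_monoid ?M)"
  proof (rule M.subgroupI)
    show "coset N ` T \<subseteq> carrier (add_monoid ?M)" using s(1) by auto
    show "coset N ` T \<noteq> {}" using is_idealD(2)[OF T] by auto
    show "inv\<^bsub>add_monoid ?M\<^esub> U \<in> coset N ` T" if U: "U \<in> coset N ` T" for U
    proof -
      obtain x where x: "x \<in> T" "U = coset N x" using U by blast
      have "inv\<^bsub>add_monoid ?M\<^esub> U = coset N (0 - x)"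
        using s(1) by (intro M.inv_equality) (auto simp: x(2) s(3,5))
      then show ?thesis
        using is_ideal_diff[OF is_subring_UNIV T is_idealD(2)[OF T] x(1)] by blast
    qed
    show "U \<otimes>\<^bsub>add_monoid ?M\<^esub> Y \<in> coset N ` T" if "U \<in> coset N ` T" "Y \<in> coset N ` T" for U Y
      using that is_idealD(3)[OF T] by (auto simp: s(5))
  qed
  show "a \<odot>\<^bsub>?M\<^esub> U \<in> coset N ` T" if "U \<in> coset N ` T" for a U
    using that is_idealD(4)[OF T] by (auto simp: s(4))
qed

lemma gen_submodule_least: "submodule N A M \<Longrightarrow> E \<subseteq> N \<Longrightarrow> gen_submodule A M E \<subseteq> N"
  by (auto simp: gen_submodule_def)

lemma gen_submodule_superset: "E \<subseteq> gen_submodule A M E"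
  by (auto simp: gen_submodule_def)

lemma gen_submodule_empty:
  assumes "submodule {\<zero>\<^bsub>M\<^esub>} A M"
  shows "gen_submodule A M {} = {\<zero>\<^bsub>M\<^esub>}"
proof
  show "gen_submodule A M {} \<subseteq> {\<zero>\<^bsub>M\<^esub>}" by (rule gen_submodule_least[OF assms]) simp
  show "{\<zero>\<^bsub>M\<^esub>} \<subseteq> gen_submodule A M {}"
    using subgroup.one_closed[OF submodule.axioms(1)] by (fastforce simp: gen_submodule_def)
qed

text \<open>The first condition on a regular sequence concerns the quotient by the zero submodule, whose cosets are
  singletons.\<close>

lemma regular_seq_first:
  assumes reg: "regular_seq A M as" "as \<noteq> []" and sub: "submodule {\<zero>\<^bsub>M\<^esub>} A M"
    and group: "group (add_monoid M)" and smult: "\<And>x. x \<in> carrier M \<Longrightarrow> (as ! 0) \<odot>\<^bsub>M\<^esub> x \<in> carrier M"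
    and x: "x \<in> carrier M" "(as ! 0) \<odot>\<^bsub>M\<^esub> x = \<zero>\<^bsub>M\<^esub>"
  shows "x = \<zero>\<^bsub>M\<^esub>"
proof -
  interpret M: group "add_monoid M" by (rule group)
  have "ideal_smult A (set (take 0 as)) M = {\<zero>\<^bsub>M\<^esub>}"
    by (simp add: ideal_smult_def gen_submodule_empty[OF sub])
  then have reg0: "\<forall>B \<in> carrier (quot_module M {\<zero>\<^bsub>M\<^esub>}).
      (as ! 0) \<odot>\<^bsub>quot_module M {\<zero>\<^bsub>M\<^esub>}\<^esub> B = \<zero>\<^bsub>quot_module M {\<zero>\<^bsub>M\<^esub>}\<^esub>
      \<longrightarrow> B = \<zero>\<^bsub>quot_module M {\<zero>\<^bsub>M\<^esub>}\<^esub>"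
    using reg unfolding regular_seq_def by (metis length_greater_0_conv)
  have r_coset: "{\<zero>\<^bsub>M\<^esub>} +>\<^bsub>M\<^esub> y = {y}" if "y \<in> carrier M" for y
    using M.l_one that by (auto simp: a_r_coset_def r_coset_def)
  have "{x} \<in> carrier (quot_module M {\<zero>\<^bsub>M\<^esub>})"
    using x(1) r_coset by (auto simp: quot_module_def A_RCOSETS_def RCOSETS_def a_r_coset_def intro!: bexI[of _ x])
  moreover have "(as ! 0) \<odot>\<^bsub>quot_module M {\<zero>\<^bsub>M\<^esub>}\<^esub> {x} = \<zero>\<^bsub>quot_module M {\<zero>\<^bsub>M\<^esub>}\<^esub>"
    using x(2) smult[OF x(1)] r_coset by (simp add: quot_module_def)
  ultimately have "{x} = \<zero>\<^bsub>quot_module M {\<zero>\<^bsub>M\<^esub>}\<^esub>" using reg0 by blast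
  then show ?thesis by (simp add: quot_module_def)
qed

text \<open>The case of infinite depth is excluded by \<open>I \<subseteq> J \<noteq> R\<close>.\<close>

theorem depth_pos_nonzerodivisor:
  fixes I J :: "'a::comm_ring_1 set"
  assumes I: "is_ideal UNIV I" and J: "is_ideal UNIV J" "1 \<notin> J" "I \<subseteq> J"
    and depth: "depth (ring_on UNIV) J (quot_module (self_module (ring_on UNIV)) I) > 0"
  obtains w where "w \<in> J" "\<And>r. w * r \<in> I \<Longrightarrow> r \<in> I"
proof -
  let ?M = "quot_module (self_module (ring_on UNIV)) I"
  note s = quot_UNIV_simps[OF I]
  have "ideal_smult (ring_on UNIV) J ?M \<noteq> carrier ?M"
  proof
    assume eq: "ideal_smult (ring_on UNIV) J ?M = carrier ?M"
    have "ideal_smult (ring_on UNIV) J ?M \<subseteq> coset I ` J"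
      unfolding ideal_smult_def
    proof (rule gen_submodule_least[OF submodule_quot_module[OF I J(1)]], clarify)
      fix a U assume "a \<in> J" "U \<in> carrier ?M"
      then obtain x where x: "U = coset I x" using s(1) by auto
      have "x * a \<in> J" by (rule is_idealD(4)[OF J(1) UNIV_I \<open>a \<in> J\<close>])
      then show "a \<odot>\<^bsub>?M\<^esub> U \<in> coset I ` J" unfolding x s(4) by (simp add: mult.commute)
    qed
    then have "coset I 1 \<in> coset I ` J" using eq s(1) by blast
    then obtain x where x: "x \<in> J" "coset I 1 = coset I x" by blast
    then have "1 - x \<in> J" using coset_eq_iff[OF I] J(3) by blast
    then show False using is_idealD(3)[OF J(1) _ x(1)] J(2) by fastforce
  qed
  then have "0 < Sup {enat (length as) | as. set as \<subseteq> J \<and> regular_seq (ring_on UNIV) ?M as}"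
    using depth unfolding depth_def by simp
  then obtain as where as: "set as \<subseteq> J" "regular_seq (ring_on UNIV) ?M as" "as \<noteq> []"
    unfolding less_Sup_iff by (auto simp: zero_enat_def)
  have zero: "submodule {\<zero>\<^bsub>?M\<^esub>} (ring_on UNIV) ?M"
  proof -
    have "is_ideal UNIV {0 :: 'a}" by (simp add: is_ideal_def)
    from submodule_quot_module[OF I this] show ?thesis using s(3) by simp
  qed
  have "r \<in> I" if r: "as ! 0 * r \<in> I" for r
  proof -
    have "coset I r = \<zero>\<^bsub>?M\<^esub>"
    proof (rule regular_seq_first[OF as(2,3) zero group_quot_module[OF I]])
      show "coset I r \<in> carrier ?M" using s(1) by simp
      show "as ! 0 \<odot>\<^bsub>?M\<^esub> coset I r = \<zero>\<^bsub>?M\<^esub>"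
        unfolding s(2,4) using r coset_eq_ideal_iff[OF I] by blast
      show "as ! 0 \<odot>\<^bsub>?M\<^esub> U \<in> carrier ?M" if "U \<in> carrier ?M" for U
        using that unfolding s(1) by (auto simp: s(4))
    qed
    then show ?thesis unfolding s(2) using coset_eq_ideal_iff[OF I] by blast
  qed
  moreover have "as ! 0 \<in> J" using as(1,3) by (metis length_greater_0_conv nth_mem subsetD)
  ultimately show thesis using that by blast
qed

section \<open>Powers and symbolic powers\<close>

lemma ideal_power_0: "ideal_power (ring_on UNIV) I 0 = UNIV"
  by (simp add: ideal_power_def nat_pow_def ideals_set_def)

lemma ideal_power_Suc:
  "ideal_power (ring_on UNIV) I (Suc l) = ideal_prod (ring_on UNIV) (ideal_power (ring_on UNIV) I l) I"
  by (simp add: ideal_power_def nat_pow_def ideals_set_def)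

context
  fixes I :: "'a::comm_ring_1 set"
  assumes I: "is_ideal UNIV I"
begin

abbreviation ipow :: "nat \<Rightarrow> 'a set" where
  "ipow \<equiv> ideal_power (ring_on UNIV) I"

lemma is_ideal_ideal_power: "is_ideal UNIV (ipow l)"
proof (induction l)
  case 0
  then show ?case by (simp add: ideal_power_0 is_ideal_def)
next
  case (Suc l)
  interpret cring "ring_on (UNIV :: 'a set)" by (rule cring_ring_on[OF is_subring_UNIV])
  show ?case
    using ideal_prod_is_ideal[of "ipow l" I] Suc I
    by (simp add: ideal_power_Suc ideal_ring_on_iff[OF is_subring_UNIV])
qed

lemma ideal_power_mult_right: "a \<in> ipow l \<Longrightarrow> b \<in> I \<Longrightarrow> a * b \<in> ipow (Suc l)"
  using ideal_prod.prod[of a "ipow l" b I "ring_on UNIV"] by (simp add: ideal_power_Suc)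

lemma ideal_power_one: "a \<in> I \<Longrightarrow> a \<in> ipow 1"
  using ideal_power_mult_right[of 1 0 a] by (simp add: ideal_power_0)

lemma ideal_power_induct:
  assumes zero: "\<And>a. T 0 a"
    and add: "\<And>l a b. T l a \<Longrightarrow> T l b \<Longrightarrow> T l (a + b)"
    and mult: "\<And>l a b. a \<in> ipow l \<Longrightarrow> T l a \<Longrightarrow> b \<in> I \<Longrightarrow> T (Suc l) (a * b)"
  shows "a \<in> ipow l \<Longrightarrow> T l a"
proof (induction l arbitrary: a)
  case 0
  then show ?case using zero by simp
next
  case (Suc l)
  from Suc.prems[unfolded ideal_power_Suc] show ?case
    by (induction rule: ideal_prod.induct) (auto simp: Suc.IH intro: mult add)
qed

lemma ideal_power_mult: "a \<in> ipow l \<Longrightarrow> b \<in> ipow m \<Longrightarrow> a * b \<in> ipow (l + m)"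
proof -
  assume a: "a \<in> ipow l"
  assume "b \<in> ipow m"
  then show ?thesis
  proof (rule ideal_power_induct[of "\<lambda>m b. a * b \<in> ipow (l + m)", rotated -1])
    show "a * b \<in> ipow (l + 0)" for b
      using is_idealD(4)[OF is_ideal_ideal_power _ a, of b] by (simp add: mult.commute)
    show "a * (b + c) \<in> ipow (l + m)" if "a * b \<in> ipow (l + m)" "a * c \<in> ipow (l + m)" for m b c
      using is_idealD(3)[OF is_ideal_ideal_power that] by (simp add: distrib_left)
    show "a * (b * c) \<in> ipow (l + Suc m)" if "a * b \<in> ipow (l + m)" "c \<in> I" for m b c
      using ideal_power_mult_right[OF that] by (simp add: mult.assoc)
  qed
qed

text \<open>The set of denominators in the definition of the symbolic powers.\<close>

definition nonassoc :: "'a set" where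
  "nonassoc = UNIV - \<Union>(assoc_primes (ring_on UNIV) (quot_module (self_module (ring_on UNIV)) I))"

lemma one_nonassoc: "1 \<in> nonassoc"
  by (auto simp: nonassoc_def assoc_primes_def primeideal_ring_on_iff[OF is_subring_UNIV] is_prime_ideal_def)

lemma mult_nonassoc:
  assumes "v \<in> nonassoc" "w \<in> nonassoc"
  shows "v * w \<in> nonassoc"
  unfolding nonassoc_def
proof (rule DiffI, simp, rule notI, elim UnionE)
  fix P assume P: "P \<in> assoc_primes (ring_on UNIV) (quot_module (self_module (ring_on UNIV)) I)" "v * w \<in> P"
  have "is_prime_ideal UNIV P"
    using P(1) by (auto simp: assoc_primes_def primeideal_ring_on_iff[OF is_subring_UNIV])
  then have "v \<in> P \<or> w \<in> P" using P(2) by (simp add: is_prime_ideal_def)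
  then show False using assms P(1) unfolding nonassoc_def by blast
qed

lemma nonzerodivisor_nonassoc:
  assumes w: "\<And>r. w * r \<in> I \<Longrightarrow> r \<in> I"
  shows "w \<in> nonassoc"
proof (rule ccontr)
  note s = quot_UNIV_simps[OF I]
  assume "w \<notin> nonassoc"
  then obtain P r where P: "is_prime_ideal UNIV P" "w \<in> P"
    "P = {a. a \<odot>\<^bsub>quot_module (self_module (ring_on UNIV)) I\<^esub> coset I r
        = \<zero>\<^bsub>quot_module (self_module (ring_on UNIV)) I\<^esub>}"
    unfolding nonassoc_def assoc_primes_def primeideal_ring_on_iff[OF is_subring_UNIV] s(1) by auto
  have P_eq: "P = {a. a * r \<in> I}" unfolding P(3) s(2,4) coset_eq_ideal_iff[OF I] ..
  have "1 \<in> P" using P(2) w by (auto simp: P_eq)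
  then show False using P(1) by (simp add: is_prime_ideal_def)
qed

text \<open>The fraction \<open>a/1\<close> equals \<open>b/s\<close> with \<open>b \<in> I\<^sup>l\<close> if and only if \<open>u s a = u b\<close> for some denominator \<open>u\<close>.
  Zero may be a denominator, so that \<open>u\<close> cannot be cancelled.\<close>

lemma symbolic_power_iff:
  "a \<in> symbolic_power (ring_on UNIV) I l \<longleftrightarrow> (\<exists>w\<in>nonassoc. w * a \<in> ipow l)"
proof -
  let ?rel = "loc_rel (ring_on UNIV) nonassoc" and ?frac = "loc_frac (ring_on UNIV) nonassoc"
  have rel: "((a, s), (b, t)) \<in> ?rel \<longleftrightarrow>
      s \<in> nonassoc \<and> t \<in> nonassoc \<and> (\<exists>u\<in>nonassoc. u * (a * t - b * s) = 0)" for a b s t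
    by (simp add: loc_rel_def a_minus_ring_on[OF is_subring_UNIV])
  have rel_sym: "((b, t), (a, s)) \<in> ?rel"
    if ab: "((a, s), (b, t)) \<in> ?rel" for a b s t
  proof -
    obtain u where "u \<in> nonassoc" "u * (a * t - b * s) = 0" using ab rel by blast
    moreover from this have "u * (b * s - a * t) = 0" by (simp add: algebra_simps)
    ultimately show ?thesis using ab rel by blast
  qed
  have rel_trans: "((a, s), (c, r)) \<in> ?rel"
    if ab: "((a, s), (b, t)) \<in> ?rel"
      and bc: "((b, t), (c, r)) \<in> ?rel" for a b c s t r
  proof -
    obtain u where u: "u \<in> nonassoc" "u * (a * t - b * s) = 0" using ab rel by blast
    obtain v where v: "v \<in> nonassoc" "v * (b * r - c * t) = 0" using bc rel by blast
    have "(u * v * t) * (a * r - c * s) = v * r * (u * (a * t - b * s)) + u * s * (v * (b * r - c * t))"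
      by (simp add: algebra_simps)
    also have "\<dots> = 0" by (simp add: u v)
    finally have "(u * v * t) * (a * r - c * s) = 0" .
    moreover have "u * v * t \<in> nonassoc" using u v ab rel by (blast intro: mult_nonassoc)
    ultimately show ?thesis using ab bc rel by blast
  qed
  have frac: "?frac a s = ?frac b t \<longleftrightarrow>
      ((a, s), (b, t)) \<in> ?rel"
    if "s \<in> nonassoc" "t \<in> nonassoc" for a b s t
  proof
    have "(b, t) \<in> ?frac b t"
      using that one_nonassoc unfolding loc_frac_def by (auto simp: rel)
    then show "((a, s), (b, t)) \<in> ?rel"
      if "?frac a s = ?frac b t"
      using that unfolding loc_frac_def by blast
    show "?frac a s = ?frac b t"
      if ab: "((a, s), (b, t)) \<in> ?rel"
    proof -
      have "y \<in> ?frac a s \<longleftrightarrow> y \<in> ?frac b t" for y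
        unfolding loc_frac_def using ab rel_sym rel_trans by (cases y) blast
      then show ?thesis by blast
    qed
  qed
  have "a \<in> symbolic_power (ring_on UNIV) I l \<longleftrightarrow>
      ?frac a 1 \<in> loc_ideal (ring_on UNIV) nonassoc (ipow l)"
    by (simp add: symbolic_power_def Let_def nonassoc_def)
  also have "\<dots> \<longleftrightarrow> (\<exists>b\<in>ipow l. \<exists>s\<in>nonassoc.
      ?frac a 1 = ?frac b s)"
    unfolding loc_ideal_def mem_Collect_eq by blast
  also have "\<dots> \<longleftrightarrow> (\<exists>b\<in>ipow l. \<exists>s\<in>nonassoc. ((a, 1), (b, s)) \<in> ?rel)"
    by (intro bex_cong refl frac one_nonassoc)
  also have "\<dots> \<longleftrightarrow> (\<exists>w\<in>nonassoc. w * a \<in> ipow l)"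
  proof
    assume "\<exists>b\<in>ipow l. \<exists>s\<in>nonassoc. ((a, 1), (b, s)) \<in> ?rel"
    then obtain b s u where b: "b \<in> ipow l" "s \<in> nonassoc" "u \<in> nonassoc" "u * (a * s - b * 1) = 0"
      using rel by blast
    have "(u * s) * a = u * b" using b(4) by (simp add: algebra_simps)
    then show "\<exists>w\<in>nonassoc. w * a \<in> ipow l"
      using is_idealD(4)[OF is_ideal_ideal_power UNIV_I b(1), of u] mult_nonassoc[OF b(3,2)] by metis
  next
    assume "\<exists>w\<in>nonassoc. w * a \<in> ipow l"
    then obtain w where w: "w \<in> nonassoc" "w * a \<in> ipow l" by blast
    have "((a, 1), (w * a, w)) \<in> ?rel"
      using w one_nonassoc by (auto simp: rel mult.commute intro!: bexI[of _ 1])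
    then show "\<exists>b\<in>ipow l. \<exists>s\<in>nonassoc. ((a, 1), (b, s)) \<in> ?rel"
      using w by blast
  qed
  finally show ?thesis .
qed

lemma symbolic_power_0: "symbolic_power (ring_on UNIV) I 0 = UNIV"
  using one_nonassoc by (auto simp: symbolic_power_iff ideal_power_0)

text \<open>If some \<open>h\<close> in the symbolic power were not multiplied into the power by any power of
  \<open>x \<in> P\<close>, then the quotient would have an associated prime that does not contain \<open>x\<close>.\<close>

theorem symbolic_power_saturation:
  assumes noeth: "noetherian (UNIV :: 'a set)"
    and hyp: "zero_module (quot_module ((self_module (ring_on UNIV))\<lparr>carrier := symbolic_power (ring_on UNIV) I l\<rparr>) (ipow l)) \<or>
      primary_module (ring_on UNIV) P
        (quot_module ((self_module (ring_on UNIV))\<lparr>carrier := symbolic_power (ring_on UNIV) I l\<rparr>) (ipow l))"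
    and h: "h \<in> symbolic_power (ring_on UNIV) I l" and x: "x \<in> P"
  shows "\<exists>k. x ^ k * h \<in> ipow l"
proof (rule ccontr)
  let ?C = "symbolic_power (ring_on UNIV) I l"
  let ?M = "quot_module ((self_module (ring_on UNIV))\<lparr>carrier := ?C\<rparr>) (ipow l)"
  note ideal = is_ideal_ideal_power[of l]
  note s = quot_module_simps[OF ideal, of ?C]
  assume no_power: "\<nexists>k. x ^ k * h \<in> ipow l"
  have "h \<notin> ipow l" using no_power[unfolded not_ex, rule_format, of 0] by simp
  then have "coset (ipow l) h \<noteq> \<zero>\<^bsub>?M\<^esub>" unfolding s(2) using coset_eq_ideal_iff[OF ideal] by blast
  moreover have "coset (ipow l) h \<in> carrier ?M" using h s(1) by blast
  ultimately have "\<not> zero_module ?M" unfolding zero_module_def by blast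
  then have assoc: "assoc_primes (ring_on UNIV) ?M = {P}" using hyp unfolding primary_module_def by blast
  obtain b where b: "is_prime_ideal UNIV {r. r * (b * h) \<in> ipow l}" "x \<notin> {r. r * (b * h) \<in> ipow l}"
    using associated_prime_avoiding[OF is_subring_UNIV noeth, of "ipow l" x h] no_power
      is_idealD(2-4)[OF ideal] by auto
  obtain w where "w \<in> nonassoc" "w * h \<in> ipow l" using h symbolic_power_iff by blast
  then have "b * h \<in> ?C"
    unfolding symbolic_power_iff using is_idealD(4)[OF ideal UNIV_I, of "w * h" b]
    by (auto simp: mult.left_commute)
  then have "coset (ipow l) (b * h) \<in> carrier ?M" using s(1) by blast
  moreover have "{r. r * (b * h) \<in> ipow l} =
      {a \<in> carrier (ring_on UNIV). a \<odot>\<^bsub>?M\<^esub> coset (ipow l) (b * h) = \<zero>\<^bsub>?M\<^esub>}"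
    unfolding s(2,4) coset_eq_ideal_iff[OF ideal] by simp
  ultimately have "{r. r * (b * h) \<in> ipow l} \<in> assoc_primes (ring_on UNIV) ?M"
    unfolding assoc_primes_def primeideal_ring_on_iff[OF is_subring_UNIV] using b(1) by blast
  then have "{r. r * (b * h) \<in> ipow l} = P" unfolding assoc by (rule singletonD)
  then show False using b(2) x by simp
qed

end

section \<open>Localization of a domain and Serre's condition\<close>

text \<open>In a domain, with zero excluded from the denominators, equality of fractions is equality of the cross
  products.\<close>

context
  fixes A W :: "'a::idom set"
  assumes A: "is_subring A" and W_mult: "W \<subseteq> A" "1 \<in> W" "0 \<notin> W" "\<forall>s\<in>W. \<forall>t\<in>W. s * t \<in> W"
begin

lemmas denom = W_mult(1-3) W_mult(4)[rule_format]

abbreviation frac :: "'a \<Rightarrow> 'a \<Rightarrow> ('a \<times> 'a) set" where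
  "frac \<equiv> loc_frac (ring_on A) W"

abbreviation Local :: "('a \<times> 'a) set ring" where
  "Local \<equiv> localization (ring_on A) W"

lemma frac_eq:
  assumes "a \<in> A" "s \<in> W"
  shows "frac a s = {(b, t). b \<in> A \<and> t \<in> W \<and> a * t = b * s}"
proof -
  have "((a, s), (b, t)) \<in> loc_rel (ring_on A) W \<longleftrightarrow> b \<in> A \<and> t \<in> W \<and> a * t = b * s" for b t
  proof -
    have "a * t \<ominus>\<^bsub>ring_on A\<^esub> b * s = a * t - b * s" if "b \<in> A" "t \<in> W"
      using that assms denom(1) by (intro a_minus_ring_on[OF A] is_subringD(5)[OF A]) auto
    moreover have "(\<exists>u\<in>W. u * (a * t - b * s) = 0) \<longleftrightarrow> a * t = b * s"
      using denom(2,3) by auto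
    ultimately show ?thesis using assms by (auto simp: loc_rel_def)
  qed
  then show ?thesis unfolding loc_frac_def by auto
qed

lemma frac_eq_iff:
  assumes "a \<in> A" "s \<in> W" "b \<in> A" "t \<in> W"
  shows "frac a s = frac b t \<longleftrightarrow> a * t = b * s"
proof
  assume "frac a s = frac b t"
  moreover have "(b, t) \<in> frac b t" using assms by (simp add: frac_eq)
  ultimately have "(b, t) \<in> frac a s" by simp
  then show "a * t = b * s" using assms by (simp add: frac_eq)
next
  assume ab: "a * t = b * s"
  have nz: "s \<noteq> 0" "t \<noteq> 0" using assms denom(3) by auto
  have "a * r = c * s \<longleftrightarrow> b * r = c * t" for c r
  proof -
    have "(a * r) * t = (b * r) * s" using ab by (metis mult.assoc mult.commute)
    then have "a * r = c * s \<longleftrightarrow> (b * r) * s = (c * s) * t" using nz by (metis mult_right_cancel)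
    also have "\<dots> \<longleftrightarrow> (b * r) * s = (c * t) * s" by (simp add: mult_ac)
    also have "\<dots> \<longleftrightarrow> b * r = c * t" using nz by simp
    finally show ?thesis .
  qed
  then show "frac a s = frac b t" using assms by (simp add: frac_eq)
qed

lemma frac_self: "a \<in> A \<Longrightarrow> s \<in> W \<Longrightarrow> (a, s) \<in> frac a s"
  by (simp add: frac_eq)

lemma carrier_localization: "carrier Local = {frac a s | a s. a \<in> A \<and> s \<in> W}"
  by (auto simp: localization_def quotient_def loc_frac_def)

lemma localization_zero_one: "\<zero>\<^bsub>Local\<^esub> = frac 0 1" "\<one>\<^bsub>Local\<^esub> = frac 1 1"
  by (simp_all add: localization_def)

lemma frac_ops:
  assumes a: "a \<in> A" "s \<in> W" and b: "b \<in> A" "t \<in> W"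
  shows "frac a s \<otimes>\<^bsub>Local\<^esub> frac b t = frac (a * b) (s * t)"
    and "frac a s \<oplus>\<^bsub>Local\<^esub> frac b t = frac (a * t + b * s) (s * t)"
proof -
  have cong: "frac (a' * b') (s' * t') = frac (a * b) (s * t) \<and>
      frac (a' * t' + b' * s') (s' * t') = frac (a * t + b * s) (s * t)"
    if "(a', s') \<in> frac a s" "(b', t') \<in> frac b t" for a' s' b' t'
  proof -
    have a': "a' \<in> A" "s' \<in> W" "a * s' = a' * s" and b': "b' \<in> A" "t' \<in> W" "b * t' = b' * t"
      using that a b by (auto simp: frac_eq)
    have WA: "s \<in> A" "t \<in> A" "s' \<in> A" "t' \<in> A" using a b a' b' denom(1) by auto
    have "(a' * b') * (s * t) = (a' * s) * (b' * t)" by (simp add: mult_ac)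
    also have "\<dots> = (a * b) * (s' * t')" unfolding a'(3)[symmetric] b'(3)[symmetric] by (simp add: mult_ac)
    finally have 1: "(a' * b') * (s * t) = (a * b) * (s' * t')" .
    have "(a' * t' + b' * s') * (s * t) = (a' * s) * t' * t + (b' * t) * s' * s" by (simp add: algebra_simps)
    also have "\<dots> = (a * t + b * s) * (s' * t')"
      unfolding a'(3)[symmetric] b'(3)[symmetric] by (simp add: algebra_simps)
    finally have 2: "(a' * t' + b' * s') * (s * t) = (a * t + b * s) * (s' * t')" .
    show ?thesis
      using 1 2 a b a' b' WA by (simp add: frac_eq_iff denom(4) is_subringD(4,5)[OF A])
  qed
  have "frac a s \<otimes>\<^bsub>Local\<^esub> frac b t = (\<Union>(a', s')\<in>frac a s. \<Union>(b', t')\<in>frac b t. frac (a' * b') (s' * t'))"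
    by (simp add: localization_def)
  also have "\<dots> = frac (a * b) (s * t)" using cong frac_self[OF a] frac_self[OF b] by fast
  finally show "frac a s \<otimes>\<^bsub>Local\<^esub> frac b t = frac (a * b) (s * t)" .
  have "frac a s \<oplus>\<^bsub>Local\<^esub> frac b t = (\<Union>(a', s')\<in>frac a s. \<Union>(b', t')\<in>frac b t. frac (a' * t' + b' * s') (s' * t'))"
    by (simp add: localization_def)
  also have "\<dots> = frac (a * t + b * s) (s * t)" using cong frac_self[OF a] frac_self[OF b] by fast
  finally show "frac a s \<oplus>\<^bsub>Local\<^esub> frac b t = frac (a * t + b * s) (s * t)" .
qed

lemma localizationE:
  assumes "x \<in> carrier Local"
  obtains a s where "a \<in> A" "s \<in> W" "x = frac a s"
  using assms carrier_localization by blast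

lemma frac_carrier: "a \<in> A \<Longrightarrow> s \<in> W \<Longrightarrow> frac a s \<in> carrier Local"
  using carrier_localization by blast

lemma cring_localization: "cring Local"
proof -
  note mem = is_subringD(1,2,4,5,6)[OF A] subsetD[OF denom(1)] denom(2,4)
  show ?thesis
  proof (intro cringI abelian_groupI comm_monoidI)
    fix x assume "x \<in> carrier Local"
    then obtain a s where x: "a \<in> A" "s \<in> W" "x = frac a s" by (rule localizationE)
    show "\<zero>\<^bsub>Local\<^esub> \<oplus>\<^bsub>Local\<^esub> x = x" "\<one>\<^bsub>Local\<^esub> \<otimes>\<^bsub>Local\<^esub> x = x" using x mem by (simp_all add: localization_zero_one frac_ops)
    show "\<exists>y\<in>carrier Local. y \<oplus>\<^bsub>Local\<^esub> x = \<zero>\<^bsub>Local\<^esub>"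
      using x mem by (intro bexI[of _ "frac (- a) s"]) (simp_all add: localization_zero_one frac_ops frac_carrier frac_eq_iff)
    fix y assume "y \<in> carrier Local"
    then obtain b t where y: "b \<in> A" "t \<in> W" "y = frac b t" by (rule localizationE)
    show "x \<oplus>\<^bsub>Local\<^esub> y \<in> carrier Local" "x \<otimes>\<^bsub>Local\<^esub> y \<in> carrier Local" using x y mem by (simp_all add: frac_ops frac_carrier)
    show "x \<oplus>\<^bsub>Local\<^esub> y = y \<oplus>\<^bsub>Local\<^esub> x" "x \<otimes>\<^bsub>Local\<^esub> y = y \<otimes>\<^bsub>Local\<^esub> x"
      using x y by (simp_all add: frac_ops mult.commute add.commute)
    fix z assume "z \<in> carrier Local"
    then obtain c r where z: "c \<in> A" "r \<in> W" "z = frac c r" by (rule localizationE)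
    show "x \<oplus>\<^bsub>Local\<^esub> y \<oplus>\<^bsub>Local\<^esub> z = x \<oplus>\<^bsub>Local\<^esub> (y \<oplus>\<^bsub>Local\<^esub> z)" "x \<otimes>\<^bsub>Local\<^esub> y \<otimes>\<^bsub>Local\<^esub> z = x \<otimes>\<^bsub>Local\<^esub> (y \<otimes>\<^bsub>Local\<^esub> z)"
      using x y z mem by (simp_all add: frac_ops algebra_simps)
    show "(x \<oplus>\<^bsub>Local\<^esub> y) \<otimes>\<^bsub>Local\<^esub> z = x \<otimes>\<^bsub>Local\<^esub> z \<oplus>\<^bsub>Local\<^esub> y \<otimes>\<^bsub>Local\<^esub> z"
      using x y z mem by (simp add: frac_ops frac_eq_iff algebra_simps)
  next
    show "\<zero>\<^bsub>Local\<^esub> \<in> carrier Local" "\<one>\<^bsub>Local\<^esub> \<in> carrier Local" using mem by (simp_all add: localization_zero_one frac_carrier)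
  qed
qed

lemma frac_loc_ideal_iff:
  assumes P: "is_prime_ideal A P" "P \<inter> W = {}" and a: "a \<in> A" "s \<in> W"
  shows "frac a s \<in> loc_ideal (ring_on A) W P \<longleftrightarrow> a \<in> P"
proof
  assume "frac a s \<in> loc_ideal (ring_on A) W P"
  then obtain b t where b: "b \<in> P" "t \<in> W" "frac a s = frac b t" by (auto simp: loc_ideal_def)
  have PA: "P \<subseteq> A" using P(1) is_idealD(1) by (auto simp: is_prime_ideal_def)
  have "a * t = b * s" using b a PA by (simp add: frac_eq_iff subset_iff)
  moreover have "s * b \<in> P"
    using P(1) a(2) b(1) denom(1) is_idealD(4)[of A P s b] by (auto simp: is_prime_ideal_def)
  ultimately have "a * t \<in> P" by (simp add: mult.commute)
  moreover have "t \<in> A" "t \<notin> P" using b(2) denom(1) P(2) by auto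
  ultimately show "a \<in> P" using P(1) a(1) by (auto simp: is_prime_ideal_def)
next
  assume "a \<in> P"
  then show "frac a s \<in> loc_ideal (ring_on A) W P" using a(2) by (auto simp: loc_ideal_def)
qed

lemma primeideal_loc_ideal:
  assumes P: "is_prime_ideal A P" "P \<inter> W = {}"
  shows "primeideal (loc_ideal (ring_on A) W P) Local"
proof -
  interpret L: cring Local by (rule cring_localization)
  note mem = is_subringD(1,2,4,5,6)[OF A] subsetD[OF denom(1)] denom(2,4)
  note iff = frac_loc_ideal_iff[OF P]
  have P_ideal: "is_ideal A P" using P(1) by (simp add: is_prime_ideal_def)
  note PD = is_idealD[OF P_ideal]
  have elem: "\<exists>a s. a \<in> P \<and> s \<in> W \<and> x = frac a s" if "x \<in> loc_ideal (ring_on A) W P" for x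
    using that by (auto simp: loc_ideal_def)
  have sub: "loc_ideal (ring_on A) W P \<subseteq> carrier Local"
    using PD(1) by (auto simp: loc_ideal_def carrier_localization)
  have mult_closed: "x \<otimes>\<^bsub>Local\<^esub> y \<in> loc_ideal (ring_on A) W P"
    if x: "x \<in> loc_ideal (ring_on A) W P" and y: "y \<in> carrier Local" for x y
  proof -
    obtain a s where a: "a \<in> P" "s \<in> W" "x = frac a s" using elem[OF x] by blast
    obtain b t where b: "b \<in> A" "t \<in> W" "y = frac b t" using localizationE[OF y] by blast
    have "b * a \<in> P" using PD(4)[OF b(1) a(1)] .
    then show ?thesis using a b PD(1) mem by (simp add: frac_ops iff mult.commute subset_iff)
  qed
  show ?thesis
  proof (intro primeidealI idealI cring_localization)
    show "ring Local" by (rule cring.axioms(1)[OF cring_localization])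
    show "subgroup (loc_ideal (ring_on A) W P) (add_monoid Local)"
    proof (rule L.add.subgroupI)
      show "loc_ideal (ring_on A) W P \<subseteq> carrier Local" by (rule sub)
      have "frac 0 1 \<in> loc_ideal (ring_on A) W P" using iff PD(2) mem by simp
      then show "loc_ideal (ring_on A) W P \<noteq> {}" by blast
      show "\<ominus>\<^bsub>Local\<^esub> x \<in> loc_ideal (ring_on A) W P" if x: "x \<in> loc_ideal (ring_on A) W P" for x
      proof -
        have "\<ominus>\<^bsub>Local\<^esub> x = x \<otimes>\<^bsub>Local\<^esub> (\<ominus>\<^bsub>Local\<^esub> \<one>\<^bsub>Local\<^esub>)"
          using x sub L.r_minus[of x "\<one>\<^bsub>Local\<^esub>"] by auto
        then show ?thesis using mult_closed[OF x] by simp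
      qed
      show "x \<oplus>\<^bsub>Local\<^esub> y \<in> loc_ideal (ring_on A) W P"
        if xy: "x \<in> loc_ideal (ring_on A) W P" "y \<in> loc_ideal (ring_on A) W P" for x y
      proof -
        obtain a s where a: "a \<in> P" "s \<in> W" "x = frac a s" using elem[OF xy(1)] by blast
        obtain b t where b: "b \<in> P" "t \<in> W" "y = frac b t" using elem[OF xy(2)] by blast
        have "t * a + s * b \<in> P" using a b PD(3,4) mem by auto
        then show ?thesis using a b PD(1) mem by (simp add: frac_ops iff mult.commute subset_iff)
      qed
    qed
    show "x \<otimes>\<^bsub>Local\<^esub> a \<in> loc_ideal (ring_on A) W P" "a \<otimes>\<^bsub>Local\<^esub> x \<in> loc_ideal (ring_on A) W P"
      if "a \<in> loc_ideal (ring_on A) W P" "x \<in> carrier Local" for a x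
      using mult_closed[OF that] that sub L.m_comm[of a x] by auto
    have "frac 1 1 \<notin> loc_ideal (ring_on A) W P" using iff P(1) mem by (simp add: is_prime_ideal_def)
    then show "carrier Local \<noteq> loc_ideal (ring_on A) W P" using frac_carrier mem by blast
    show "x \<in> loc_ideal (ring_on A) W P \<or> y \<in> loc_ideal (ring_on A) W P"
      if xy: "x \<in> carrier Local" "y \<in> carrier Local" "x \<otimes>\<^bsub>Local\<^esub> y \<in> loc_ideal (ring_on A) W P" for x y
    proof -
      obtain a s where a: "a \<in> A" "s \<in> W" "x = frac a s" using localizationE[OF xy(1)] by blast
      obtain b t where b: "b \<in> A" "t \<in> W" "y = frac b t" using localizationE[OF xy(2)] by blast
      have "a * b \<in> P" using xy(3) a b mem by (simp add: frac_ops iff)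
      then have "a \<in> P \<or> b \<in> P" using P(1) a(1) b(1) by (auto simp: is_prime_ideal_def)
      then show ?thesis using a b iff by blast
    qed
  qed
qed

end

lemma self_module_facts:
  fixes R :: "'a ring" (structure)
  assumes R: "cring R"
  shows submodule_self_module: "ideal J R \<Longrightarrow> submodule J R (self_module R)"
    and group_self_module: "group (add_monoid (self_module R))"
proof -
  interpret cring R by (rule R)
  have sm: "carrier (self_module R) = carrier R" "\<zero>\<^bsub>self_module R\<^esub> = \<zero>"
    "a \<odot>\<^bsub>self_module R\<^esub> x = a \<otimes> x" "a \<oplus>\<^bsub>self_module R\<^esub> x = a \<oplus> x" for a x
    by (simp_all add: self_module_def)
  have "\<exists>y\<in>carrier R. y \<oplus> x = \<zero>" if "x \<in> carrier R" for x
    using that l_neg by blast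
  then show "group (add_monoid (self_module R))"
    by (intro groupI) (auto simp: sm a_assoc)
  have inv: "inv\<^bsub>add_monoid (self_module R)\<^esub> x = \<ominus> x" for x
    by (simp add: m_inv_def a_inv_def sm Units_def)
  assume "ideal J R"
  then interpret J: ideal J R .
  show "submodule J R (self_module R)"
  proof (intro submodule.intro submodule_axioms.intro subgroup.intro)
    show "inv\<^bsub>add_monoid (self_module R)\<^esub> x \<in> J" if "x \<in> J" for x
      unfolding inv using that by (rule additive_subgroup.a_inv_closed[OF J.is_additive_subgroup])
  qed (use J.a_subset J.I_l_closed additive_subgroup.zero_closed[OF J.is_additive_subgroup]
      additive_subgroup.a_closed[OF J.is_additive_subgroup] in \<open>auto simp: sm\<close>)
qed

text \<open>The submodule generated by the first element is its principal ideal, and a coset of it is zero when its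
  representative is a multiple of that element.\<close>

lemma regular_seq_two:
  fixes R :: "'a ring" (structure)
  assumes R: "cring R" and reg: "regular_seq R (self_module R) as" and len: "length as \<ge> 2"
  shows "x \<in> carrier R \<Longrightarrow> as ! 0 \<otimes> x = \<zero> \<Longrightarrow> x = \<zero>"
    and "x \<in> carrier R \<Longrightarrow> y \<in> carrier R \<Longrightarrow> as ! 1 \<otimes> x = as ! 0 \<otimes> y \<Longrightarrow> \<exists>z\<in>carrier R. x = as ! 0 \<otimes> z"
proof -
  interpret cring R by (rule R)
  have sm: "carrier (self_module R) = carrier R" "\<zero>\<^bsub>self_module R\<^esub> = \<zero>"
    "a \<odot>\<^bsub>self_module R\<^esub> x = a \<otimes> x" "a \<oplus>\<^bsub>self_module R\<^esub> x = a \<oplus> x" for a x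
    by (simp_all add: self_module_def)
  have as: "set as \<subseteq> carrier R" using reg by (simp add: regular_seq_def)
  have as0: "as ! 0 \<in> carrier R" and as1: "as ! 1 \<in> carrier R"
    using as len by (auto intro!: subsetD[OF as] nth_mem)
  have "as \<noteq> []" using len by auto
  then show "x = \<zero>" if "x \<in> carrier R" "as ! 0 \<otimes> x = \<zero>"
    using regular_seq_first[OF reg _ _ group_self_module[OF R]] submodule_self_module[OF R zeroideal] that as0
    by (simp add: sm)
  let ?N = "(\<lambda>x. as ! 0 \<otimes> x) ` carrier R"
  have N: "ideal ?N R"
  proof -
    have "?N = PIdl (as ! 0)" using as0 by (auto simp: cgenideal_def m_comm)
    then show ?thesis using cgenideal_ideal[OF as0] by simp
  qed
  have sub: "submodule ?N R (self_module R)" by (rule submodule_self_module[OF R N])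
  have "set (take 1 as) = {as ! 0}" using len by (cases as) auto
  then have "ideal_smult R (set (take 1 as)) (self_module R) = ?N"
    using gen_submodule_least[OF sub, of ?N] gen_submodule_superset[of ?N R "self_module R"]
    by (simp add: ideal_smult_def sm setcompr_eq_image)
  then have reg1: "\<forall>B \<in> carrier (quot_module (self_module R) ?N).
      (as ! 1) \<odot>\<^bsub>quot_module (self_module R) ?N\<^esub> B = \<zero>\<^bsub>quot_module (self_module R) ?N\<^esub>
      \<longrightarrow> B = \<zero>\<^bsub>quot_module (self_module R) ?N\<^esub>"
    using reg len unfolding regular_seq_def by (metis Suc_1 Suc_le_lessD)
  have coset: "?N +>\<^bsub>self_module R\<^esub> x = ?N +> x" for x
    by (simp add: a_r_coset_def r_coset_def self_module_def)
  assume x: "x \<in> carrier R" and y: "y \<in> carrier R" and eq: "as ! 1 \<otimes> x = as ! 0 \<otimes> y"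
  interpret N: ideal ?N R by (rule N)
  have mem: "as ! 1 \<otimes> x \<in> ?N" using y eq by blast
  have xx: "x \<in> ?N +> x" by (rule N.a_rcos_self[OF x])
  have "as ! 1 \<otimes> u \<in> ?N" if u: "u \<in> ?N +> x" for u
  proof -
    obtain v where v: "v \<in> ?N" "u = v \<oplus> x" using u by (auto simp: a_r_coset_def')
    have "v \<in> carrier R" using v(1) N.a_subset by blast
    then have "as ! 1 \<otimes> u = as ! 1 \<otimes> v \<oplus> as ! 1 \<otimes> x" using as1 x v(2) by (simp add: r_distr)
    then show ?thesis using N.I_l_closed[OF v(1) as1] mem by (simp add: N.a_closed)
  qed
  then have "?N +> (as ! 1 \<otimes> u) = ?N" if "u \<in> ?N +> x" for u
    using that N.a_rcos_const by blast
  then have "(\<Union>u\<in>?N +> x. ?N +> (as ! 1 \<otimes> u)) = ?N" using xx by blast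
  then have "(as ! 1) \<odot>\<^bsub>quot_module (self_module R) ?N\<^esub> (?N +> x) = \<zero>\<^bsub>quot_module (self_module R) ?N\<^esub>"
    by (simp add: quot_module_def coset sm)
  moreover have "?N +> x \<in> carrier (quot_module (self_module R) ?N)"
  proof -
    have "a_rcosets\<^bsub>self_module R\<^esub> ?N = a_rcosets ?N" by (simp add: A_RCOSETS_def RCOSETS_def r_coset_def self_module_def)
    then show ?thesis using a_rcosetsI[OF N.a_subset x] by (simp add: quot_module_def)
  qed
  ultimately have "?N +> x = ?N" using reg1 by (simp add: quot_module_def)
  then show "\<exists>z\<in>carrier R. x = as ! 0 \<otimes> z" using xx by auto
qed

text \<open>A chain of three primes makes the localization at \<open>Q\<close> at least two-dimensional, hence of depth
  at least two. For a regular sequence \<open>a, b\<close> in \<open>Q\<close> the equation \<open>b (a h) = a (b h)\<close> shows that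
  \<open>a h\<close> is a multiple of \<open>a\<close> in the localization, so that \<open>h\<close> lies in it.\<close>

theorem serre_S2_extension:
  fixes A :: "'a::idom set"
  assumes A: "is_subring A" and serre: "serre_S 2 (ring_on A)"
    and Q: "is_prime_ideal A Q" and P: "is_prime_ideal A P" "P \<noteq> {0}" "P \<subset> Q"
    and h: "\<And>a. a \<in> Q \<Longrightarrow> a * h \<in> A"
  obtains s where "s \<in> A" "s \<notin> Q" "s * h \<in> A"
proof -
  define W where "W = A - Q"
  have QA: "is_ideal A Q" and PA: "is_ideal A P" using Q P(1) by (auto simp: is_prime_ideal_def)
  have W: "W \<subseteq> A" "1 \<in> W" "0 \<notin> W" "\<forall>s\<in>W. \<forall>t\<in>W. s * t \<in> W"
    using Q is_subringD(1,5)[OF A] is_idealD(2)[OF QA] by (auto simp: W_def is_prime_ideal_def)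
  let ?L = "localization (ring_on A) W" and ?frac = "loc_frac (ring_on A) W"
  let ?loc = "loc_ideal (ring_on A) W"
  interpret L: cring ?L by (rule cring_localization[OF A W])
  note frac_eq_iff = frac_eq_iff[OF A W] and frac_ops = frac_ops[OF A W] and localization_zero_one = localization_zero_one[OF A W]
    and localizationE = localizationE[OF A W] and frac_carrier = frac_carrier[OF A W] and mem_iff = frac_loc_ideal_iff[OF A W]
  have zero: "is_prime_ideal A {0}"
    using is_subringD(2)[OF A] by (auto simp: is_prime_ideal_def is_ideal_def)
  have chain: "?loc P1 \<subset> ?loc P2" if P12: "is_prime_ideal A P1" "is_prime_ideal A P2" "P1 \<subset> P2" "P2 \<subseteq> Q" for P1 P2
  proof -
    have disj: "P1 \<inter> W = {}" "P2 \<inter> W = {}" using that by (auto simp: W_def)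
    obtain a where a: "a \<in> P2" "a \<notin> P1" using P12(3) by blast
    have "a \<in> A" using a(1) P12(2) is_idealD(1) unfolding is_prime_ideal_def by blast
    then have "?frac a 1 \<in> ?loc P2" "?frac a 1 \<notin> ?loc P1"
      using mem_iff[OF that(2) disj(2)] mem_iff[OF that(1) disj(1)] a W(2) by blast+
    moreover have "?loc P1 \<subseteq> ?loc P2" using that(3) by (auto simp: loc_ideal_def)
    ultimately show ?thesis by blast
  qed
  have P0: "{0} \<subset> P" using P(2) is_idealD(2)[OF PA] by blast
  have prime: "primeideal (?loc P') ?L" if "is_prime_ideal A P'" "P' \<subseteq> Q" for P'
    using that by (intro primeideal_loc_ideal[OF A W]) (auto simp: W_def)
  have dim: "krull_dim ?L \<ge> 2"
  proof -
    let ?Ps = "[?loc {0}, ?loc P, ?loc Q]"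
    have "\<forall>P\<in>set ?Ps. primeideal P ?L" using prime zero P Q is_idealD(2)[OF QA] by auto
    moreover have "sorted_wrt (\<subset>) ?Ps"
      using chain[OF zero P(1) P0] chain[OF P(1) Q P(3)] P(3) by auto
    ultimately have "enat (length ?Ps - 1) \<le> krull_dim ?L"
      unfolding krull_dim_def by (intro Sup_upper) blast
    then show ?thesis by (simp add: numeral_eq_enat numeral_2_eq_2)
  qed
  have "primeideal Q (ring_on A)" using primeideal_ring_on_iff[OF A] Q by blast
  then have "min (enat 2) (krull_dim ?L) \<le> depth ?L (?loc Q) (self_module ?L)"
    using serre unfolding serre_S_def W_def Let_def by simp
  then have depth: "enat 2 \<le> depth ?L (?loc Q) (self_module ?L)"
    using dim by (simp add: numeral_eq_enat min_def)
  have Qid: "ideal (?loc Q) ?L" using prime[OF Q] primeideal.axioms(1) by blast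
  have "ideal_smult ?L (?loc Q) (self_module ?L) \<noteq> carrier (self_module ?L)"
  proof
    assume eq: "ideal_smult ?L (?loc Q) (self_module ?L) = carrier (self_module ?L)"
    interpret Q: ideal "?loc Q" ?L by (rule Qid)
    have "submodule (?loc Q) ?L (self_module ?L)" by (rule submodule_self_module[OF L.is_cring Qid])
    then have "ideal_smult ?L (?loc Q) (self_module ?L) \<subseteq> ?loc Q"
      unfolding ideal_smult_def using Q.I_r_closed
      by (intro gen_submodule_least) (auto simp: self_module_def)
    then have "carrier ?L = ?loc Q" using eq Q.a_subset by (auto simp: self_module_def)
    then show False using primeideal.I_notcarr[OF prime[OF Q]] by blast
  qed
  then have "enat 1 < Sup {enat (length as) | as. set as \<subseteq> ?loc Q \<and> regular_seq ?L (self_module ?L) as}"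
    using depth unfolding depth_def by (auto simp: enat_ord_simps intro: less_le_trans[rotated])
  then obtain as where as: "set as \<subseteq> ?loc Q" "regular_seq ?L (self_module ?L) as" "length as \<ge> 2"
    unfolding less_Sup_iff by auto
  have "as ! 0 \<in> ?loc Q" "as ! 1 \<in> ?loc Q"
    using as(3) by (auto intro!: subsetD[OF as(1)] nth_mem)
  then obtain a s b t where a: "a \<in> Q" "s \<in> W" "as ! 0 = ?frac a s"
    and b: "b \<in> Q" "t \<in> W" "as ! 1 = ?frac b t" unfolding loc_ideal_def by blast
  have aA: "a \<in> A" "b \<in> A" "s \<in> A" using a b is_idealD(1)[OF QA] W(1) by auto
  have mem: "a * h \<in> A" "b * h \<in> A" using h a b by auto
  have sbh: "s * (b * h) \<in> A" by (rule is_subringD(5)[OF A aA(3) mem(2)])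
  have a0: "a \<noteq> 0"
  proof
    assume "a = 0"
    then have "as ! 0 \<otimes>\<^bsub>?L\<^esub> \<one>\<^bsub>?L\<^esub> = \<zero>\<^bsub>?L\<^esub>"
      using a W(2) is_subringD(1,2)[OF A] by (simp add: localization_zero_one frac_ops frac_eq_iff)
    then have "\<one>\<^bsub>?L\<^esub> = \<zero>\<^bsub>?L\<^esub>" using regular_seq_two(1)[OF L.is_cring as(2,3)] by simp
    then show False using W(2) is_subringD(1,2)[OF A] by (simp add: localization_zero_one frac_eq_iff)
  qed
  have "as ! 1 \<otimes>\<^bsub>?L\<^esub> ?frac (a * h) 1 = as ! 0 \<otimes>\<^bsub>?L\<^esub> ?frac (s * (b * h)) t"
    using a b aA mem sbh W by (simp add: frac_ops frac_eq_iff is_subringD(5)[OF A] mult_ac)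
  then obtain z where z: "z \<in> carrier ?L" "?frac (a * h) 1 = as ! 0 \<otimes>\<^bsub>?L\<^esub> z"
    using regular_seq_two(2)[OF L.is_cring as(2,3) frac_carrier[OF mem(1) W(2)] frac_carrier[OF sbh b(2)]] by blast
  obtain c r where c: "c \<in> A" "r \<in> W" "z = ?frac c r" using localizationE[OF z(1)] by blast
  have "(a * h) * (s * r) = a * c * 1"
    using z(2) a aA mem(1) c W by (simp add: frac_ops frac_eq_iff is_subringD(5)[OF A])
  then have "a * (s * r * h) = a * c" by (simp add: mult_ac)
  then have "s * r * h = c" using a0 by simp
  moreover have "s * r \<in> W" using W(4) a(2) c(2) by blast
  ultimately show thesis using that[of "s * r"] c(1) by (auto simp: W_def)
qed

section \<open>Generated ideals and subalgebras\<close>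

lemma genideal_UNIV:
  fixes S :: "'a::comm_ring_1 set"
  shows is_ideal_genideal: "is_ideal UNIV (Idl\<^bsub>ring_on UNIV\<^esub> S)"
    and subset_genideal: "S \<subseteq> Idl\<^bsub>ring_on UNIV\<^esub> S"
    and genideal_least: "is_ideal UNIV J \<Longrightarrow> S \<subseteq> J \<Longrightarrow> Idl\<^bsub>ring_on UNIV\<^esub> S \<subseteq> J"
proof -
  interpret cring "ring_on (UNIV :: 'a set)" by (rule cring_ring_on[OF is_subring_UNIV])
  show "is_ideal UNIV (Idl\<^bsub>ring_on UNIV\<^esub> S)"
    using genideal_ideal[of S] by (simp add: ideal_ring_on_iff[OF is_subring_UNIV])
  show "S \<subseteq> Idl\<^bsub>ring_on UNIV\<^esub> S" using genideal_self[of S] by simp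
  show "Idl\<^bsub>ring_on UNIV\<^esub> S \<subseteq> J" if "is_ideal UNIV J" "S \<subseteq> J"
    using genideal_minimal[of J S] that by (simp add: ideal_ring_on_iff[OF is_subring_UNIV])
qed

lemma subalgebra_t:
  fixes F :: "'a::comm_ring_1 poly set"
  shows is_subring_subalgebra_t: "is_subring (subalgebra_t F)"
    and const_subalgebra_t: "[:a:] \<in> subalgebra_t F"
    and gen_subalgebra_t: "p \<in> F \<Longrightarrow> p \<in> subalgebra_t F"
    and subalgebra_t_least: "is_subring C \<Longrightarrow> (\<And>a. [:a:] \<in> C) \<Longrightarrow> F \<subseteq> C \<Longrightarrow> subalgebra_t F \<subseteq> C"
proof -
  let ?R = "ring_on (UNIV :: 'a poly set)"
  interpret R: cring ?R by (rule cring_ring_on[OF is_subring_UNIV])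
  have neg: "\<ominus>\<^bsub>?R\<^esub> p = - p" for p by (intro R.minus_equality) auto
  have def: "subalgebra_t F = generate_ring ?R (range (\<lambda>a. [:a:]) \<union> F)"
    by (simp add: subalgebra_t_def ring_on_UNIV)
  show "is_subring (subalgebra_t F)"
    unfolding is_subring_def
  proof (intro conjI ballI)
    show "1 \<in> subalgebra_t F" using generate_ring.one[of ?R] by (simp add: def)
    fix p q assume pq: "p \<in> subalgebra_t F" "q \<in> subalgebra_t F"
    have "- q \<in> subalgebra_t F" using generate_ring.a_inv[of q ?R] pq(2) by (simp add: def neg)
    then show "p - q \<in> subalgebra_t F"
      using generate_ring.eng_add[of p ?R _ "- q"] pq(1) by (simp add: def)
    show "p * q \<in> subalgebra_t F" using generate_ring.eng_mult[of p ?R _ q] pq by (simp add: def)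
  qed
  show "[:a:] \<in> subalgebra_t F" unfolding def by (rule generate_ring.incl) simp
  show "p \<in> subalgebra_t F" if "p \<in> F" unfolding def using that by (intro generate_ring.incl) simp
  show "subalgebra_t F \<subseteq> C" if C: "is_subring C" "\<And>a. [:a:] \<in> C" "F \<subseteq> C"
  proof
    fix p assume "p \<in> subalgebra_t F"
    then show "p \<in> C" unfolding def
      by (induction rule: generate_ring.induct)
        (use C in \<open>auto simp: neg intro: is_subringD(1,4,5,6)[OF C(1)]\<close>)
  qed
qed

lemma noetherian_hom_image:
  assumes h: "is_hom h" and B: "is_subring B" "noetherian B"
  shows "noetherian (h ` B)"
  unfolding noetherian_def
proof (intro allI impI, elim conjE)
  fix J :: "nat \<Rightarrow> _" assume J: "\<forall>i. is_ideal (h ` B) (J i)" and inc: "\<forall>i. J i \<subseteq> J (Suc i)"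
  define T where "T i = {b \<in> B. h b \<in> J i}" for i
  have "is_ideal B (T i)" for i
    unfolding is_ideal_def T_def
    using is_idealD(2-4)[OF J[rule_format, of i]] is_subringD(2,4,5)[OF B(1)]
    by (auto simp: is_homD(2-4)[OF h])
  moreover have "T i \<subseteq> T (Suc i)" for i using inc by (auto simp: T_def)
  ultimately obtain N where N: "\<And>i. i \<ge> N \<Longrightarrow> T i = T N"
    using B(2)[unfolded noetherian_def, rule_format, of T] by auto
  have JT: "J i = h ` T i" for i
    using is_idealD(1)[OF J[rule_format, of i]] by (auto simp: T_def)
  have "J i = J N" if "i \<ge> N" for i unfolding JT using N[OF that] by simp
  then show "\<exists>N. \<forall>i\<ge>N. J i = J N" by blast
qed

lemma prime_ideal_powerD:
  assumes B: "is_subring B" and P: "is_prime_ideal B P" and a: "a \<in> B" "a ^ n \<in> P"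
  shows "a \<in> P"
  using a(2)
proof (induction n)
  case 0
  then show ?case using P by (simp add: is_prime_ideal_def)
next
  case (Suc n)
  have "a ^ n \<in> B" by (rule is_subringD(7)[OF B a(1)])
  then show ?case using Suc P a(1) by (auto simp: is_prime_ideal_def)
qed

section \<open>A Cremona map and its inverse\<close>

text \<open>The situation after elementary reductions: \<open>E\<close> is the inversion factor on the target side, and the
  degree \<open>dD\<close> of \<open>D\<close> satisfies \<open>d d' = 1 + dD\<close> because \<open>g\<^sub>i(f) = x\<^sub>i D\<close>. The degree of \<open>E\<close> is \<open>dD\<close> as well.\<close>

locale cremona =
  fixes f g :: "'n::{finite, linorder} \<Rightarrow> ('n, 'k::field) mpoly"
    and D E :: "('n, 'k) mpoly" and d d' dD :: nat
  assumes f_form: "form d (f i)" and g_form: "form d' (g i)" and D_form: "form dD D"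
    and gf: "msubst mconst f (g i) = mvar i * D" and fg: "msubst mconst g (f i) = mvar i * E"
    and D0: "D \<noteq> 0" and E0: "E \<noteq> 0" and dd': "d * d' = 1 + dD"
    and gcd_g: "no_common_factor g"
begin

abbreviation I :: "('n, 'k) mpoly set" where "I \<equiv> base_ideal f"
abbreviation rees :: "('n, 'k) mpoly poly set" where "rees \<equiv> rees_algebra I"
abbreviation at_f :: "('n, 'k) mpoly \<Rightarrow> ('n, 'k) mpoly" where "at_f \<equiv> msubst mconst f"
abbreviation at_g :: "('n, 'k) mpoly \<Rightarrow> ('n, 'k) mpoly" where "at_g \<equiv> msubst mconst g"
abbreviation powI :: "nat \<Rightarrow> ('n, 'k) mpoly set" where "powI \<equiv> ideal_power (ring_on UNIV) I"

definition at_ft :: "('n, 'k) mpoly \<Rightarrow> ('n, 'k) mpoly poly" where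
  "at_ft = msubst (\<lambda>c. [:mconst c:]) (\<lambda>i. Polynomial.monom (f i) 1)"

lemma hom_at: "is_hom at_f" "is_hom at_g" "is_hom at_ft"
  unfolding at_ft_def by (intro is_hom_msubst is_hom_mconst is_hom_const_poly)+

lemma base_ideal:
  shows is_ideal_I: "is_ideal UNIV I" and f_mem: "f i \<in> I"
    and I_least: "is_ideal UNIV J \<Longrightarrow> (\<And>i. f i \<in> J) \<Longrightarrow> I \<subseteq> J"
  unfolding base_ideal_def ring_on_UNIV[symmetric]
proof -
  show "is_ideal UNIV (Idl\<^bsub>ring_on UNIV\<^esub> (range f))" by (rule is_ideal_genideal)
  show "f i \<in> Idl\<^bsub>ring_on UNIV\<^esub> (range f)" by (rule subsetD[OF subset_genideal rangeI])
  show "Idl\<^bsub>ring_on UNIV\<^esub> (range f) \<subseteq> J" if "is_ideal UNIV J" "\<And>i. f i \<in> J"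
    using that by (intro genideal_least) auto
qed

lemma mvar_nonzero: "(mvar i :: ('n, 'k) mpoly) \<noteq> 0"
  unfolding mvar_def by (metis lookup_single_eq lookup_zero zero_neq_one)

lemma f_nonzero: "f i \<noteq> 0"
  using fg[of i] E0 mvar_nonzero by (auto simp: is_homD(4)[OF hom_at(2)])

lemma at_f_form: "form l q \<Longrightarrow> form (d * l) (at_f q)"
  by (rule form_msubst[OF _ f_form])

lemma at_g_form: "form l q \<Longrightarrow> form (d' * l) (at_g q)"
  by (rule form_msubst[OF _ g_form])

lemma at_f_at_g: "form e H \<Longrightarrow> at_f (at_g H) = H * D ^ e"
  using msubst_form_scale[of e H mconst mvar D]
  by (simp add: msubst_msubst[OF is_hom_mconst] gf msubst_mvar_id)

lemma at_g_at_f: "form l q \<Longrightarrow> at_g (at_f q) = q * E ^ l"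
  using msubst_form_scale[of l q mconst mvar E]
  by (simp add: msubst_msubst[OF is_hom_mconst] fg msubst_mvar_id)

lemma at_f_inj: "form l q \<Longrightarrow> at_f q = 0 \<Longrightarrow> q = 0"
  using at_g_at_f[of l q] E0 by (simp add: is_homD(4)[OF hom_at(2)])

lemma E_form: "form dD E"
proof -
  have "form (d' * d) (mvar undefined * E)"
    unfolding fg[symmetric] by (rule at_g_form[OF f_form])
  from form_quotient[OF form_mvar mvar_nonzero this E0] show ?thesis
    using dd' by (simp add: mult.commute)
qed

lemma at_f_E: "at_f E = D ^ d"
proof -
  have "at_f (mvar undefined * E) = f undefined * D ^ d"
    using at_f_at_g[OF f_form] by (simp add: fg)
  then have "f undefined * at_f E = f undefined * D ^ d"
    by (simp add: is_homD(3)[OF hom_at(1)] msubst_mvar[OF is_hom_mconst])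
  then show ?thesis using f_nonzero by simp
qed

lemma at_ft_form: "form l q \<Longrightarrow> at_ft q = Polynomial.monom (at_f q) l"
proof -
  assume q: "form l q"
  have "at_ft q = msubst (\<lambda>c. [:mconst c:]) (\<lambda>i. [:f i:] * Polynomial.monom 1 1) q"
    by (simp add: at_ft_def smult_monom)
  also have "\<dots> = msubst (\<lambda>c. [:mconst c:]) (\<lambda>i. [:f i:]) q * Polynomial.monom 1 1 ^ l"
    by (rule msubst_form_scale[OF q])
  also have "msubst (\<lambda>c. [:mconst c:]) (\<lambda>i. [:f i:]) q = [:at_f q:]"
    by (rule hom_msubst[OF is_hom_pconst, symmetric])
  finally show ?thesis by (simp add: monom_power smult_monom)
qed

lemma coeff_at_ft: "coeff (at_ft q) l = at_f (hcomp l q)"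
proof -
  have "at_ft q = (\<Sum>e\<le>degree (homog q). Polynomial.monom (at_f (hcomp e q)) e)"
    by (subst sum_hcomp[symmetric]) (simp add: is_homD(8)[OF hom_at(3)] at_ft_form[OF form_hcomp])
  then have "coeff (at_ft q) l = (\<Sum>e\<le>degree (homog q). if e = l then at_f (hcomp l q) else 0)"
    by (auto simp: coeff_sum intro!: sum.cong)
  also have "\<dots> = at_f (hcomp l q)"
    by (auto simp: hcomp_def coeff_eq_0 is_homD(4)[OF hom_at(1)])
  finally show ?thesis .
qed

subsection \<open>The Rees algebra and its grading\<close>

lemma rees_facts:
  shows is_subring_rees: "is_subring rees" and const_rees: "[:a:] \<in> rees"
    and I_rees: "a \<in> I \<Longrightarrow> Polynomial.monom a 1 \<in> rees"
  unfolding rees_algebra_def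
  by (simp_all add: is_subring_subalgebra_t const_subalgebra_t gen_subalgebra_t)

lemma monom_ideal:
  assumes C: "is_subring C" "\<And>a. [:a:] \<in> C"
  shows "is_ideal UNIV {a. Polynomial.monom a l \<in> C}"
  unfolding is_ideal_def
proof (intro conjI ballI)
  fix a b assume ab: "a \<in> {a. Polynomial.monom a l \<in> C}"
  show "r * a \<in> {a. Polynomial.monom a l \<in> C}" for r
    using is_subringD(5)[OF C(1) C(2)[of r], of "Polynomial.monom a l"] ab by (simp add: smult_monom)
  show "a + b \<in> {a. Polynomial.monom a l \<in> C}" if "b \<in> {a. Polynomial.monom a l \<in> C}"
    using is_subringD(4)[OF C(1), of "Polynomial.monom a l" "Polynomial.monom b l"] ab that
    by (simp add: add_monom)
qed (simp_all add: is_subringD(2)[OF C(1)])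

lemma rees_least:
  assumes C: "is_subring C" "\<And>a. [:a:] \<in> C" "\<And>i. Polynomial.monom (f i) 1 \<in> C"
  shows "rees \<subseteq> C"
  unfolding rees_algebra_def
proof (rule subalgebra_t_least[OF C(1,2)])
  have "I \<subseteq> {a. Polynomial.monom a 1 \<in> C}"
    by (rule I_least[OF monom_ideal[OF C(1,2)]]) (use C(3) in simp)
  then show "(\<lambda>a. Polynomial.monom a 1) ` I \<subseteq> C" by blast
qed

lemma powI_monom_mem:
  assumes C: "is_subring C" "\<And>a. [:a:] \<in> C" "\<And>a. a \<in> I \<Longrightarrow> Polynomial.monom a 1 \<in> C"
    and a: "a \<in> powI l"
  shows "Polynomial.monom a l \<in> C"
proof (rule ideal_power_induct[OF is_ideal_I _ _ _ a, of "\<lambda>l a. Polynomial.monom a l \<in> C"])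
  show "Polynomial.monom a 0 \<in> C" for a using C(2) by (simp add: monom_0)
  show "Polynomial.monom (a + b) l \<in> C" if "Polynomial.monom a l \<in> C" "Polynomial.monom b l \<in> C" for l a b
    using is_subringD(4)[OF C(1) that] by (simp add: add_monom)
  show "Polynomial.monom (a * b) (Suc l) \<in> C" if "Polynomial.monom a l \<in> C" "b \<in> I" for l a b
    using is_subringD(5)[OF C(1) that(1) C(3)[OF that(2)]] by (simp add: mult_monom)
qed

lemma powI_rees: "a \<in> powI l \<Longrightarrow> Polynomial.monom a l \<in> rees"
  by (rule powI_monom_mem[OF is_subring_rees const_rees I_rees])

lemma rees_coeff: "p \<in> rees \<Longrightarrow> coeff p l \<in> powI l"
proof -
  note ideal = is_ideal_ideal_power[OF is_ideal_I]
  have sum: "sum h Y \<in> powI l" if "\<And>y. y \<in> Y \<Longrightarrow> h y \<in> powI l" for h :: "nat \<Rightarrow> _" and Y l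
    using that by (induction Y rule: infinite_finite_induct) (auto intro: is_idealD(2,3)[OF ideal])
  let ?C = "{p. \<forall>l. coeff p l \<in> powI l}"
  have "rees \<subseteq> ?C"
  proof (rule rees_least)
    have pow0: "a \<in> powI 0" for a by (simp add: ideal_power_0)
    show const: "[:a:] \<in> ?C" for a
      using pow0 is_idealD(2)[OF ideal] by (auto simp: coeff_pCons split: nat.split)
    show "is_subring ?C"
      unfolding is_subring_def
    proof (intro conjI ballI)
      show "1 \<in> ?C" using const[of 1] by (simp add: one_pCons)
      fix p q assume pq: "p \<in> ?C" "q \<in> ?C"
      then show "p - q \<in> ?C" by (auto intro: is_ideal_diff[OF is_subring_UNIV ideal])
      have "coeff p i * coeff q (l - i) \<in> powI l" if "i \<le> l" for i l
        using ideal_power_mult[OF is_ideal_I, of "coeff p i" i "coeff q (l - i)" "l - i"] pq that by simp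
      then show "p * q \<in> ?C" by (auto simp: coeff_mult intro!: sum)
    qed
    show "Polynomial.monom (f i) 1 \<in> ?C" for i
      using ideal_power_one[OF is_ideal_I f_mem] is_idealD(2)[OF ideal] by auto
  qed
  then show "p \<in> rees \<Longrightarrow> coeff p l \<in> powI l" by blast
qed

lemma at_ft_rees: "at_ft q \<in> rees"
proof -
  have "is_subring {q. at_ft q \<in> rees}"
    by (auto simp: is_subring_def is_homD[OF hom_at(3)] intro: is_subringD(1,3,5)[OF is_subring_rees])
  then have "{q. at_ft q \<in> rees} = UNIV"
    using I_rees[OF f_mem]
    by (intro mpoly_generated)
      (simp_all add: at_ft_def msubst_mconst[OF is_hom_const_poly] msubst_mvar[OF is_hom_const_poly]
        const_rees)
  then show ?thesis by blast
qed

lemma at_f_powI: "form l q \<Longrightarrow> at_f q \<in> powI l"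
  using rees_coeff[OF at_ft_rees, of q l] by (simp add: at_ft_form)

lemma noetherian_rees: "noetherian rees"
proof -
  let ?B = "range (\<lambda>a :: ('n, 'k) mpoly. [:a:])"
  have "is_subring ?B"
    unfolding is_subring_def by (auto simp: one_pCons image_iff)
  moreover have "noetherian ?B" by (rule noetherian_hom_image[OF is_hom_pconst is_subring_UNIV noetherian_mpoly])
  ultimately obtain C where C: "is_subring C" "noetherian C" "?B \<union> range (\<lambda>i. Polynomial.monom (f i) 1) \<subseteq> C"
    "\<And>C'. is_subring C' \<Longrightarrow> ?B \<union> range (\<lambda>i. Polynomial.monom (f i) 1) \<subseteq> C' \<Longrightarrow> C \<subseteq> C'"
    using noetherian_finitely_generated[of ?B "range (\<lambda>i. Polynomial.monom (f i) 1)"] by auto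
  have "C \<subseteq> rees" using const_rees I_rees[OF f_mem] by (intro C(4) is_subring_rees) auto
  moreover have "rees \<subseteq> C" using C(3) by (intro rees_least C(1)) auto
  ultimately show ?thesis using C(2) by auto
qed

text \<open>Give \<open>H t\<^sup>l\<close> with \<open>H\<close> homogeneous the weight \<open>deg H - d l\<close>. The generators \<open>x\<^sub>i\<close> and \<open>f\<^sub>i t\<close> of
  the Rees algebra have weights one and zero.\<close>

lemma rees_weight_nonneg: "p \<in> rees \<Longrightarrow> e < d * l \<Longrightarrow> hcomp e (coeff p l) = 0"
proof -
  let ?C = "{p :: ('n, 'k) mpoly poly. \<forall>l e. e < d * l \<longrightarrow> hcomp e (coeff p l) = 0}"
  have "rees \<subseteq> ?C"
  proof (rule rees_least)
    show const: "[:a:] \<in> ?C" for a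
      by (auto simp: coeff_pCons hcomp_zero split: nat.split)
    show "is_subring ?C"
      unfolding is_subring_def
    proof (intro conjI ballI)
      show "1 \<in> ?C" using const[of 1] by (simp add: one_pCons)
      fix p q assume pq: "p \<in> ?C" "q \<in> ?C"
      then show "p - q \<in> ?C" by (simp add: hcomp_diff)
      have "hcomp j (coeff p i) * hcomp (e - j) (coeff q (l - i)) = 0" if "e < d * l" "i \<le> l" "j \<le> e" for i j e l
      proof (cases "j < d * i")
        case True
        then show ?thesis using pq by simp
      next
        case False
        then have "e - j < d * (l - i)" using that by (simp add: diff_mult_distrib2)
        then show ?thesis using pq by simp
      qed
      then show "p * q \<in> ?C" by (auto simp: coeff_mult hcomp_sum hcomp_mult intro!: sum.neutral)
    qed
    show "Polynomial.monom (f i) 1 \<in> ?C" for i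
      using hcomp_form[OF f_form[of i]] by (auto simp: hcomp_zero)
  qed
  then show "p \<in> rees \<Longrightarrow> e < d * l \<Longrightarrow> hcomp e (coeff p l) = 0" by blast
qed

text \<open>On the Rees algebra, where no weights are negative, taking the part of weight zero is
  multiplicative. Its kernel is therefore a prime ideal.\<close>

definition weight0 :: "('n, 'k) mpoly poly \<Rightarrow> ('n, 'k) mpoly poly" where
  "weight0 p = (\<Sum>l\<le>degree p. Polynomial.monom (hcomp (d * l) (coeff p l)) l)"

lemma coeff_weight0: "coeff (weight0 p) l = hcomp (d * l) (coeff p l)"
proof -
  have "coeff (weight0 p) l = (\<Sum>i\<le>degree p. if i = l then hcomp (d * l) (coeff p l) else 0)"
    by (auto simp: weight0_def coeff_sum intro!: sum.cong)
  also have "\<dots> = hcomp (d * l) (coeff p l)"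
    by (auto simp: coeff_eq_0 hcomp_zero)
  finally show ?thesis .
qed

lemma weight0_add: "weight0 (p + q) = weight0 p + weight0 q"
  by (rule poly_eqI) (simp add: coeff_weight0 hcomp_add)

lemma weight0_mult:
  assumes p: "p \<in> rees" and q: "q \<in> rees"
  shows "weight0 (p * q) = weight0 p * weight0 q"
proof (rule poly_eqI)
  fix l
  have inner: "hcomp (d * l) (coeff p i * coeff q (l - i)) =
      hcomp (d * i) (coeff p i) * hcomp (d * (l - i)) (coeff q (l - i))" if i: "i \<le> l" for i
  proof -
    have "hcomp j (coeff p i) * hcomp (d * l - j) (coeff q (l - i)) =
        (if j = d * i then hcomp (d * i) (coeff p i) * hcomp (d * (l - i)) (coeff q (l - i)) else 0)"
      if "j \<le> d * l" for j
    proof (cases j "d * i" rule: linorder_cases)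
      case less
      then show ?thesis using rees_weight_nonneg[OF p] by simp
    next
      case equal
      then show ?thesis by (simp add: diff_mult_distrib2)
    next
      case greater
      then have "d * l - j < d * (l - i)" using that by (simp add: diff_mult_distrib2)
      then show ?thesis using rees_weight_nonneg[OF q] greater by simp
    qed
    moreover have "d * i \<le> d * l" using i by simp
    ultimately show ?thesis by (simp add: hcomp_mult)
  qed
  show "coeff (weight0 (p * q)) l = coeff (weight0 p * weight0 q) l"
    by (simp add: coeff_weight0 coeff_mult hcomp_sum inner)
qed

definition positive_ideal :: "('n, 'k) mpoly poly set" where
  "positive_ideal = {p \<in> rees. weight0 p = 0}"

lemma is_prime_positive_ideal: "is_prime_ideal rees positive_ideal"
  unfolding is_prime_ideal_def is_ideal_def
proof (intro conjI ballI impI)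
  note R = is_subringD[OF is_subring_rees]
  show "positive_ideal \<subseteq> rees" by (auto simp: positive_ideal_def)
  show "0 \<in> positive_ideal" using R(2) by (simp add: positive_ideal_def weight0_def hcomp_zero)
  show "a + b \<in> positive_ideal" if "a \<in> positive_ideal" "b \<in> positive_ideal" for a b
    using that R(4) by (auto simp: positive_ideal_def weight0_add)
  show "r * a \<in> positive_ideal" if "r \<in> rees" "a \<in> positive_ideal" for r a
    using that R(5) by (auto simp: positive_ideal_def weight0_mult)
  have "coeff (weight0 1) 0 = 1"
    by (simp add: coeff_weight0 hcomp_def is_homD(1)[OF is_hom_homog])
  then show "1 \<notin> positive_ideal" by (auto simp: positive_ideal_def)
  show "a \<in> positive_ideal \<or> b \<in> positive_ideal" if "a \<in> rees" "b \<in> rees" "a * b \<in> positive_ideal" for a b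
    using that by (auto simp: positive_ideal_def weight0_mult)
qed

lemma mvar_positive_ideal: "[:mvar i:] \<in> positive_ideal"
  by (auto simp: positive_ideal_def const_rees coeff_weight0 coeff_pCons hcomp_form[OF form_mvar]
      hcomp_zero intro!: poly_eqI split: nat.split)

lemma weight0_at_ft: "weight0 (at_ft q) = at_ft q"
  by (rule poly_eqI) (simp add: coeff_weight0 coeff_at_ft hcomp_form[OF at_f_form[OF form_hcomp]])

lemma at_ft_inj: "at_ft q = 0 \<Longrightarrow> q = 0"
proof -
  assume "at_ft q = 0"
  then have "at_f (hcomp l q) = 0" for l using coeff_at_ft[of q l] by simp
  then have "hcomp l q = 0" for l using at_f_inj[OF form_hcomp] by blast
  then show "q = 0" using sum_hcomp[of q] by simp
qed

text \<open>Modulo the \<open>x\<^sub>i\<close> every element of the Rees algebra is a polynomial in the \<open>f\<^sub>i t\<close>.\<close>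

lemma rees_mod_mvar:
  assumes J: "is_ideal rees J" "\<And>i. [:mvar i:] \<in> J" and p: "p \<in> rees"
  shows "\<exists>q. p - at_ft q \<in> J"
proof -
  note R = is_subringD[OF is_subring_rees] and JD = is_idealD[OF J(1)]
  note diff = is_ideal_diff[OF is_subring_rees J(1)] and hom = is_homD[OF hom_at(3)]
  let ?C = "{p \<in> rees. \<exists>q. p - at_ft q \<in> J}"
  have C: "is_subring ?C"
    unfolding is_subring_def
  proof (intro conjI ballI)
    show "1 \<in> ?C" using R(1) JD(2) by (auto simp: hom intro!: exI[of _ 1])
    fix a b assume "a \<in> ?C" "b \<in> ?C"
    then obtain q r where a: "a \<in> rees" "a - at_ft q \<in> J" and b: "b \<in> rees" "b - at_ft r \<in> J" by blast
    have "(a - b) - at_ft (q - r) \<in> J" using diff[OF a(2) b(2)] by (simp add: hom algebra_simps)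
    then show "a - b \<in> ?C" using R(3)[OF a(1) b(1)] by blast
    have "b * (a - at_ft q) + at_ft q * (b - at_ft r) \<in> J"
      by (intro JD(3,4) at_ft_rees a b)
    then have "a * b - at_ft (q * r) \<in> J" by (simp add: hom algebra_simps)
    then show "a * b \<in> ?C" using R(5)[OF a(1) b(1)] by blast
  qed
  have "is_subring {r. [:r:] \<in> ?C}"
    unfolding is_subring_def
  proof (intro conjI ballI)
    show "1 \<in> {r. [:r:] \<in> ?C}" using is_subringD(1)[OF C] by (simp only: mem_Collect_eq one_pCons)
    fix a b assume "a \<in> {r. [:r:] \<in> ?C}" "b \<in> {r. [:r:] \<in> ?C}"
    then have ab: "[:a:] \<in> ?C" "[:b:] \<in> ?C" by (simp_all only: mem_Collect_eq)
    have eq: "[:a - b:] = [:a:] - [:b:]" "[:a * b:] = [:a:] * [:b:]" by simp_all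
    show "a - b \<in> {r. [:r:] \<in> ?C}" "a * b \<in> {r. [:r:] \<in> ?C}"
      using is_subringD(3,5)[OF C ab] unfolding eq[symmetric] by (simp_all only: mem_Collect_eq)
  qed
  then have "{r. [:r:] \<in> ?C} = UNIV"
  proof (rule mpoly_generated)
    show "mconst a \<in> {r. [:r:] \<in> ?C}" for a
      using JD(2) by (auto simp: const_rees at_ft_def msubst_mconst[OF is_hom_const_poly] intro!: exI[of _ "mconst a"])
    show "mvar i \<in> {r. [:r:] \<in> ?C}" for i
      using J(2) by (auto simp: const_rees hom intro!: exI[of _ 0])
  qed
  then have "r \<in> {r. [:r:] \<in> ?C}" for r by (simp only: UNIV_I)
  then have const: "[:r:] \<in> ?C" for r by (rule CollectD)
  have "rees \<subseteq> ?C"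
  proof (rule rees_least[OF C const])
    show "Polynomial.monom (f i) 1 \<in> ?C" for i
      using I_rees[OF f_mem] JD(2)
      by (auto simp: at_ft_def msubst_mvar[OF is_hom_const_poly] intro!: exI[of _ "mvar i"])
  qed
  then show ?thesis using p by blast
qed

end

lemma hcomp_form_mult:
  fixes u H :: "('v::finite, 'a::comm_ring_1) mpoly"
  shows "form s u \<Longrightarrow> hcomp (s + e) (u * H) = u * hcomp e H"
  by (simp add: hcomp_def is_homD(3)[OF is_hom_homog] homog_form coeff_monom_mult)

lemma is_ideal_Int: "is_ideal B J \<Longrightarrow> is_ideal B J' \<Longrightarrow> is_ideal B (J \<inter> J')"
  by (auto simp: is_ideal_def)

context cremona
begin

subsection \<open>Extending elements over the ideal of the \<open>x\<^sub>i\<close>\<close>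

text \<open>If \<open>h\<close> is multiplied into the Rees algebra by powers of the \<open>x\<^sub>i\<close> and by a nonzero element of weight
  zero, then the associated primes of the Rees algebra plus \<open>h\<close> modulo the Rees algebra properly contain
  the prime ideal of elements of positive weight. Condition \<open>(S\<^sub>2)\<close> leaves room for no such prime.\<close>

lemma rees_S2:
  assumes serre: "serre_S 2 (ring_on rees)" and q: "q \<noteq> 0" "at_ft q * h \<in> rees"
    and x: "\<And>i. [:mvar i:] ^ s * h \<in> rees"
  shows "h \<in> rees"
proof (rule ccontr)
  assume "h \<notin> rees"
  note R = is_subringD[OF is_subring_rees]
  obtain b where b: "b \<in> rees" and prime: "is_prime_ideal rees {r \<in> rees. r * (b * h) \<in> rees}"
  proof (rule associated_prime_avoiding[OF is_subring_rees noetherian_rees])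
    show "1 ^ k * h \<notin> rees" for k using \<open>h \<notin> rees\<close> by simp
  qed (use R in auto)
  define Q where "Q = {r \<in> rees. r * (b * h) \<in> rees}"
  have Q: "is_prime_ideal rees Q" using prime by (simp add: Q_def)
  have memQ: "r \<in> Q" if "r \<in> rees" "r * h \<in> rees" for r
    using R(5)[OF b that(2)] that(1) by (simp add: Q_def mult.left_commute)
  have xQ: "[:mvar i:] \<in> Q" for i
    by (rule prime_ideal_powerD[OF is_subring_rees Q const_rees memQ[OF R(7)[OF const_rees] x]])
  have qQ: "at_ft q \<in> Q" by (rule memQ[OF at_ft_rees q(2)])
  have ideals: "is_ideal rees Q" "is_ideal rees positive_ideal"
    using Q is_prime_positive_ideal by (simp_all add: is_prime_ideal_def)
  have PQ: "is_ideal rees (positive_ideal \<inter> Q)"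
    by (rule is_ideal_Int[OF ideals(2,1)])
  have decomp: "\<exists>q. p - at_ft q \<in> positive_ideal \<inter> Q" if "p \<in> rees" for p
    by (rule rees_mod_mvar[OF PQ _ that])
      (simp add: xQ mvar_positive_ideal)
  have "positive_ideal \<subseteq> Q"
  proof
    fix p assume p: "p \<in> positive_ideal"
    then obtain q' where q': "p - at_ft q' \<in> positive_ideal \<inter> Q"
      using decomp is_idealD(1)[OF ideals(2)] by blast
    then have "p - (p - at_ft q') \<in> positive_ideal"
      using is_ideal_diff[OF is_subring_rees ideals(2) p] by blast
    then have "weight0 (at_ft q') = 0" by (simp add: positive_ideal_def)
    then have "at_ft q' = 0" by (simp only: weight0_at_ft)
    then show "p \<in> Q" using q' by simp
  qed
  moreover have "at_ft q \<notin> positive_ideal"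
    using q(1) at_ft_inj[of q] weight0_at_ft[of q] by (auto simp: positive_ideal_def)
  ultimately have sub: "positive_ideal \<subset> Q" using qQ by blast
  have "[:mvar undefined:] \<noteq> (0 :: ('n, 'k) mpoly poly)" using mvar_nonzero by simp
  then have nz: "positive_ideal \<noteq> {0}" using mvar_positive_ideal by blast
  obtain s where "s \<in> rees" "s \<notin> Q" "s * (b * h) \<in> rees"
  proof (rule serre_S2_extension[OF is_subring_rees serre Q is_prime_positive_ideal nz sub])
    show "a * (b * h) \<in> rees" if "a \<in> Q" for a using that by (simp add: Q_def)
  qed
  then show False by (simp add: Q_def)
qed

subsection \<open>The saturation of the powers of the base ideal\<close>

lemma powI_at_g: "a \<in> powI l \<Longrightarrow> E ^ l dvd at_g a"
proof (rule ideal_power_induct[OF is_ideal_I, of "\<lambda>l a. E ^ l dvd at_g a"])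
  note hom = is_homD[OF hom_at(2)]
  show "E ^ 0 dvd at_g a" for a by simp
  show "E ^ l dvd at_g (a + b)" if "E ^ l dvd at_g a" "E ^ l dvd at_g b" for l a b
    using that by (simp add: hom(2))
  have "I \<subseteq> {a. E dvd at_g a}"
    by (rule I_least) (auto simp: is_ideal_def hom fg)
  then show "E ^ Suc l dvd at_g (a * b)" if "E ^ l dvd at_g a" "b \<in> I" for l a b
    using that mult_dvd_mono[of "E ^ l" "at_g a" E "at_g b"] by (auto simp: hom(3) mult.commute)
qed

text \<open>Substituting \<open>g\<close> into \<open>x\<^sub>i\<^sup>s H \<in> I\<^sup>l\<close> shows that \<open>E\<^sup>l\<close> divides all \<open>g\<^sub>i\<^sup>s H(g)\<close>. As the \<open>g\<^sub>i\<close> have no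
  common factor, \<open>H(g) = E\<^sup>l p\<close>. Substituting \<open>f\<close> gives back \<open>H\<close> up to powers of \<open>D\<close>.\<close>

lemma saturated_form:
  assumes H: "form e H" "H \<noteq> 0" and x: "\<And>i. mvar i ^ s * H \<in> powI l"
  obtains p k where "form k p" "p \<noteq> 0" "k + d * d' * l = d' * e + l" "D ^ (d * l) * at_f p = D ^ e * H"
proof -
  note hom = is_homD[OF hom_at(2)]
  have "E ^ l dvd g i ^ s * at_g H" for i
    using powI_at_g[OF x[of i]] by (simp add: hom(3,7) msubst_mvar[OF is_hom_mconst])
  moreover have "E ^ l \<noteq> 0" using E0 by simp
  ultimately have "E ^ l dvd at_g H" using factorial_dvd_cancel_coprime[OF factorial_mpoly _ gcd_g] by metis
  then obtain p where p: "at_g H = E ^ l * p" by (elim dvdE)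
  have fgH: "at_f (at_g H) = H * D ^ e" by (rule at_f_at_g[OF H(1)])
  then have "at_g H \<noteq> 0" using H(2) D0 by (auto simp: is_homD(4)[OF hom_at(1)])
  then have p0: "p \<noteq> 0" using p by auto
  have "form (dD * l) (E ^ l)" by (rule form_power[OF E_form])
  moreover have "form (d' * e) (E ^ l * p)" unfolding p[symmetric] by (rule at_g_form[OF H(1)])
  ultimately have le: "dD * l \<le> d' * e" and form: "form (d' * e - dD * l) p"
    using form_quotient[of "dD * l" "E ^ l" "d' * e" p] E0 p0 by auto
  \<comment> \<open>The degree of \<open>p\<close>, with \<open>dD\<close> replaced by \<open>d d' - 1\<close> and written without subtraction.\<close>
  have "d' * e - dD * l + d * d' * l = d' * e + l" unfolding dd' using le by (simp add: distrib_right)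
  moreover have "D ^ (d * l) * at_f p = D ^ e * H"
    using fgH unfolding p
    by (simp add: is_homD(3,7)[OF hom_at(1)] at_f_E power_mult mult.commute)
  ultimately show thesis using that form p0 by blast
qed

definition symbolic_algebra :: "('n, 'k) mpoly poly set" where
  "symbolic_algebra = subalgebra_t ((\<lambda>a. Polynomial.monom a 1) ` I \<union> {Polynomial.monom D d'})"

lemma symbolic_algebra_facts:
  shows is_subring_symbolic_algebra: "is_subring symbolic_algebra"
    and const_symbolic_algebra: "[:a:] \<in> symbolic_algebra"
    and D_symbolic_algebra: "Polynomial.monom D d' \<in> symbolic_algebra"
    and rees_symbolic_algebra: "rees \<subseteq> symbolic_algebra"
proof -
  show *: "is_subring symbolic_algebra" "[:a:] \<in> symbolic_algebra" for a
    by (simp_all add: symbolic_algebra_def is_subring_subalgebra_t const_subalgebra_t)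
  show "Polynomial.monom D d' \<in> symbolic_algebra"
    unfolding symbolic_algebra_def by (rule gen_subalgebra_t) simp
  show "rees \<subseteq> symbolic_algebra"
    by (intro rees_least *) (auto simp: symbolic_algebra_def intro!: gen_subalgebra_t f_mem)
qed

text \<open>The weight \<open>e - d l\<close> of \<open>H t\<^sup>l\<close> decides. If it is \<open>-a < 0\<close>, then \<open>H = p(f) D\<^sup>a\<close>. If it is \<open>a \<ge> 0\<close>,
  then \<open>p(f) = D\<^sup>a H\<close>, so that \<open>g\<^sub>i(f t)\<^sup>a = (x\<^sub>i D t\<^sup>d\<^sup>')\<^sup>a\<close> multiplies \<open>H t\<^sup>l\<close> into the Rees algebra, and \<open>(S\<^sub>2)\<close>
  applies.\<close>

lemma saturated_form_mem:
  assumes serre: "serre_S 2 (ring_on rees)"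
    and H: "form e H" and x: "\<And>i. mvar i ^ s * H \<in> powI l"
  shows "Polynomial.monom H l \<in> symbolic_algebra"
proof (cases "H = 0")
  case True
  then show ?thesis by (simp add: is_subringD(2)[OF is_subring_symbolic_algebra])
next
  case False
  from saturated_form[OF H False x] obtain p k where p: "form k p" "p \<noteq> 0"
    and k: "k + d * d' * l = d' * e + l" and eq: "D ^ (d * l) * at_f p = D ^ e * H" by blast
  have p_rees: "Polynomial.monom (at_f p) k \<in> rees" by (rule powI_rees[OF at_f_powI[OF p(1)]])
  show ?thesis
  proof (cases "e < d * l")
    case True
    define a where "a = d * l - e"
    have a: "d * l = e + a" using True by (simp add: a_def)
    have "D ^ e * (D ^ a * at_f p) = D ^ e * H" using eq unfolding a by (simp add: power_add mult.assoc)
    then have "D ^ a * at_f p = H" using D0 by simp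
    moreover have "d' * a + k = l"
    proof -
      have "d * d' * l = d' * (d * l)" by simp
      then have "d * d' * l = d' * e + d' * a" unfolding a by (simp add: distrib_left)
      then show ?thesis using k by simp
    qed
    ultimately have "Polynomial.monom H l = Polynomial.monom D d' ^ a * Polynomial.monom (at_f p) k"
      by (simp add: monom_power mult_monom)
    also have "\<dots> \<in> symbolic_algebra"
      using p_rees rees_symbolic_algebra D_symbolic_algebra
      by (intro is_subringD(5,7)[OF is_subring_symbolic_algebra]) auto
    finally show ?thesis .
  next
    case nonneg: False
    define a where "a = e - d * l"
    have a: "e = d * l + a" using nonneg by (simp add: a_def)
    have "D ^ (d * l) * at_f p = D ^ (d * l) * (D ^ a * H)" using eq unfolding a by (simp add: power_add mult.assoc)
    then have fp: "at_f p = D ^ a * H" using D0 by simp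
    have kl: "k = l + d' * a"
    proof -
      have "d' * e = d * d' * l + d' * a" unfolding a by (simp add: distrib_left)
      then show ?thesis using k by simp
    qed
    obtain i where gi: "g i \<noteq> 0"
      using gf[of undefined] D0 mvar_nonzero by (metis is_homD(4)[OF hom_at(1)] no_zero_divisors)
    have "at_ft (g i ^ a) = Polynomial.monom ((mvar i * D) ^ a) (d' * a)"
      by (simp add: is_homD(7)[OF hom_at(3)] at_ft_form[OF g_form] gf monom_power)
    then have "at_ft (g i ^ a) * Polynomial.monom H l = [:mvar i ^ a:] * Polynomial.monom (at_f p) k"
      unfolding fp kl by (simp add: mult_monom smult_monom power_mult_distrib mult.assoc add.commute)
    also have "\<dots> \<in> rees" by (rule is_subringD(5)[OF is_subring_rees const_rees p_rees])
    finally have "at_ft (g i ^ a) * Polynomial.monom H l \<in> rees" .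
    moreover have "[:mvar i:] ^ s * Polynomial.monom H l \<in> rees" for i
    proof -
      have "[:mvar i:] ^ s = [:mvar i ^ s :: ('n, 'k) mpoly:]" by (rule is_homD(7)[OF is_hom_pconst, symmetric])
      then show ?thesis using powI_rees[OF x[of i]] by (simp add: smult_monom)
    qed
    moreover have "g i ^ a \<noteq> 0" using gi by simp
    ultimately have "Polynomial.monom H l \<in> rees" using rees_S2[OF serre] by blast
    then show ?thesis using rees_symbolic_algebra by blast
  qed
qed

text \<open>The base ideal is homogeneous, hence so are its powers.\<close>

lemma hcomp_powI: "a \<in> powI l \<Longrightarrow> hcomp e a \<in> powI l"
proof -
  note ideal = is_ideal_ideal_power[OF is_ideal_I]
  have sum: "sum h Y \<in> J" if "is_ideal UNIV J" "\<And>y. y \<in> Y \<Longrightarrow> h y \<in> J"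
    for J and h :: "nat \<Rightarrow> ('n, 'k) mpoly" and Y
    using that(2) by (induction Y rule: infinite_finite_induct) (auto intro: is_idealD(2,3)[OF that(1)])
  have "I \<subseteq> {a. \<forall>e. hcomp e a \<in> I}"
  proof (rule I_least)
    show "is_ideal UNIV {a. \<forall>e. hcomp e a \<in> I}"
      unfolding is_ideal_def using is_idealD(2-4)[OF is_ideal_I]
      by (auto simp: hcomp_zero hcomp_add hcomp_mult intro!: sum[OF is_ideal_I])
    show "f i \<in> {a. \<forall>e. hcomp e a \<in> I}" for i
      using f_mem is_idealD(2)[OF is_ideal_I] by (auto simp: hcomp_form[OF f_form])
  qed
  then have I: "hcomp e b \<in> I" if "b \<in> I" for b e using that by blast
  assume "a \<in> powI l"
  then have "\<forall>e. hcomp e a \<in> powI l"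
  proof (rule ideal_power_induct[OF is_ideal_I, of "\<lambda>l a. \<forall>e. hcomp e a \<in> powI l", rotated 3])
    show "\<forall>e. hcomp e a \<in> powI 0" for a by (simp add: ideal_power_0)
    show "\<forall>e. hcomp e (a + b) \<in> powI l"
      if "\<forall>e. hcomp e a \<in> powI l" "\<forall>e. hcomp e b \<in> powI l" for l a b
      using that is_idealD(3)[OF ideal] by (simp add: hcomp_add)
    show "\<forall>e. hcomp e (a * b) \<in> powI (Suc l)" if "\<forall>e. hcomp e a \<in> powI l" "b \<in> I" for l a b
      unfolding hcomp_mult using that I
      by (intro allI sum[OF ideal] ideal_power_mult_right[OF is_ideal_I]) auto
  qed
  then show ?thesis by blast
qed

text \<open>The powers of the \<open>x\<^sub>i\<close> are taken equal, and then each homogeneous component of \<open>H\<close> is treated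
  separately.\<close>

lemma saturated_mem:
  assumes serre: "serre_S 2 (ring_on rees)" and x: "\<And>i. \<exists>k. mvar i ^ k * H \<in> powI l"
  shows "Polynomial.monom H l \<in> symbolic_algebra"
proof -
  note ideal = is_ideal_ideal_power[OF is_ideal_I]
  obtain k where k: "\<And>i. mvar i ^ k i * H \<in> powI l" using x by metis
  define s where "s = Max (range k)"
  have s: "mvar i ^ s * H \<in> powI l" for i
  proof -
    have "k i \<le> s" by (simp add: s_def)
    then have "mvar i ^ s * H = mvar i ^ (s - k i) * (mvar i ^ k i * H)"
      by (simp add: mult.assoc flip: power_add)
    then show ?thesis using is_idealD(4)[OF ideal UNIV_I k[of i]] by metis
  qed
  have "mvar i ^ s * hcomp e H \<in> powI l" for i e
  proof -
    have "form s (mvar i ^ s :: ('n, 'k) mpoly)" using form_power[OF form_mvar] by (metis mult_1)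
    from hcomp_form_mult[OF this, of e H] show ?thesis using hcomp_powI[OF s[of i], of "s + e"] by simp
  qed
  then have mem: "Polynomial.monom (hcomp e H) l \<in> symbolic_algebra" for e
    by (rule saturated_form_mem[OF serre form_hcomp])
  have "Polynomial.monom H l = (\<Sum>e\<le>degree (homog H). Polynomial.monom (hcomp e H) l)"
    by (subst (1) sum_hcomp[symmetric]) (simp add: poly_eq_iff coeff_sum)
  then show ?thesis using mem by (simp add: is_subringD(8)[OF is_subring_symbolic_algebra])
qed

subsection \<open>The symbolic Rees algebra\<close>

text \<open>The element \<open>w\<close> stems from the depth of \<open>R/I\<close>. It makes \<open>D\<close>, which the \<open>x\<^sub>i\<close> multiply into
  \<open>I\<^sup>d\<^sup>'\<close>, an element of the symbolic power.\<close>

theorem symbolic_rees_algebra_eq: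
  assumes serre: "serre_S 2 (ring_on rees)"
    and sat: "\<And>l h i. l \<ge> 1 \<Longrightarrow> h \<in> symbolic_power (ring_on UNIV) I l \<Longrightarrow> \<exists>k. mvar i ^ k * h \<in> powI l"
    and w: "w \<in> Idl\<^bsub>ring_on UNIV\<^esub> (range mvar)" "\<And>r. w * r \<in> I \<Longrightarrow> r \<in> I"
  shows "symbolic_rees_algebra I = symbolic_algebra"
proof
  let ?S = "symbolic_power (ring_on UNIV) I"
  note ideal = is_ideal_ideal_power[OF is_ideal_I] and sym = symbolic_power_iff[OF is_ideal_I]
  have def: "symbolic_rees_algebra I = {p. \<forall>l. coeff p l \<in> ?S l}"
    by (simp add: symbolic_rees_algebra_def ring_on_UNIV)
  show "symbolic_rees_algebra I \<subseteq> symbolic_algebra"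
  proof
    fix p assume p: "p \<in> symbolic_rees_algebra I"
    have "Polynomial.monom (coeff p l) l \<in> symbolic_algebra" for l
    proof (cases "l = 0")
      case True
      then show ?thesis using const_symbolic_algebra by (simp add: monom_0)
    next
      case False
      then show ?thesis using p sat[of l "coeff p l"] by (intro saturated_mem[OF serre]) (simp add: def)
    qed
    then have "(\<Sum>l\<le>degree p. Polynomial.monom (coeff p l) l) \<in> symbolic_algebra"
      by (intro is_subringD(8)[OF is_subring_symbolic_algebra])
    then show "p \<in> symbolic_algebra" by (simp only: poly_as_sum_of_monoms)
  qed
  have powI_sym: "a \<in> ?S l" if "a \<in> powI l" for a l
    unfolding sym using that one_nonassoc[OF is_ideal_I] by (intro bexI[of _ 1]) auto
  have zero: "0 \<in> ?S l" for l
    by (rule powI_sym[OF is_idealD(2)[OF ideal]])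
  have diff: "a - b \<in> ?S l"
    if ab: "a \<in> ?S l" "b \<in> ?S l" for a b l
  proof -
    obtain u v where u: "u \<in> nonassoc I" "u * a \<in> powI l" and v: "v \<in> nonassoc I" "v * b \<in> powI l"
      using ab unfolding sym by blast
    have "v * (u * a) - u * (v * b) \<in> powI l"
      by (intro is_ideal_diff[OF is_subring_UNIV ideal] is_idealD(4)[OF ideal] UNIV_I u v)
    then have "(u * v) * (a - b) \<in> powI l" by (simp add: algebra_simps)
    then show ?thesis unfolding sym using mult_nonassoc[OF is_ideal_I u(1) v(1)] by blast
  qed
  have mult: "a * b \<in> ?S (l + m)"
    if ab: "a \<in> ?S l" "b \<in> ?S m" for a b l m
  proof -
    obtain u v where u: "u \<in> nonassoc I" "u * a \<in> powI l" and v: "v \<in> nonassoc I" "v * b \<in> powI m"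
      using ab unfolding sym by blast
    have "(u * a) * (v * b) \<in> powI (l + m)" by (rule ideal_power_mult[OF is_ideal_I u(2) v(2)])
    then have "(u * v) * (a * b) \<in> powI (l + m)" by (simp add: mult_ac)
    then show ?thesis unfolding sym using mult_nonassoc[OF is_ideal_I u(1) v(1)] by blast
  qed
  have sum: "sum h Y \<in> ?S l"
    if "\<And>y. y \<in> Y \<Longrightarrow> h y \<in> ?S l" for h :: "nat \<Rightarrow> ('n, 'k) mpoly" and Y l
    using that
  proof (induction Y rule: infinite_finite_induct)
    case (insert y F)
    have "h y - (0 - sum h F) \<in> ?S l"
      using insert by (intro diff zero) auto
    then show ?case using insert by simp
  qed (simp_all add: zero)
  have const: "[:a:] \<in> symbolic_rees_algebra I" for a
    using zero symbolic_power_0[OF is_ideal_I] by (auto simp: def coeff_pCons split: nat.split)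
  have "D \<in> ?S d'"
  proof -
    have "is_ideal UNIV {r. r * D \<in> powI d'}"
      unfolding is_ideal_def using is_idealD(2-4)[OF ideal] by (auto simp: distrib_right mult.assoc)
    moreover have "mvar i * D \<in> powI d'" for i using at_f_powI[OF g_form[of i]] by (simp add: gf)
    ultimately have "Idl\<^bsub>ring_on UNIV\<^esub> (range mvar) \<subseteq> {r. r * D \<in> powI d'}"
      by (intro genideal_least) auto
    then show ?thesis unfolding sym using w nonzerodivisor_nonassoc[OF is_ideal_I] by blast
  qed
  then have D: "Polynomial.monom D d' \<in> symbolic_rees_algebra I" by (simp add: def zero)
  show "symbolic_algebra \<subseteq> symbolic_rees_algebra I"
    unfolding symbolic_algebra_def
  proof (rule subalgebra_t_least)
    show "is_subring (symbolic_rees_algebra I)"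
      unfolding is_subring_def
    proof (intro conjI ballI)
      show "1 \<in> symbolic_rees_algebra I" using const[of 1] by (simp add: one_pCons)
      fix p q assume pq: "p \<in> symbolic_rees_algebra I" "q \<in> symbolic_rees_algebra I"
      then show "p - q \<in> symbolic_rees_algebra I" by (simp add: def diff)
      have "coeff p i * coeff q (l - i) \<in> ?S l" if "i \<le> l" for i l
        using mult[of "coeff p i" i "coeff q (l - i)" "l - i"] pq that by (simp add: def)
      then show "p * q \<in> symbolic_rees_algebra I" by (auto simp: def coeff_mult intro!: sum)
    qed
    show "(\<lambda>a. Polynomial.monom a 1) ` I \<union> {Polynomial.monom D d'} \<subseteq> symbolic_rees_algebra I"
      using D powI_sym[OF ideal_power_one[OF is_ideal_I]] zero by (auto simp: def)
  qed (rule const)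
qed

end

section \<open>The presentation ideal\<close>

lemma a_kernel_UNIV:
  "a_kernel ring_of_type_algebra ring_of_type_algebra h = {p. h p = (0 :: 'b::comm_ring_1)}"
  by (auto simp: a_kernel_def kernel_def ring_of_type_algebra_def)

text \<open>To show that an additive group is everything, it is enough that it contains \<open>1\<close> and is closed under
  multiplication by generators: its multipliers form a subring.\<close>

lemma is_subring_multipliers:
  assumes diff: "\<And>a b. a \<in> C \<Longrightarrow> b \<in> C \<Longrightarrow> a - b \<in> C"
  shows "is_subring {v. \<forall>u\<in>C. v * u \<in> C}"
  unfolding is_subring_def using diff by (auto simp: left_diff_distrib mult.assoc)

lemma is_ideal_kernel: "is_hom h \<Longrightarrow> is_ideal UNIV {p. h p = 0}"
  by (auto simp: is_ideal_def is_homD)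

lemma hom_poly_map:
  assumes h: "is_hom h"
  shows "h (poly p x) = poly (map_poly h p) (h x)"
  by (induction p) (simp_all add: is_homD[OF h] map_poly_pCons)

lemma map_poly_hom:
  assumes h: "is_hom h"
  shows "map_poly h (p + q) = map_poly h p + map_poly h q"
    "map_poly h (p - q) = map_poly h p - map_poly h q" "map_poly h (smult c p) = smult (h c) (map_poly h p)"
  by (rule poly_eqI, simp add: coeff_map_poly is_homD[OF h])+

context cremona
begin

abbreviation z :: "('n option, ('n, 'k) mpoly) mpoly" where "z \<equiv> mvar None"

definition to_rees :: "('n, ('n, 'k) mpoly) mpoly \<Rightarrow> ('n, 'k) mpoly poly" where
  "to_rees = msubst (\<lambda>a. [:a:]) (\<lambda>i. Polynomial.monom (f i) 1)"

definition to_symbolic :: "('n option, ('n, 'k) mpoly) mpoly \<Rightarrow> ('n, 'k) mpoly poly" where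
  "to_symbolic = msubst (\<lambda>a. [:a:])
     (case_option (Polynomial.monom D d') (\<lambda>i. Polynomial.monom (f i) 1))"

definition relations :: "('n option, ('n, 'k) mpoly) mpoly set" where
  "relations = Idl\<^bsub>ring_on UNIV\<^esub> (incl_xyz ` {p. to_rees p = 0} \<union>
     {mconst (mvar i) * z - form_in_y (g i) | i. True})"

lemma homs:
  "is_hom (incl_xyz :: ('n, ('n, 'k) mpoly) mpoly \<Rightarrow> _)" "is_hom (form_in_y :: ('n, 'k) mpoly \<Rightarrow> _)"
  "is_hom to_rees" "is_hom to_symbolic"
  unfolding incl_xyz_def form_in_y_def to_rees_def to_symbolic_def
  by (intro is_hom_msubst is_hom_mconst is_hom_pconst is_hom_comp[OF is_hom_mconst is_hom_mconst])+

lemma incl_generators: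
  "incl_xyz (mconst a) = (mconst a :: ('n option, ('n, 'k) mpoly) mpoly)"
  "incl_xyz (mvar i) = (mvar (Some i) :: ('n option, ('n, 'k) mpoly) mpoly)"
  by (simp_all add: incl_xyz_def msubst_mconst msubst_mvar is_hom_mconst)

lemma form_in_y_generators:
  "form_in_y (mconst c) = (mconst (mconst c) :: ('n option, ('n, 'k) mpoly) mpoly)"
  "form_in_y (mvar i) = (mvar (Some i) :: ('n option, ('n, 'k) mpoly) mpoly)"
  unfolding form_in_y_def
  by (rule msubst_mconst msubst_mvar, rule is_hom_comp[OF is_hom_mconst is_hom_mconst])+

lemma target_generators:
  "to_symbolic (mconst a) = [:a:]" "to_symbolic z = Polynomial.monom D d'"
  "to_symbolic (mvar (Some i)) = Polynomial.monom (f i) 1"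
  "to_rees (mconst a) = [:a:]" "to_rees (mvar i) = Polynomial.monom (f i) 1"
  "at_ft (mconst c) = [:mconst c:]" "at_ft (mvar i) = Polynomial.monom (f i) 1"
  by (simp_all add: to_symbolic_def to_rees_def at_ft_def msubst_mconst msubst_mvar is_hom_pconst is_hom_const_poly)

lemma to_symbolic_incl: "to_symbolic (incl_xyz p) = to_rees p"
  by (rule hom_eqI[OF is_hom_comp[OF homs(4,1)] homs(3)]) (simp_all add: incl_generators target_generators)

lemma to_symbolic_form_in_y: "to_symbolic (form_in_y q) = at_ft q"
  by (rule hom_eqI[OF is_hom_comp[OF homs(4,2)] hom_at(3)]) (simp_all add: form_in_y_generators target_generators)

lemma form_in_y_incl: "\<exists>p. form_in_y q = (incl_xyz p :: ('n option, ('n, 'k) mpoly) mpoly)"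
proof -
  let ?C = "range (incl_xyz :: ('n, ('n, 'k) mpoly) mpoly \<Rightarrow> _)"
  have "is_subring ?C"
    unfolding is_subring_def using is_homD(1,3,6)[OF homs(1)] by (auto simp: image_iff) metis+
  from is_subringD(1,3,5)[OF this] have "is_subring {q. form_in_y q \<in> ?C}"
    unfolding is_subring_def by (simp add: is_homD(1,3,6)[OF homs(2)])
  then have "{q. form_in_y q \<in> ?C} = UNIV"
  proof (rule mpoly_generated)
    show "mconst c \<in> {q. form_in_y q \<in> ?C}" for c
      using incl_generators(1)[of "mconst c"] by (auto simp: form_in_y_generators image_iff intro: exI[of _ "mconst (mconst c)"])
    show "mvar i \<in> {q. form_in_y q \<in> ?C}" for i
      using incl_generators(2)[of i] by (auto simp: form_in_y_generators image_iff intro: exI[of _ "mvar i"])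
  qed
  then show ?thesis by blast
qed

lemma relations_facts:
  shows is_ideal_relations: "is_ideal UNIV relations"
    and incl_relations: "to_rees p = 0 \<Longrightarrow> incl_xyz p \<in> relations"
    and xz_relations: "mconst (mvar i) * z - form_in_y (g i) \<in> relations"
  unfolding relations_def
  by (auto intro: is_ideal_genideal subsetD[OF subset_genideal])

lemma relations_kernel: "relations \<subseteq> {p. to_symbolic p = 0}"
  unfolding relations_def
proof (rule genideal_least[OF is_ideal_kernel[OF homs(4)]])
  have "to_symbolic (mconst (mvar i) * z - form_in_y (g i)) = 0" for i
    by (simp add: is_homD[OF homs(4)] target_generators to_symbolic_form_in_y
        at_ft_form[OF g_form] gf smult_monom)
  then show "incl_xyz ` {p. to_rees p = 0} \<union> {mconst (mvar i) * z - form_in_y (g i) | i. True}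
      \<subseteq> {p. to_symbolic p = 0}"
    by (auto simp: to_symbolic_incl)
qed

subsection \<open>Normal forms modulo the relations\<close>

text \<open>The relations \<open>x\<^sub>i z = g\<^sub>i(y)\<close> remove all \<open>x\<^sub>i\<close> from the coefficients of positive powers of \<open>z\<close>.\<close>

definition normal_form ::
  "('n, ('n, 'k) mpoly) mpoly \<Rightarrow> ('n, 'k) mpoly poly \<Rightarrow> ('n option, ('n, 'k) mpoly) mpoly" where
  "normal_form p q = incl_xyz p + z * poly (map_poly form_in_y q) z"

definition reducible :: "('n option, ('n, 'k) mpoly) mpoly set" where
  "reducible = {u. \<exists>p q. u - normal_form p q \<in> relations}"

lemma reducible_cong:
  assumes "u - v \<in> relations" "v \<in> reducible"
  shows "u \<in> reducible"
proof -
  obtain p q where "v - normal_form p q \<in> relations" using assms(2) by (auto simp: reducible_def)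
  then have "(u - v) + (v - normal_form p q) \<in> relations"
    using is_idealD(3)[OF is_ideal_relations assms(1)] by blast
  then show ?thesis by (auto simp: reducible_def)
qed

lemma normal_form_reducible: "normal_form p q \<in> reducible"
  using is_idealD(2)[OF is_ideal_relations] by (auto simp: reducible_def intro!: exI[of _ p] exI[of _ q])

lemma incl_reducible: "incl_xyz p \<in> reducible"
  using normal_form_reducible[of p 0] by (simp add: normal_form_def)

lemma reducible_diff:
  assumes "u \<in> reducible" "v \<in> reducible"
  shows "u - v \<in> reducible"
proof -
  obtain p q p' q' where u: "u - normal_form p q \<in> relations" and v: "v - normal_form p' q' \<in> relations"
    using assms by (auto simp: reducible_def)
  have "normal_form p q - normal_form p' q' = normal_form (p - p') (q - q')"
    by (simp add: normal_form_def is_homD[OF homs(1)] map_poly_hom[OF homs(2)] algebra_simps)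
  then have eq: "(u - v) - normal_form (p - p') (q - q') = (u - normal_form p q) - (v - normal_form p' q')"
    by (simp add: algebra_simps)
  have "(u - v) - normal_form (p - p') (q - q') \<in> relations"
    unfolding eq by (rule is_ideal_diff[OF is_subring_UNIV is_ideal_relations u v])
  then show ?thesis unfolding reducible_def by blast
qed

lemma reducible_add:
  assumes "u \<in> reducible" "v \<in> reducible"
  shows "u + v \<in> reducible"
proof -
  have "0 \<in> reducible" using reducible_diff[OF assms(1) assms(1)] by simp
  from reducible_diff[OF assms(1) reducible_diff[OF this assms(2)]] show ?thesis by simp
qed

lemma reducible_mult:
  assumes nf: "\<And>p q. a * normal_form p q \<in> reducible" and u: "u \<in> reducible"
  shows "a * u \<in> reducible"
proof -
  obtain p q where "u - normal_form p q \<in> relations" using u by (auto simp: reducible_def)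
  then have "a * (u - normal_form p q) \<in> relations" using is_idealD(4)[OF is_ideal_relations] by blast
  then show ?thesis using reducible_cong[OF _ nf, of "a * u" p q] by (simp add: right_diff_distrib)
qed

lemma form_in_y_reducible:
  assumes "u \<in> reducible"
  shows "form_in_y s * u \<in> reducible"
proof (rule reducible_mult[OF _ assms])
  fix p q
  obtain r where r: "form_in_y s = (incl_xyz r :: ('n option, ('n, 'k) mpoly) mpoly)"
    using form_in_y_incl by blast
  have "form_in_y s * normal_form p q = normal_form (r * p) (smult s q)"
    by (simp add: normal_form_def is_homD[OF homs(1)] map_poly_hom[OF homs(2)] algebra_simps r)
  then show "form_in_y s * normal_form p q \<in> reducible" using normal_form_reducible by simp
qed

lemma poly_form_in_y_reducible: "poly (map_poly form_in_y q) z \<in> reducible"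
proof -
  obtain a r where q: "q = pCons a r" by (cases q)
  obtain p where p: "form_in_y a = (incl_xyz p :: ('n option, ('n, 'k) mpoly) mpoly)"
    using form_in_y_incl by blast
  have "poly (map_poly form_in_y q) z = normal_form p r"
    by (simp add: q map_poly_pCons is_homD(4)[OF homs(2)] normal_form_def p)
  then show ?thesis using normal_form_reducible by simp
qed

lemma mvar_x_reducible:
  assumes "u \<in> reducible"
  shows "mconst (mvar i) * u \<in> reducible"
proof (rule reducible_mult[OF _ assms])
  fix p q
  let ?r = "poly (map_poly form_in_y q) z"
  have "?r * (mconst (mvar i) * z - form_in_y (g i)) \<in> relations"
    by (rule is_idealD(4)[OF is_ideal_relations UNIV_I xz_relations])
  then have "mconst (mvar i) * (z * ?r) - form_in_y (g i) * ?r \<in> relations" by (simp add: algebra_simps)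
  then have 1: "mconst (mvar i) * (z * ?r) \<in> reducible"
    by (rule reducible_cong[OF _ form_in_y_reducible[OF poly_form_in_y_reducible]])
  have 2: "mconst (mvar i) * incl_xyz p \<in> reducible"
    using incl_reducible[of "mconst (mvar i) * p"] by (simp add: is_homD(3)[OF homs(1)] incl_generators)
  show "mconst (mvar i) * normal_form p q \<in> reducible"
    using reducible_add[OF 2 1] by (simp add: normal_form_def distrib_left)
qed

lemma const_reducible:
  assumes "u \<in> reducible"
  shows "mconst a * u \<in> reducible"
proof -
  let ?C = "{v. \<forall>u\<in>reducible. v * u \<in> reducible}"
  have C: "is_subring ?C" by (rule is_subring_multipliers[OF reducible_diff])
  have hom: "is_hom (mconst :: ('n, 'k) mpoly \<Rightarrow> ('n option, ('n, 'k) mpoly) mpoly)" by (rule is_hom_mconst)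
  have "is_subring {a. mconst a \<in> ?C}"
    unfolding is_subring_def
  proof (intro conjI ballI CollectI)
    show "mconst 1 * u \<in> reducible" if "u \<in> reducible" for u
      using that by (simp add: is_homD(1)[OF hom])
    fix a b u assume a: "a \<in> {a. mconst a \<in> ?C}" and b: "b \<in> {a. mconst a \<in> ?C}" and u: "u \<in> reducible"
    have ab: "mconst a \<in> ?C" "mconst b \<in> ?C" by (rule CollectD[OF a], rule CollectD[OF b])
    show "mconst (a - b) * u \<in> reducible" "mconst (a * b) * u \<in> reducible"
      using is_subringD(3,5)[OF C ab] u by (simp_all add: is_homD[OF hom])
  qed
  then have "{a. mconst a \<in> ?C} = UNIV"
  proof (rule mpoly_generated)
    show "mconst c \<in> {a. mconst a \<in> ?C}" for c
      using form_in_y_reducible[of _ "mconst c"] by (simp add: form_in_y_generators)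
    show "mvar i \<in> {a. mconst a \<in> ?C}" for i using mvar_x_reducible by simp
  qed
  then show ?thesis using assms by blast
qed

lemma z_incl_reducible: "z * incl_xyz p \<in> reducible"
proof -
  let ?C = "{p. z * incl_xyz p \<in> reducible}"
  note hom = is_homD[OF homs(1)]
  have C: "is_subring {v. \<forall>u\<in>?C. v * u \<in> ?C}"
    by (rule is_subring_multipliers) (auto simp: hom right_diff_distrib intro: reducible_diff)
  have "{v. \<forall>u\<in>?C. v * u \<in> ?C} = UNIV"
  proof (rule mpoly_generated[OF C])
    have "z * incl_xyz (mconst a * u) = mconst a * (z * incl_xyz u)"
      "z * incl_xyz (mvar i * u) = form_in_y (mvar i) * (z * incl_xyz u)" for a i u
      by (simp_all add: hom incl_generators form_in_y_generators mult_ac)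
    then show "mconst a \<in> {v. \<forall>u\<in>?C. v * u \<in> ?C}" "mvar i \<in> {v. \<forall>u\<in>?C. v * u \<in> ?C}" for a i
      using const_reducible[of _ a] form_in_y_reducible[of _ "mvar i"] by simp_all
  qed
  moreover have "1 \<in> ?C"
    using normal_form_reducible[of 0 1]
    by (simp add: normal_form_def hom map_poly_1 is_homD(1)[OF homs(2)])
  ultimately have "p * 1 \<in> ?C" by blast
  then show ?thesis by simp
qed

lemma all_reducible: "u \<in> reducible"
proof -
  let ?C = "{v. \<forall>u\<in>reducible. v * u \<in> reducible}"
  have "?C = UNIV"
  proof (rule mpoly_generated[OF is_subring_multipliers[OF reducible_diff]])
    show "mconst a \<in> ?C" for a using const_reducible by simp
    have "z * u \<in> reducible" if "u \<in> reducible" for u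
    proof (rule reducible_mult[OF _ that])
      fix p q
      have "z * (z * poly (map_poly form_in_y q) z) \<in> reducible"
        using normal_form_reducible[of 0 "pCons 0 q"]
        by (simp add: normal_form_def is_homD(4)[OF homs(1)] is_homD(4)[OF homs(2)] map_poly_pCons)
      from reducible_add[OF z_incl_reducible this] show "z * normal_form p q \<in> reducible"
        by (simp add: normal_form_def distrib_left)
    qed
    then show "mvar v \<in> ?C" for v
      using form_in_y_reducible[of _ "mvar (the v)"] by (cases v) (simp_all add: form_in_y_generators)
  qed
  moreover have "1 \<in> reducible" using incl_reducible[of 1] by (simp add: is_homD(1)[OF homs(1)])
  ultimately have "u * 1 \<in> reducible" by blast
  then show ?thesis by simp
qed

lemma to_rees_mem: "to_rees p \<in> rees"
proof -
  have "is_subring {p. to_rees p \<in> rees}"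
    unfolding is_subring_def
    by (auto simp: is_homD[OF homs(3)] intro: is_subringD(1,3,5)[OF is_subring_rees])
  then have "{p. to_rees p \<in> rees} = UNIV"
    using I_rees[OF f_mem]
    by (intro mpoly_generated) (simp_all add: target_generators const_rees)
  then show ?thesis by blast
qed

text \<open>The terms of a normal form have different weights in the target: those without \<open>z\<close> have
  nonnegative weight, and \<open>z\<^sup>m q(y)\<close> has weight \<open>-m\<close>.\<close>

lemma normal_form_kernel:
  assumes "to_symbolic (normal_form p q) = 0"
  shows "q = 0"
proof -
  let ?M = "Polynomial.monom D d'"
  have "poly (map_poly at_ft q) ?M = to_symbolic (poly (map_poly form_in_y q) z)"
    by (simp add: hom_poly_map[OF homs(4)] target_generators map_poly_map_poly is_homD(4)[OF homs(2)]
        is_homD(4)[OF homs(4)] o_def to_symbolic_form_in_y)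
  then have total: "to_rees p + ?M * poly (map_poly at_ft q) ?M = 0"
    using assms by (simp add: normal_form_def is_homD[OF homs(4)] to_symbolic_incl target_generators)
  have deg: "degree (map_poly at_ft q) \<le> degree q" by (rule degree_le) (simp add: coeff_map_poly coeff_eq_0 is_homD(4)[OF hom_at(3)])
  have "poly (map_poly at_ft q) ?M = (\<Sum>j\<le>degree q. coeff (map_poly at_ft q) j * ?M ^ j)"
    unfolding poly_altdef using deg by (intro sum.mono_neutral_left) (auto simp: coeff_eq_0)
  then have tail: "?M * poly (map_poly at_ft q) ?M =
      (\<Sum>j\<le>degree q. Polynomial.monom (D ^ Suc j) (d' * Suc j) * at_ft (coeff q j))"
    by (simp add: sum_distrib_left coeff_map_poly is_homD(4)[OF hom_at(3)] monom_power mult_ac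
        flip: mult_monom)
  have term_form: "form (d * l - m) (coeff (Polynomial.monom (D ^ m) (d' * m) * at_ft u) l)
      \<and> (coeff (Polynomial.monom (D ^ m) (d' * m) * at_ft u) l \<noteq> 0 \<longrightarrow> m \<le> d * l)" for l m u
  proof (cases "d' * m \<le> l")
    case False
    then show ?thesis by (simp add: coeff_monom_mult form_def)
  next
    case True
    then obtain k where k: "l = d' * m + k" using le_Suc_ex by blast
    have dl: "d * l = m + (dD * m + d * k)"
      unfolding k using dd' by (simp add: distrib_left flip: mult.assoc)
    have "form (dD * m + d * k) (D ^ m * at_f (hcomp k u))"
      by (intro form_mult form_power[OF D_form] at_f_form form_hcomp)
    then show ?thesis using dl by (simp add: coeff_monom_mult k coeff_at_ft)
  qed
  have "hcomp i (coeff q j) = 0" for i j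
  proof (cases "j \<le> degree q")
    case False
    then show ?thesis by (simp add: coeff_eq_0 hcomp_zero)
  next
    case True
    let ?m = "Suc j"
    define l where "l = d' * ?m + i"
    have dl: "d * l = ?m + (dD * ?m + d * i)"
      unfolding l_def using dd' by (simp add: distrib_left flip: mult.assoc)
    \<comment> \<open>In this degree and at \<open>t\<^sup>l\<close> only one term of the normal form is visible.\<close>
    let ?e = "d * l - ?m"
    have "hcomp ?e (coeff (Polynomial.monom (D ^ Suc j') (d' * Suc j') * at_ft (coeff q j')) l) =
        (if j' = j then D ^ ?m * at_f (hcomp i (coeff q j)) else 0)" for j'
    proof (cases "j' = j")
      case True
      have "coeff (Polynomial.monom (D ^ ?m) (d' * ?m) * at_ft (coeff q j)) l = D ^ ?m * at_f (hcomp i (coeff q j))"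
        by (simp add: coeff_monom_mult l_def coeff_at_ft)
      moreover from this have "form ?e (D ^ ?m * at_f (hcomp i (coeff q j)))"
        using term_form[of l ?m "coeff q j"] by metis
      ultimately show ?thesis using hcomp_form[of ?e _ ?e] True by metis
    next
      case False
      have "d * l - Suc j' \<noteq> ?e" if "Suc j' \<le> d * l" using that dl False by linarith
      then show ?thesis
        using term_form[of l "Suc j'" "coeff q j'"] False
        by (metis hcomp_form)
    qed
    moreover have "hcomp ?e (coeff (to_rees p) l) = 0"
      using dl by (intro rees_weight_nonneg[OF to_rees_mem]) simp
    ultimately have "hcomp ?e (coeff (to_rees p + ?M * poly (map_poly at_ft q) ?M) l) =
        D ^ ?m * at_f (hcomp i (coeff q j))"
      using True unfolding tail by (simp add: hcomp_add coeff_sum hcomp_sum)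
    then have "D ^ ?m * at_f (hcomp i (coeff q j)) = 0"
      unfolding total by (simp add: hcomp_zero)
    then show ?thesis using D0 at_f_inj[OF form_hcomp] by simp
  qed
  then have "coeff q j = 0" for j using sum_hcomp[of "coeff q j"] by simp
  then show ?thesis by (simp add: poly_eq_iff)
qed

theorem symbolic_presentation_ideal_eq:
  "symbolic_presentation_ideal f D d' = Idl\<^bsub>ring_of_type_algebra\<^esub>
     (incl_xyz ` rees_presentation_ideal f \<union> {mconst (mvar i) * mvar None - form_in_y (g i) | i. True})"
proof -
  have "u \<in> relations" if u: "to_symbolic u = 0" for u
  proof -
    obtain p q where pq: "u - normal_form p q \<in> relations" using all_reducible[of u] by (auto simp: reducible_def)
    then have "to_symbolic (u - normal_form p q) = 0" using relations_kernel by blast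
    then have nf: "to_symbolic (normal_form p q) = 0" using u by (simp add: is_homD(6)[OF homs(4)])
    then have "q = 0" by (rule normal_form_kernel)
    then have nf_eq: "normal_form p q = incl_xyz p" by (simp add: normal_form_def)
    then have "to_rees p = 0" using nf by (simp add: to_symbolic_incl)
    then have "normal_form p q \<in> relations" unfolding nf_eq by (rule incl_relations)
    then show ?thesis using is_idealD(3)[OF is_ideal_relations pq] by fastforce
  qed
  then have "{u. to_symbolic u = 0} = relations" using relations_kernel by blast
  then show ?thesis
    by (simp add: symbolic_presentation_ideal_def rees_presentation_ideal_def a_kernel_UNIV relations_def
        to_symbolic_def to_rees_def ring_on_UNIV)
qed

end

section \<open>The inversion factor on the target side\<close>

lemma mvar_dvd_iff:
  fixes p :: "('v, 'a::comm_ring_1) mpoly"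
  shows "mvar v dvd p \<longleftrightarrow> (\<forall>m. Poly_Mapping.lookup p m \<noteq> 0 \<longrightarrow> Poly_Mapping.lookup m v > 0)"
proof
  assume "mvar v dvd p"
  then obtain c where "p = c * mvar v ^ 1" by (auto simp: dvd_def mult.commute)
  then show "\<forall>m. Poly_Mapping.lookup p m \<noteq> 0 \<longrightarrow> Poly_Mapping.lookup m v > 0"
    using lookup_mult_mvar_power_less[of _ v 1 c] by auto
next
  assume pos: "\<forall>m. Poly_Mapping.lookup p m \<noteq> 0 \<longrightarrow> Poly_Mapping.lookup m v > 0"
  have "mvar v dvd Poly_Mapping.single m (Poly_Mapping.lookup p m)" if "m \<in> Poly_Mapping.keys p" for m
  proof -
    have "Poly_Mapping.lookup m v > 0" using pos that by (simp add: in_keys_iff)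
    then have eq: "Poly_Mapping.single v 1 + (m - Poly_Mapping.single v 1) = m"
      by (intro poly_mapping_eqI) (auto simp: lookup_add lookup_minus lookup_single when_def)
    have "Poly_Mapping.single m (Poly_Mapping.lookup p m) =
        mvar v * Poly_Mapping.single (m - Poly_Mapping.single v 1) (Poly_Mapping.lookup p m)"
      unfolding mvar_def mult_single eq mult_1 ..
    then show ?thesis by simp
  qed
  then have "mvar v dvd (\<Sum>m\<in>Poly_Mapping.keys p. Poly_Mapping.single m (Poly_Mapping.lookup p m))"
    by (intro dvd_sum)
  then show "mvar v dvd p" by (simp add: sum_single_lookup)
qed

lemma mvar_dvd_mult_other:
  fixes p :: "('v, 'a::comm_ring_1) mpoly"
  assumes "i \<noteq> j" "mvar i dvd p * mvar j"
  shows "mvar i dvd p"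
  unfolding mvar_dvd_iff
proof (intro allI impI)
  fix m assume "Poly_Mapping.lookup p m \<noteq> 0"
  then have "Poly_Mapping.lookup (p * mvar j) (m + Poly_Mapping.single j 1) \<noteq> 0"
    using lookup_mult_mvar_power[of p j 1 m] by simp
  then have "Poly_Mapping.lookup (m + Poly_Mapping.single j 1) i > 0"
    using assms(2) unfolding mvar_dvd_iff by blast
  then show "Poly_Mapping.lookup m i > 0" using assms(1) by (simp add: lookup_add lookup_single)
qed

lemma mvar_not_unit: "\<not> mvar v dvd (1 :: ('v, 'a::comm_ring_1) mpoly)"
proof
  assume "mvar v dvd (1 :: ('v, 'a) mpoly)"
  moreover have "Poly_Mapping.lookup (1 :: ('v, 'a) mpoly) 0 \<noteq> 0" by simp
  ultimately have "Poly_Mapping.lookup (0 :: 'v \<Rightarrow>\<^sub>0 nat) v > 0" unfolding mvar_dvd_iff by blast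
  then show False by simp
qed

text \<open>With one variable only, the variable would be a common factor.\<close>

lemma two_variables:
  fixes g :: "'n::finite \<Rightarrow> ('n, 'k::field) mpoly"
  assumes g: "\<And>i. form d' (g i)" and d': "d' > 0" and gcd: "no_common_factor g"
  shows "\<exists>j. j \<noteq> (i :: 'n)"
proof (rule ccontr)
  assume "\<not> ?thesis"
  then have U: "(UNIV :: 'n set) = {i}" by auto
  have "mvar i dvd g j" for j
    unfolding mvar_dvd_iff
  proof (intro allI impI)
    fix m assume "Poly_Mapping.lookup (g j) m \<noteq> 0"
    then have "monom_deg m = d'" using g[of j] by (simp add: form_iff_lookup)
    then show "Poly_Mapping.lookup m i > 0" using d' by (simp add: monom_deg_UNIV U)
  qed
  then have "mvar i dvd (1 :: ('n, 'k) mpoly)" using gcd unfolding no_common_factor_def by blast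
  then show False by (simp add: mvar_not_unit)
qed

text \<open>The variable \<open>y\<^sub>i\<close> divides \<open>h\<^sub>i y\<^sub>j = h\<^sub>j y\<^sub>i\<close>, and so divides \<open>h\<^sub>i\<close> if \<open>j \<noteq> i\<close>. In one variable the
  claim fails for constant \<open>h\<close>.\<close>

lemma same_rational_map_identity:
  fixes h :: "'n::{finite, linorder} \<Rightarrow> ('n, 'k::field) mpoly"
  assumes same: "same_rational_map h mvar" and two: "\<And>i :: 'n. \<exists>j. j \<noteq> i"
  obtains E where "\<And>i. h i = mvar i * E"
proof -
  have eq: "h i * mvar j = h j * mvar i" for i j using same by (simp add: same_rational_map_def)
  have "\<exists>E. h i = mvar i * E" for i
  proof -
    obtain j where "j \<noteq> i" using two by blast
    moreover have "mvar i dvd h i * mvar j" unfolding eq[of i j] by simp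
    ultimately have "mvar i dvd h i" using mvar_dvd_mult_other[of i j "h i"] by blast
    then show ?thesis by (simp add: dvd_def)
  qed
  then obtain E where E: "\<And>i. h i = mvar i * E i" by metis
  have nz: "mvar i \<noteq> (0 :: ('n, 'k) mpoly)" for i using mvar_not_unit[of i] by (metis dvd_0_left_iff mvar_def lookup_single_eq lookup_zero zero_neq_one)
  have "E i = E undefined" for i
  proof -
    have "(mvar i * mvar undefined) * E i = (mvar i * mvar undefined) * E undefined"
      using eq[of i undefined] unfolding E by (simp add: mult_ac)
    then show ?thesis using nz by simp
  qed
  then show thesis using that E by metis
qed

lemma irrelevant_ideal:
  fixes J :: "('n::{finite, linorder}, 'k::field) mpoly set"
  defines "J \<equiv> Idl\<^bsub>ring_on UNIV\<^esub> (range mvar)"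
  shows one_notin_irrelevant: "1 \<notin> J" and form_irrelevant: "form d p \<Longrightarrow> d > 0 \<Longrightarrow> p \<in> J"
proof -
  have J: "is_ideal UNIV J" unfolding J_def by (rule is_ideal_genideal)
  have mem: "mvar i \<in> J" for i unfolding J_def by (rule subsetD[OF subset_genideal rangeI])
  have hom: "is_hom (hcomp 0 :: ('n, 'k) mpoly \<Rightarrow> _)"
    unfolding is_hom_def by (simp add: hcomp_add hcomp_mult) (simp add: hcomp_def is_homD(1)[OF is_hom_homog])
  have "J \<subseteq> {p. hcomp 0 p = 0}"
    unfolding J_def by (rule genideal_least[OF is_ideal_kernel[OF hom]]) (auto simp: hcomp_form[OF form_mvar])
  then show "1 \<notin> J" using is_homD(1)[OF hom] by auto
  have "is_subring {p. p - hcomp 0 p \<in> J}"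
    unfolding is_subring_def
  proof (intro conjI ballI CollectI)
    show "1 - hcomp 0 1 \<in> J" using is_idealD(2)[OF J] by (simp add: is_homD(1)[OF hom])
    fix a b assume "a \<in> {p. p - hcomp 0 p \<in> J}" "b \<in> {p. p - hcomp 0 p \<in> J}"
    then have ab: "a - hcomp 0 a \<in> J" "b - hcomp 0 b \<in> J" by simp_all
    show "a - b - hcomp 0 (a - b) \<in> J"
      using is_ideal_diff[OF is_subring_UNIV J ab] by (simp add: hcomp_diff algebra_simps)
    have "b * (a - hcomp 0 a) + hcomp 0 a * (b - hcomp 0 b) \<in> J"
      by (intro is_idealD(3,4)[OF J] UNIV_I ab)
    then show "a * b - hcomp 0 (a * b) \<in> J" by (simp add: is_homD(3)[OF hom] algebra_simps)
  qed
  then have "{p. p - hcomp 0 p \<in> J} = UNIV"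
  proof (rule mpoly_generated)
    show "mconst a \<in> {p. p - hcomp 0 p \<in> J}" for a
    proof -
      have "hcomp 0 (mconst a) = (mconst a :: ('n, 'k) mpoly)"
        by (subst hcomp_form[of 0]) (simp_all add: mconst_def form_single monom_deg_def)
      then show ?thesis using is_idealD(2)[OF J] by simp
    qed
    show "mvar i \<in> {p. p - hcomp 0 p \<in> J}" for i
      using mem by (simp add: hcomp_form[OF form_mvar])
  qed
  then have "p - hcomp 0 p \<in> J" by blast
  then show "p \<in> J" if "form d p" "d > 0" using that by (simp add: hcomp_form)
qed

section \<open>The symbolic Rees algebra and its presentation\<close>

theorem theorem2p1:
  fixes f g :: "'n::{finite, linorder} \<Rightarrow> ('n, 'k::field) mpoly"
    and D :: "('n, 'k) mpoly"
    and d' :: nat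
    and R :: "('n, 'k) mpoly ring"
    and I :: "('n, 'k) mpoly set"
  defines "R \<equiv> ring_of_type_algebra"
    and "I \<equiv> base_ideal f"
  assumes "infinite (UNIV :: 'k set)"
    and "cremona_map f"
    and "depth R irrelevant_ideal (quot_module (self_module R) I) > 0"
    and "represents_inverse g f"
    and "\<forall>i. form d' (g i)"
    and "no_common_factor g"
    and "source_inversion_factor f g D"
    and "\<forall>l\<ge>1.
           zero_module (quot_module ((self_module R)\<lparr>carrier := symbolic_power R I l\<rparr>) (ideal_power R I l)) \<or>
           primary_module R irrelevant_ideal
             (quot_module ((self_module R)\<lparr>carrier := symbolic_power R I l\<rparr>) (ideal_power R I l))"
    and "serre_S 2 (ring_of_type_algebra\<lparr>carrier := rees_algebra I\<rparr>)"
  shows "symbolic_rees_algebra I =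
           subalgebra_t ((\<lambda>a. Polynomial.monom a 1) ` I \<union> {Polynomial.monom D d'}) \<and>
         symbolic_presentation_ideal f D d' =
           Idl\<^bsub>ring_of_type_algebra\<^esub>
             (incl_xyz ` rees_presentation_ideal f \<union>
              {mconst (mvar i) * mvar None - form_in_y (g i) | i. True})"
proof -
  note R_eq = R_def[folded ring_on_UNIV]
  have irr: "irrelevant_ideal = Idl\<^bsub>ring_on UNIV\<^esub> (range (mvar :: 'n \<Rightarrow> ('n, 'k) mpoly))"
    by (simp add: irrelevant_ideal_def ring_on_UNIV)
  obtain d where f_form: "\<And>i. form d (f i)" using assms(4) by (auto simp: cremona_map_def)
  have g_form: "form d' (g i)" for i using assms(7) by blast
  obtain dD where D_form: "form dD D" and gf: "\<And>i. msubst mconst f (g i) = mvar i * D"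
    using assms(9) by (auto simp: source_inversion_factor_def)
  obtain i0 where "comp_rep g f i0 \<noteq> 0"
    using assms(6) by (auto simp: represents_inverse_def rational_map_rep_def)
  then have nz: "mvar i0 * D \<noteq> 0" using gf by (simp add: comp_rep_def)
  then have D0: "D \<noteq> 0" by auto
  have "form (d * d') (mvar i0 * D)" unfolding gf[symmetric] by (rule form_msubst[OF g_form f_form])
  then have dd': "d * d' = 1 + dD" using form_unique[OF _ form_mult[OF form_mvar D_form] nz] by blast
  then have pos: "d > 0" "d' > 0" by (auto intro!: Nat.gr0I)
  have same: "same_rational_map (comp_rep f g) mvar" and "\<exists>i. comp_rep f g i \<noteq> 0"
    using assms(6) by (auto simp: represents_inverse_def rational_map_rep_def)
  obtain E where E: "\<And>i. comp_rep f g i = mvar i * E"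
    using same_rational_map_identity[OF same two_variables[OF g_form pos(2) assms(8)]] by blast
  have E0: "E \<noteq> 0" using \<open>\<exists>i. comp_rep f g i \<noteq> 0\<close> E by auto
  interpret cremona f g D E d d' dD
    using f_form g_form D_form gf E D0 E0 dd' assms(8) by unfold_locales (simp_all add: comp_rep_def)
  have I_sub: "I \<subseteq> irrelevant_ideal"
    unfolding irr I_def by (rule I_least[OF is_ideal_genideal form_irrelevant[OF f_form pos(1)]])
  obtain w where w: "w \<in> irrelevant_ideal" "\<And>r. w * r \<in> I \<Longrightarrow> r \<in> I"
    using depth_pos_nonzerodivisor[of I irrelevant_ideal] is_ideal_I is_ideal_genideal one_notin_irrelevant
      I_sub assms(5) unfolding irr R_eq I_def by metis
  have mvar_irr: "(mvar i :: ('n, 'k) mpoly) \<in> irrelevant_ideal" for i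
    unfolding irr by (rule subsetD[OF subset_genideal rangeI])
  have sat: "\<exists>k. mvar i ^ k * h \<in> ideal_power (ring_on UNIV) (base_ideal f) l"
    if "l \<ge> 1" "h \<in> symbolic_power (ring_on UNIV) (base_ideal f) l" for l h i
    using symbolic_power_saturation[OF is_ideal_I noetherian_mpoly _ that(2) mvar_irr] assms(10) that(1)
    unfolding R_eq I_def by blast
  have "serre_S 2 (ring_on (rees_algebra (base_ideal f)))"
    using assms(11) unfolding I_def ring_on_def .
  from symbolic_rees_algebra_eq[OF this sat w[unfolded irr I_def]] symbolic_presentation_ideal_eq
  show ?thesis unfolding I_def symbolic_algebra_def by blast
qed

end
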